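(* The graded tensor product $V^\sigma(z_1)*\dots*V^\sigma(z_n)$ does not depend (as an $\mathfrak{osp}(1,2)[t]^\sigma$-module) on the complex parameters $z_i$ satisfying $z_i^2\ne z_j^2$ for all $i\ne j$. The vectors $$e_{a_1}\cdots e_{a_s}\,g^+_{b_1}\cdots g^+_{b_k}\,w^\sigma_{-n},\qquad 1\le b_1<\dots<b_k\le 2n-1,\quad 0\le a_1\le\dots\le a_s\le 2(n-k-s),$$ with all $a_i$ even and all $b_j$ odd, form a basis of the twisted Weyl module $W^\sigma_{-n}$.
   Context: Everything is over $\mathbb{C}$. $\mathfrak{osp}(1,2)$ is the Lie superalgebra with even part $\mathfrak{sl}_2$ (standard basis $e,h,f$) and odd part $\pi_1$ with basis $g^+,g^-$; the nontrivial brackets are $[e,f]=h$, $[h,e]=2e$, $[h,f]=-2f$, $[h,g^\pm]=\pm g^\pm$, $[g^+,g^-]_+=h$, $[g^+,g^+]_+=2e$, $[g^-,g^-]_+=-2f$, $[f,g^+]=-g^-$, $[e,g^-]=-g^+$. Write $y_i=y\otimes t^i$. The twisted current algebra is $\mathfrak{osp}(1,2)[t]^\sigma=\bigoplus_{i\ge0}\mathfrak{sl}_2\otimes t^{2i}\oplus\bigoplus_{i\ge0}\pi_1\otimes t^{2i+1}$. $W^\sigma_{-n}$ is the cyclic, $\mathfrak{sl}_2$-integrable $\mathfrak{osp}(1,2)[t]^\sigma$-module with generator $w_{-n}^\sigma$ and defining relations $f_{2i}w^\sigma_{-n}=0$, $g^-_{2i+1}w^\sigma_{-n}=0$, $h_{2i+2}w^\sigma_{-n}=0$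 ($i\ge0$), $h_0w^\sigma_{-n}=-nw^\sigma_{-n}$, $e_0^{n+1}w^\sigma_{-n}=0$. $V$ is the $3$-dimensional irreducible $\mathfrak{osp}(1,2)$-module ($h$-weights $-1,0,1$), with cyclic vector its lowest weight vector $\mathsf v$, taken to be even. For $z\in\mathbb{C}$, $V^\sigma(z)$ is $V$ with $y\otimes t^k\in\mathfrak{osp}(1,2)[t]^\sigma$ acting as $z^ky$. Tensor products use the sign rule $y(a\otimes b)=ya\otimes b+(-1)^{|y||a|}a\otimes yb$. Let $U=U(\mathfrak{osp}(1,2)[t]^\sigma)=\bigoplus_{s\ge0}U_s$ be graded by $t$-degree, and let $F_s=\sum_{r\le s}U_r(\mathsf v\otimes\dots\otimes \mathsf v)\subset V^\sigma(z_1)\otimes\dots\otimes V^\sigma(z_n)$. The graded tensor product $V^\sigma(z_1)*\dots*V^\sigma(z_n)$ is the associated graded module of $F_\bullet$.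
   Formalization: The parameters z_i are additionally required to be nonzero; without this the independence claim fails, e.g. for n = 1 the graded tensor product has dimension 2 at z_1 = 0 and dimension 3 for z_1 ≠ 0. *)

theory Defs
  imports Complex_Main "HOL-Library.Poly_Mapping" "HOL-Algebra.Module" "HOL-Algebra.AbelCoset"
begin

section \<open>Complex vector spaces with a chosen basis\<close>

text \<open>
  The vector space with basis \<open>'a\<close> is the type \<open>'a \<Rightarrow>\<^sub>0 complex\<close>; the basis vector of \<open>a\<close> is
  \<open>Poly_Mapping.single a 1\<close>.
\<close>

definition cscale :: "complex \<Rightarrow> ('a \<Rightarrow>\<^sub>0 complex) \<Rightarrow> ('a \<Rightarrow>\<^sub>0 complex)"
  where "cscale c x = Poly_Mapping.map ((*) c) x"

lemma lookup_cscale [simp]: "Poly_Mapping.lookup (cscale c x) a = c * Poly_Mapping.lookup x a"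
  unfolding cscale_def by (simp add: map.rep_eq when_def)

lemma cscale_single [simp]: "cscale c (Poly_Mapping.single a d) = Poly_Mapping.single a (c * d)"
  by (intro poly_mapping_eqI) (simp add: lookup_single when_def)

interpretation cvec: vector_space "cscale :: complex \<Rightarrow> ('a \<Rightarrow>\<^sub>0 complex) \<Rightarrow> _"
  by unfold_locales (auto intro!: poly_mapping_eqI simp: lookup_add algebra_simps)

definition lin_ext :: "('a \<Rightarrow> ('b \<Rightarrow>\<^sub>0 complex)) \<Rightarrow> ('a \<Rightarrow>\<^sub>0 complex) \<Rightarrow> ('b \<Rightarrow>\<^sub>0 complex)"
  where "lin_ext f x = (\<Sum>a\<in>Poly_Mapping.keys x. cscale (Poly_Mapping.lookup x a) (f a))"

section \<open>The Lie superalgebra osp(1,2) and its twisted current algebra\<close>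

datatype osp = OE | OH | OF | OGp | OGm

fun osp_odd :: "osp \<Rightarrow> bool" where
  "osp_odd OGp = True"
| "osp_odd OGm = True"
| "osp_odd _ = False"

definition ssign :: "bool \<Rightarrow> bool \<Rightarrow> complex"
  where "ssign p q = (if p \<and> q then -1 else 1)"

abbreviation osp_vec :: "complex \<Rightarrow> osp \<Rightarrow> (osp \<Rightarrow>\<^sub>0 complex)"
  where "osp_vec c y \<equiv> Poly_Mapping.single y c"

fun osp_bracket :: "osp \<Rightarrow> osp \<Rightarrow> (osp \<Rightarrow>\<^sub>0 complex)" where
  "osp_bracket OE OF = osp_vec 1 OH"
| "osp_bracket OF OE = osp_vec (-1) OH"
| "osp_bracket OH OE = osp_vec 2 OE"
| "osp_bracket OE OH = osp_vec (-2) OE"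
| "osp_bracket OH OF = osp_vec (-2) OF"
| "osp_bracket OF OH = osp_vec 2 OF"
| "osp_bracket OH OGp = osp_vec 1 OGp"
| "osp_bracket OGp OH = osp_vec (-1) OGp"
| "osp_bracket OH OGm = osp_vec (-1) OGm"
| "osp_bracket OGm OH = osp_vec 1 OGm"
| "osp_bracket OGp OGm = osp_vec 1 OH"
| "osp_bracket OGm OGp = osp_vec 1 OH"
| "osp_bracket OGp OGp = osp_vec 2 OE"
| "osp_bracket OGm OGm = osp_vec (-2) OF"
| "osp_bracket OF OGp = osp_vec (-1) OGm"
| "osp_bracket OGp OF = osp_vec 1 OGm"
| "osp_bracket OE OGm = osp_vec (-1) OGp"
| "osp_bracket OGm OE = osp_vec 1 OGp"
| "osp_bracket _ _ = 0"

lemma osp_bracket_skew: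
  "osp_bracket a b = cscale (- ssign (osp_odd a) (osp_odd b)) (osp_bracket b a)"
  by (cases a; cases b) (simp_all add: ssign_def)

lemma osp_bracket_jacobi:
  "lin_ext (osp_bracket a) (osp_bracket b c) =
     lin_ext (\<lambda>d. osp_bracket d c) (osp_bracket a b) +
     cscale (ssign (osp_odd a) (osp_odd b)) (lin_ext (osp_bracket b) (osp_bracket a c))"
  by (cases a; cases b; cases c)
    (simp_all add: lin_ext_def ssign_def flip: single_add single_diff single_uminus)

text \<open>The basis vectors \<open>y \<otimes> t\<^sup>k\<close> of the twisted current algebra: \<open>k\<close> is even for \<open>y\<close> in \<open>sl\<^sub>2\<close>
  and odd for \<open>y = g\<^sup>\<plusminus>\<close>.\<close>

typedef tcur = "{(y :: osp, k :: nat). osp_odd y \<longleftrightarrow> odd k}"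
  by (rule exI[of _ "(OE, 0)"]) simp

text \<open>\<open>tw y k\<close> is \<open>y\<^sub>k = y \<otimes> t\<^sup>k\<close>; it is only meaningful if \<open>k\<close> has the parity of \<open>y\<close>.\<close>

definition tw :: "osp \<Rightarrow> nat \<Rightarrow> tcur" where "tw y k = Abs_tcur (y, k)"
definition tosp :: "tcur \<Rightarrow> osp" where "tosp a = fst (Rep_tcur a)"
definition tdeg :: "tcur \<Rightarrow> nat" where "tdeg a = snd (Rep_tcur a)"
definition tparity :: "tcur \<Rightarrow> bool" where "tparity a \<longleftrightarrow> osp_odd (tosp a)"

definition tbracket :: "tcur \<Rightarrow> tcur \<Rightarrow> (tcur \<Rightarrow>\<^sub>0 complex)"
  where "tbracket a b =
    lin_ext (\<lambda>y. Poly_Mapping.single (tw y (tdeg a + tdeg b)) 1) (osp_bracket (tosp a) (tosp b))"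

section \<open>The universal enveloping superalgebra\<close>

text \<open>The free monoid, so that \<open>tcur mon \<Rightarrow>\<^sub>0 complex\<close> with the convolution product of
  \<^theory>\<open>HOL-Library.Poly_Mapping\<close> is the free associative algebra (tensor algebra).\<close>

datatype 'a mon = Mon (letters: "'a list")

instantiation mon :: (type) monoid_add
begin
definition "0 = Mon []"
definition "u + v = Mon (letters u @ letters v)"
instance by standard (auto simp: zero_mon_def plus_mon_def)
end

type_synonym free_alg = "tcur mon \<Rightarrow>\<^sub>0 complex"

definition free_gen :: "tcur \<Rightarrow> free_alg"
  where "free_gen a = Poly_Mapping.single (Mon [a]) 1"

definition env_relator :: "tcur \<Rightarrow> tcur \<Rightarrow> free_alg"
  where "env_relator a b =
    free_gen a * free_gen b - cscale (ssign (tparity a) (tparity b)) (free_gen b * free_gen a)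
      - lin_ext free_gen (tbracket a b)"

inductive_set env_ideal :: "free_alg set" where
  zero: "0 \<in> env_ideal"
| gen: "x * env_relator a b * y \<in> env_ideal"
| add: "x \<in> env_ideal \<Longrightarrow> y \<in> env_ideal \<Longrightarrow> x + y \<in> env_ideal"

lemma env_ideal_mult_left: "x \<in> env_ideal \<Longrightarrow> u * x \<in> env_ideal"
  by (induction rule: env_ideal.induct)
    (auto intro: env_ideal.intros simp: distrib_left simp flip: mult.assoc)

lemma env_ideal_mult_right: "x \<in> env_ideal \<Longrightarrow> x * u \<in> env_ideal"
proof (induction rule: env_ideal.induct)
  case (gen x a b y)
  then show ?case using env_ideal.gen[of x a b "y * u"] by (simp add: mult.assoc)
qed (auto intro: env_ideal.intros simp: distrib_right)

lemma env_ideal_uminus: "x \<in> env_ideal \<Longrightarrow> - x \<in> env_ideal"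
  using env_ideal_mult_left[of x "-1"] by simp

lemma env_ideal_diff: "x \<in> env_ideal \<Longrightarrow> y \<in> env_ideal \<Longrightarrow> x - y \<in> env_ideal"
  using env_ideal.add[of x "- y"] env_ideal_uminus[of y] by simp

definition env_rel :: "free_alg \<Rightarrow> free_alg \<Rightarrow> bool"
  where "env_rel x y \<longleftrightarrow> x - y \<in> env_ideal"

quotient_type env = free_alg / env_rel
proof (rule equivpI)
  show "reflp env_rel" by (auto simp: reflp_def env_rel_def intro: env_ideal.zero)
  show "symp env_rel" using env_ideal_uminus by (fastforce simp: symp_def env_rel_def)
  show "transp env_rel"
  proof (rule transpI)
    fix x y z assume "env_rel x y" "env_rel y z"
    then have "(x - y) + (y - z) \<in> env_ideal" unfolding env_rel_def by (rule env_ideal.add)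
    then show "env_rel x z" by (simp add: env_rel_def)
  qed
qed

instantiation env :: "{ring, monoid_mult}"
begin

lift_definition zero_env :: env is 0 .
lift_definition one_env :: env is 1 .
lift_definition plus_env :: "env \<Rightarrow> env \<Rightarrow> env" is "(+)"
proof -
  fix x x' y y' assume "env_rel x x'" "env_rel y y'"
  then have "(x - x') + (y - y') \<in> env_ideal" unfolding env_rel_def by (rule env_ideal.add)
  then show "env_rel (x + y) (x' + y')" by (simp add: env_rel_def algebra_simps)
qed
lift_definition uminus_env :: "env \<Rightarrow> env" is "uminus"
  using env_ideal_uminus by (fastforce simp: env_rel_def)
lift_definition minus_env :: "env \<Rightarrow> env \<Rightarrow> env" is "(-)"
proof -
  fix x x' y y' assume "env_rel x x'" "env_rel y y'"
  then have "(x - x') - (y - y') \<in> env_ideal" unfolding env_rel_def by (rule env_ideal_diff)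
  then show "env_rel (x - y) (x' - y')" by (simp add: env_rel_def algebra_simps)
qed
lift_definition times_env :: "env \<Rightarrow> env \<Rightarrow> env" is "(*)"
proof -
  fix x x' y y' assume "env_rel x x'" "env_rel y y'"
  then have "(x - x') * y + x' * (y - y') \<in> env_ideal"
    unfolding env_rel_def by (intro env_ideal.add env_ideal_mult_left env_ideal_mult_right)
  then show "env_rel (x * y) (x' * y')" by (simp add: env_rel_def algebra_simps)
qed

instance
  by standard (transfer; simp add: env_rel_def env_ideal.zero algebra_simps)+

end

lift_definition env_const :: "complex \<Rightarrow> env" is "\<lambda>c. Poly_Mapping.single 0 c" .
lift_definition env_gen :: "tcur \<Rightarrow> env" is free_gen .

text \<open>The even (\<open>p = False\<close>) and odd (\<open>p = True\<close>) part.\<close>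

definition env_parity :: "bool \<Rightarrow> env set"
  where "env_parity p = abs_env `
    {x. \<forall>w\<in>Poly_Mapping.keys x. odd (length (filter tparity (letters w))) = p}"

section \<open>Modules over the twisted current algebra\<close>

text \<open>A complex vector space \<open>M\<close> (in the format of \<^theory>\<open>HOL-Algebra.Module\<close>; the fields
  \<^const>\<open>monoid.mult\<close> and \<^const>\<open>monoid.one\<close> are not used) with the action of the basis
  \<open>tcur\<close> and with its even part \<open>parity_part M False\<close> and odd part \<open>parity_part M True\<close>.\<close>

record 'm tmod = "(complex, 'm) module" +
  act :: "tcur \<Rightarrow> 'm \<Rightarrow> 'm"
  parity_part :: "bool \<Rightarrow> 'm set"

definition tmod_iso :: "'m tmod \<Rightarrow> 'k tmod \<Rightarrow> bool"
  where "tmod_iso M N \<longleftrightarrow> (\<exists>\<phi>. bij_betw \<phi> (carrier M) (carrier N)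
    \<and> (\<forall>x\<in>carrier M. \<forall>y\<in>carrier M. \<phi> (x \<oplus>\<^bsub>M\<^esub> y) = \<phi> x \<oplus>\<^bsub>N\<^esub> \<phi> y)
    \<and> (\<forall>c. \<forall>x\<in>carrier M. \<phi> (c \<odot>\<^bsub>M\<^esub> x) = c \<odot>\<^bsub>N\<^esub> \<phi> x)
    \<and> (\<forall>a. \<forall>x\<in>carrier M. \<phi> (act M a x) = act N a (\<phi> x))
    \<and> (\<forall>p. \<phi> ` parity_part M p = parity_part N p))"

text \<open>\<open>sl\<^sub>2\<close>-integrability: \<open>e\<^sub>0\<close> and \<open>f\<^sub>0\<close> act locally nilpotently.\<close>

definition sl2_integrable :: "'m tmod \<Rightarrow> bool"
  where "sl2_integrable M \<longleftrightarrow>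
    (\<forall>x\<in>carrier M. \<exists>N. (act M (tw OE 0) ^^ N) x = \<zero>\<^bsub>M\<^esub> \<and> (act M (tw OF 0) ^^ N) x = \<zero>\<^bsub>M\<^esub>)"

definition tmod_quot :: "'m tmod \<Rightarrow> 'm set \<Rightarrow> 'm set tmod"
  where "tmod_quot M J =
    \<lparr> carrier = a_rcosets\<^bsub>M\<^esub> J, mult = undefined, one = undefined,
      zero = J, add = set_add M,
      smult = (\<lambda>c A. \<Union>x\<in>A. J +>\<^bsub>M\<^esub> (c \<odot>\<^bsub>M\<^esub> x)),
      act = (\<lambda>a A. \<Union>x\<in>A. J +>\<^bsub>M\<^esub> act M a x),
      parity_part = (\<lambda>p. {J +>\<^bsub>M\<^esub> x |x. x \<in> parity_part M p}) \<rparr>"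

definition regular_tmod :: "env tmod"
  where "regular_tmod =
    \<lparr> carrier = UNIV, mult = undefined, one = undefined, zero = 0, add = (+),
      smult = (\<lambda>c u. env_const c * u), act = (\<lambda>a u. env_gen a * u),
      parity_part = env_parity \<rparr>"

text \<open>A family \<open>f\<close> indexed by \<open>I\<close> is a basis; in particular its members are pairwise distinct.\<close>

definition is_basis_family :: "'m tmod \<Rightarrow> ('i \<Rightarrow> 'm) \<Rightarrow> 'i set \<Rightarrow> bool"
  where "is_basis_family M f I \<longleftrightarrow> f ` I \<subseteq> carrier M
    \<and> (\<forall>x\<in>carrier M. \<exists>S c. finite S \<and> S \<subseteq> I \<and> x = (\<Oplus>\<^bsub>M\<^esub>i\<in>S. c i \<odot>\<^bsub>M\<^esub> f i))
    \<and> (\<forall>S c. finite S \<longrightarrow> S \<subseteq> I \<longrightarrow> (\<Oplus>\<^bsub>M\<^esub>i\<in>S. c i \<odot>\<^bsub>M\<^esub> f i) = \<zero>\<^bsub>M\<^esub> \<longrightarrow> (\<forall>i\<in>S. c i = 0))"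

section \<open>The twisted Weyl modules\<close>

definition left_ideal :: "env set \<Rightarrow> bool"
  where "left_ideal J \<longleftrightarrow> 0 \<in> J \<and> (\<forall>x\<in>J. \<forall>y\<in>J. x + y \<in> J) \<and> (\<forall>u. \<forall>x\<in>J. u * x \<in> J)"

definition weyl_relators :: "nat \<Rightarrow> env set"
  where "weyl_relators n =
    {env_gen (tw OF (2 * i)) |i. True} \<union> {env_gen (tw OGm (2 * i + 1)) |i. True}
    \<union> {env_gen (tw OH (2 * i + 2)) |i. True}
    \<union> {env_gen (tw OH 0) + env_const (of_nat n), env_gen (tw OE 0) ^ (n + 1)}"

text \<open>The defining relations of the Weyl module are to be read in the category of
  \<open>sl\<^sub>2\<close>-integrable modules: a cyclic module is a quotient of the enveloping algebra by a left
  ideal, and the universal integrable one satisfying the relations is the quotient by the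
  smallest left ideal containing the relators and having an integrable quotient. (The
  intersection below is itself such an ideal, since \<open>e\<^sub>0\<close> and \<open>f\<^sub>0\<close> act nilpotently on the
  generator by the relations and ad-nilpotently on every element of the enveloping algebra.)\<close>

definition weyl_ideal :: "nat \<Rightarrow> env set"
  where "weyl_ideal n =
    \<Inter> {J. left_ideal J \<and> weyl_relators n \<subseteq> J \<and> sl2_integrable (tmod_quot regular_tmod J)}"

definition weyl_module :: "nat \<Rightarrow> env set tmod"
  where "weyl_module n = tmod_quot regular_tmod (weyl_ideal n)"

definition weyl_gen :: "nat \<Rightarrow> env set"
  where "weyl_gen n = weyl_ideal n +>\<^bsub>regular_tmod\<^esub> 1"

definition weyl_index :: "nat \<Rightarrow> (nat list \<times> nat list) set"
  where "weyl_index n = {(as, bs).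
    sorted_wrt (<) bs \<and> (\<forall>b\<in>set bs. odd b \<and> 1 \<le> b \<and> int b \<le> 2 * int n - 1)
    \<and> sorted as \<and> (\<forall>a\<in>set as. even a \<and> int a \<le> 2 * (int n - int (length bs) - int (length as)))}"

definition weyl_vec :: "nat \<Rightarrow> nat list \<times> nat list \<Rightarrow> env set"
  where "weyl_vec n = (\<lambda>(as, bs).
    foldr (\<lambda>a. act (weyl_module n) (tw OE a)) as
      (foldr (\<lambda>b. act (weyl_module n) (tw OGp b)) bs (weyl_gen n)))"

section \<open>Tensor products of evaluation modules\<close>

text \<open>The three-dimensional irreducible module: \<open>VM = v\<close> is the (even) lowest weight vector,
  \<open>V0 = g\<^sup>+ v\<close> and \<open>VP = e v\<close>.\<close>

datatype vbas = VM | V0 | VP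

fun vbas_odd :: "vbas \<Rightarrow> bool" where
  "vbas_odd V0 = True"
| "vbas_odd _ = False"

fun vact :: "osp \<Rightarrow> vbas \<Rightarrow> (vbas \<Rightarrow>\<^sub>0 complex)" where
  "vact OE VM = Poly_Mapping.single VP 1"
| "vact OF VP = Poly_Mapping.single VM 1"
| "vact OH VM = Poly_Mapping.single VM (-1)"
| "vact OH VP = Poly_Mapping.single VP 1"
| "vact OGp VM = Poly_Mapping.single V0 1"
| "vact OGp V0 = Poly_Mapping.single VP 1"
| "vact OGm V0 = Poly_Mapping.single VM (-1)"
| "vact OGm VP = Poly_Mapping.single V0 1"
| "vact _ _ = 0"

lemma vact_bracket:
  "lin_ext (\<lambda>y. vact y v) (osp_bracket a b) =
     lin_ext (vact a) (vact b v)
     - cscale (ssign (osp_odd a) (osp_odd b)) (lin_ext (vact b) (vact a v))"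
  by (cases a; cases b; cases v)
    (simp_all add: lin_ext_def ssign_def flip: single_add single_diff single_uminus)

text \<open>The tensor power \<open>V\<^sup>\<otimes>\<^sup>n\<close> has the words of length \<open>n\<close> in \<open>vbas\<close> as its basis. Iterating the sign
  rule gives
  \<open>y\<^sub>k (b\<^sub>1 \<otimes> \<dots> \<otimes> b\<^sub>n) = (\<Sum>i. (-1)\<^bsup>|y| (|b\<^sub>1| + \<dots> + |b\<^sub>i\<^sub>-\<^sub>1|)\<^esup> z\<^sub>i\<^sup>k b\<^sub>1 \<otimes> \<dots> \<otimes> y b\<^sub>i \<otimes> \<dots> \<otimes> b\<^sub>n)\<close>.\<close>

definition tensor_act_basis :: "complex list \<Rightarrow> tcur \<Rightarrow> vbas list \<Rightarrow> (vbas list \<Rightarrow>\<^sub>0 complex)"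
  where "tensor_act_basis zs a w =
    (\<Sum>i<length w.
      cscale (ssign (tparity a) (odd (length (filter vbas_odd (take i w)))) * (zs ! i) ^ tdeg a)
        (lin_ext (\<lambda>b. Poly_Mapping.single (w[i := b]) 1) (vact (tosp a) (w ! i))))"

definition tensor_module :: "complex list \<Rightarrow> (vbas list \<Rightarrow>\<^sub>0 complex) tmod"
  where "tensor_module zs =
    \<lparr> carrier = {x. \<forall>w\<in>Poly_Mapping.keys x. length w = length zs},
      mult = undefined, one = undefined, zero = 0, add = (+),
      smult = cscale, act = (\<lambda>a. lin_ext (tensor_act_basis zs a)),
      parity_part = (\<lambda>p. {x. \<forall>w\<in>Poly_Mapping.keys x.
        length w = length zs \<and> odd (length (filter vbas_odd w)) = p}) \<rparr>"

definition tensor_gen :: "complex list \<Rightarrow> (vbas list \<Rightarrow>\<^sub>0 complex)"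
  where "tensor_gen zs = Poly_Mapping.single (replicate (length zs) VM) 1"

section \<open>The graded tensor product\<close>

definition word_deg :: "tcur list \<Rightarrow> nat"
  where "word_deg ws = sum_list (map tdeg ws)"

text \<open>\<open>U\<^sub>r\<close> is spanned by the monomials \<open>a\<^sub>1 \<cdots> a\<^sub>k\<close> in the basis \<open>tcur\<close> of total \<open>t\<close>-degree \<open>r\<close>.\<close>

definition tensor_filt :: "complex list \<Rightarrow> nat \<Rightarrow> (vbas list \<Rightarrow>\<^sub>0 complex) set"
  where "tensor_filt zs s = cvec.span
    {foldr (act (tensor_module zs)) ws (tensor_gen zs) |ws. word_deg ws \<le> s}"

text \<open>The associated graded module of an increasing filtration \<open>F\<close> such that
  \<open>act M a\<close> maps \<open>F s\<close> into \<open>F (s + tdeg a)\<close>. An element is a finitely supported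
  sequence of cosets \<open>x s \<in> F s / F (s - 1)\<close>, where \<open>F (-1) = 0\<close>.\<close>

definition filt_prev :: "'m tmod \<Rightarrow> (nat \<Rightarrow> 'm set) \<Rightarrow> nat \<Rightarrow> 'm set"
  where "filt_prev M F s = (if s = 0 then {\<zero>\<^bsub>M\<^esub>} else F (s - 1))"

definition assoc_graded :: "'m tmod \<Rightarrow> (nat \<Rightarrow> 'm set) \<Rightarrow> (nat \<Rightarrow> 'm set) tmod"
  where "assoc_graded M F =
    (let P = filt_prev M F;
         C = {x. (\<forall>s. \<exists>m\<in>F s. x s = P s +>\<^bsub>M\<^esub> m) \<and> finite {s. x s \<noteq> P s}}
     in \<lparr> carrier = C, mult = undefined, one = undefined,
          zero = P, add = (\<lambda>x y s. x s <+>\<^bsub>M\<^esub> y s),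
          smult = (\<lambda>c x s. \<Union>m\<in>x s. P s +>\<^bsub>M\<^esub> (c \<odot>\<^bsub>M\<^esub> m)),
          act = (\<lambda>a x s. if s < tdeg a then P s
                         else \<Union>m\<in>x (s - tdeg a). P s +>\<^bsub>M\<^esub> act M a m),
          parity_part = (\<lambda>p. {x\<in>C. \<forall>s. x s \<inter> parity_part M p \<noteq> {}}) \<rparr>)"

text \<open>If some \<open>z\<^sub>i = 0\<close>, the odd elements act by zero on that factor and the filtration does not
  exhaust the tensor product: for \<open>n = 1\<close> the graded tensor product has dimension 2 if
  \<open>z\<^sub>1 = 0\<close> and dimension 3 otherwise. Independence of the parameters thus needs \<open>z\<^sub>i \<noteq> 0\<close>.\<close>

definition graded_tensor :: "complex list \<Rightarrow> (nat \<Rightarrow> (vbas list \<Rightarrow>\<^sub>0 complex) set) tmod"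
  where "graded_tensor zs = assoc_graded (tensor_module zs) (tensor_filt zs)"

end

theory Submission
  imports Defs "HOL-Computational_Algebra.Formal_Power_Series" "HOL-Computational_Algebra.Polynomial"
begin

text \<open>
  Let \<open>J\<close> be the left ideal of the enveloping algebra generated by the defining relators.

  Upper bound: filter \<open>U / J\<close> by the number of factors \<open>g\<^sup>+\<close> and then by their total degree. On the
  associated graded space, each \<open>g\<^sup>+\<^sub>b\<^sub>1 \<cdots> g\<^sup>+\<^sub>b\<^sub>k w\<close> satisfies the relations of the Weyl module of weight
  \<open>n - k\<close> for the current algebra of \<open>sl\<^sub>2\<close>, and Garland's relations reduce all products of the \<open>e\<^sub>a\<close>
  to the stated ones. So at most \<open>3\<^sup>n\<close> vectors span \<open>U / J\<close>.

  Lower bound: the relators lie in the left ideal \<open>K\<close> that annihilates the generator of the graded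
  tensor product, whose dimension is \<open>3\<^sup>n\<close> because the tensor product of evaluation modules is
  cyclic. Hence \<open>J = K\<close> for all admissible parameters. In particular the quotient by \<open>J\<close> is
  integrable, so that \<open>J\<close> defines the Weyl module, and the graded tensor product is independent of
  the parameters.
\<close>

text \<open>Both bounds are 3^n. V has dimension 3, so the tensor power has dimension 3^n. On the
  other side, a set B of odd indices among n possible ones leaves at most 2^(n - |B|) products of
  the e_a, and these numbers add up to (1 + 2)^n. Counting factors g^+ is not enough for the
  filtration, because h_{2i+2} kills w but not g^+_{b_1} ... g^+_{b_k} w: it raises one of the b_j.
  The total degree absorbs these terms, and it cannot grow forever because g^+_{2i+1} w = 0 for i >=
  n. The elements f and g^- cause no trouble: they shorten the product of the g^+. Modulo the
  smaller pieces the vector is therefore a lowest weight vector of weight k - n. In the tensor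
  product itself the relators fail: h_{2i+2} multiplies the generator by minus a power sum of the
  z_j. That multiple has filtration degree 0 < 2i + 2, so it vanishes in the associated graded
  module, and with it every trace of the parameters in the relations. Cyclicity is where the z_j
  matter: g^+ comes only with odd powers of t, and separating the factors requires distinct squares
  and z_j nonzero.\<close>

locale unital_algebra = vector_space scale
  for scale :: "'k::field_char_0 \<Rightarrow> 'a::ring_1 \<Rightarrow> 'a" +
  assumes scale_mult_left: "scale c x * y = scale c (x * y)"
    and mult_scale_right: "x * scale c y = scale c (x * y)"
begin

lemma of_nat_mult_eq_scale: "of_nat k * x = scale (of_nat k) x"
  by (induction k) (simp_all add: algebra_simps scale_left_distrib)

lemma of_nat_mult_mem_iff:
  assumes "subspace N" "k \<noteq> 0"
  shows "of_nat k * x \<in> N \<longleftrightarrow> x \<in> N"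
proof
  assume "of_nat k * x \<in> N"
  then have "scale (1 / of_nat k) (scale (of_nat k) x) \<in> N"
    using assms by (metis of_nat_mult_eq_scale subspace_scale)
  then show "x \<in> N" using assms by simp
qed (use assms in \<open>simp add: of_nat_mult_eq_scale subspace_scale\<close>)

lemma mult_span_mem:
  assumes "x \<in> span S" "\<And>y. y \<in> S \<Longrightarrow> a * y \<in> span T"
  shows "a * x \<in> span T"
  using assms(1)
proof (induction rule: span_induct_alt)
  case (step c y z)
  then show ?case using assms(2)
    by (simp add: distrib_left mult_scale_right span_add span_scale)
qed (simp add: span_zero)

lemma fps_power_nth_mult_mem:
  assumes "subspace N" "\<And>i x. x \<in> N \<Longrightarrow> fps_nth E i * x \<in> N" "x \<in> N"
  shows "fps_nth (E ^ s) r * x \<in> N"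
proof (induction s arbitrary: r)
  case 0
  then show ?case using assms by (auto simp: subspace_0)
next
  case (Suc s)
  then show ?case
    by (auto simp: fps_mult_nth sum_distrib_right mult.assoc intro!: subspace_sum[OF assms(1)] assms(2))
qed

lemma prod_list_mult_mem:
  assumes "\<And>i x. x \<in> N \<Longrightarrow> e i * x \<in> N" "x \<in> N"
  shows "prod_list (map e as) * x \<in> N"
  using assms by (induction as) (auto simp: mult.assoc)

end

lemma prod_list_map_commute:
  fixes e :: "'i \<Rightarrow> 'a::monoid_mult"
  assumes "\<And>i. c * e i = e i * c"
  shows "c * prod_list (map e as) = prod_list (map e as) * c"
proof (induction as)
  case (Cons a as)
  have "c * (e a * prod_list (map e as)) = e a * (c * prod_list (map e as))"
    by (metis assms mult.assoc)
  with Cons show ?case by (simp add: mult.assoc)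
qed simp

lemma prod_list_map_mset_cong:
  fixes e :: "'i \<Rightarrow> 'a::monoid_mult"
  assumes "\<And>i j. e i * e j = e j * e i" "mset as = mset bs"
  shows "prod_list (map e as) = prod_list (map e bs)"
  using assms(2)
proof (induction as arbitrary: bs)
  case (Cons a as)
  then have "a \<in> set bs" by (metis list.set_intros(1) set_mset_mset)
  then obtain xs ys where bs: "bs = xs @ a # ys" by (meson split_list)
  with Cons.prems have "mset as = mset (xs @ ys)" by simp
  with Cons.IH have "prod_list (map e as) = prod_list (map e (xs @ ys))" by blast
  moreover have "e a * prod_list (map e xs) = prod_list (map e xs) * e a"
    using assms(1) by (rule prod_list_map_commute)
  ultimately show ?case by (simp add: bs flip: mult.assoc)
qed simp

section \<open>Lowest weight vectors of the current algebra of sl(2)\<close>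

text \<open>No module is fixed. A vector is an element \<open>v\<close> of the algebra, and
  relations are read modulo a subspace \<open>N\<close> stable under the multiplications that occur.
  With \<open>N\<close> varying, the same lemmas serve every piece of the filtration.\<close>

locale sl2_current = unital_algebra scale
  for scale :: "'k::field_char_0 \<Rightarrow> 'a::ring_1 \<Rightarrow> 'a" +
  fixes e h f :: "nat \<Rightarrow> 'a"
  assumes ee: "e i * e j = e j * e i"
    and he: "h i * e j = e j * h i + 2 * e (i + j)"
    and fe: "f i * e j = e j * f i - h (i + j)"
begin

lemma h0_e0_power: "h 0 * e 0 ^ p = e 0 ^ p * h 0 + of_nat (2 * p) * e 0 ^ p"
proof (induction p)
  case (Suc p)
  have "h 0 * e 0 ^ Suc p = (e 0 * h 0 + 2 * e 0) * e 0 ^ p"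
    by (simp add: he flip: mult.assoc)
  also have "\<dots> = e 0 * (h 0 * e 0 ^ p) + 2 * e 0 ^ Suc p"
    by (simp add: algebra_simps)
  also have "\<dots> = e 0 ^ Suc p * h 0 + e 0 * (of_nat (2 * p) * e 0 ^ p) + 2 * e 0 ^ Suc p"
    unfolding Suc.IH by (simp only: distrib_left mult.assoc power_Suc)
  also have "e 0 * (of_nat (2 * p) * e 0 ^ p) = of_nat (2 * p) * e 0 ^ Suc p"
    by (metis (no_types) mult.assoc mult_of_nat_commute power_Suc)
  finally show ?case by (simp add: distrib_right add.assoc mult_2 del: power_Suc)
qed simp

lemma f0_e0_power:
  "f 0 * e 0 ^ Suc p = e 0 ^ Suc p * f 0 - of_nat (Suc p) * (e 0 ^ p * (h 0 + of_nat p))"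
proof (induction p)
  case 0
  then show ?case by (simp add: fe)
next
  case (Suc p)
  have "f 0 * e 0 ^ Suc (Suc p) = (e 0 * f 0 - h 0) * e 0 ^ Suc p"
    by (subst power_Suc) (simp add: fe del: power_Suc flip: mult.assoc)
  also have "\<dots> = e 0 * (f 0 * e 0 ^ Suc p) - h 0 * e 0 ^ Suc p"
    by (simp add: algebra_simps)
  also have "\<dots> = e 0 ^ Suc (Suc p) * f 0
      - e 0 * (of_nat (Suc p) * (e 0 ^ p * (h 0 + of_nat p)))
      - (e 0 ^ Suc p * h 0 + of_nat (2 * Suc p) * e 0 ^ Suc p)"
    unfolding Suc.IH h0_e0_power by (simp add: right_diff_distrib mult.assoc)
  also have "e 0 * (of_nat (Suc p) * (e 0 ^ p * (h 0 + of_nat p)))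
      = of_nat (Suc p) * (e 0 ^ Suc p * (h 0 + of_nat p))"
    by (metis (no_types) mult.assoc mult_of_nat_commute power_Suc)
  finally have eq: "f 0 * e 0 ^ Suc (Suc p) = e 0 ^ Suc (Suc p) * f 0
      - of_nat (Suc p) * (e 0 ^ Suc p * (h 0 + of_nat p))
      - (e 0 ^ Suc p * h 0 + of_nat (2 * Suc p) * e 0 ^ Suc p)" .
  have split: "e 0 ^ Suc p * (h 0 + of_nat q) = e 0 ^ Suc p * h 0 + of_nat q * e 0 ^ Suc p" for q
    by (simp only: distrib_left mult_of_nat_commute)

  have arith: "X - of_nat (Suc p) * (A + of_nat p * B) - (A + of_nat (2 * Suc p) * B)
      = X - of_nat (Suc (Suc p)) * (A + of_nat (Suc p) * B)" for X A B :: 'a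
  proof -
    have "of_nat (Suc p) * (A + of_nat p * B) + (A + of_nat (2 * Suc p) * B)
      = of_nat (Suc (Suc p)) * (A + of_nat (Suc p) * B)"
      by (simp add: distrib_left distrib_right mult_2)
    then show ?thesis by (simp only: diff_diff_eq)
  qed
  show ?case
    unfolding eq split by (rule arith)
qed

text \<open>Modulo \<open>N\<close>, f_0 sends e_0^(p+1) v to -(p+1)(p-m) e_0^p v. For p > m the
  coefficient is nonzero, so vanishing descends from the exponent \<open>P\<close> to m + 1, the
  exponent dictated by the weight -m.\<close>

lemma e0_power_mem:
  assumes N: "subspace N" "\<And>x. x \<in> N \<Longrightarrow> e 0 * x \<in> N" "\<And>x. x \<in> N \<Longrightarrow> f 0 * x \<in> N"
    and v: "f 0 * v \<in> N" "h 0 * v + of_nat m * v \<in> N" and P: "e 0 ^ P * v \<in> N"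
    and "m < P"
  shows "e 0 ^ Suc m * v \<in> N"
  using P \<open>m < P\<close>
proof (induction P)
  case (Suc p)
  have pow: "e 0 ^ q * x \<in> N" if "x \<in> N" for q x
    using that N(2) by (induction q) (auto simp: mult.assoc)
  show ?case
  proof (cases "p = m")
    case False
    with Suc.prems have "m < p" by simp
    have "of_nat (Suc p) * (e 0 ^ p * (h 0 * v + of_nat p * v)) =
       e 0 ^ Suc p * (f 0 * v) - f 0 * (e 0 ^ Suc p * v)"
      using arg_cong[OF f0_e0_power[of p], of "\<lambda>x. x * v"]
      by (simp add: left_diff_distrib distrib_right distrib_left mult.assoc del: of_nat_Suc)
    also have "\<dots> \<in> N"
      by (intro subspace_diff[OF N(1)] pow N(3) v Suc.prems)
    finally have "e 0 ^ p * (h 0 * v + of_nat p * v) \<in> N"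
      using N(1) of_nat_mult_mem_iff by blast
    moreover have "e 0 ^ p * (h 0 * v + of_nat m * v) \<in> N" using pow v by blast
    ultimately have "e 0 ^ p * (h 0 * v + of_nat p * v) - e 0 ^ p * (h 0 * v + of_nat m * v) \<in> N"
      by (rule subspace_diff[OF N(1)])
    also have "e 0 ^ p * (h 0 * v + of_nat p * v) - e 0 ^ p * (h 0 * v + of_nat m * v)
       = of_nat (p - m) * (e 0 ^ p * v)"
      using \<open>m < p\<close> mult_of_nat_commute[of p "e 0 ^ p"] mult_of_nat_commute[of m "e 0 ^ p"]
      by (simp add: algebra_simps of_nat_diff) (simp flip: mult.assoc)
    finally have "e 0 ^ p * v \<in> N"
      using N(1) of_nat_mult_mem_iff \<open>m < p\<close> by (metis zero_less_diff less_irrefl)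
    then show ?thesis using Suc.IH \<open>m < p\<close> by blast
  qed (use Suc.prems in simp)
qed simp

text \<open>In terms of currents the relations are [f_1, E] = -H and [H, E] = 2E': the k + 1
  brackets [h_{i+1}, e_{k-i}] all equal 2 e_{k+1}, which makes (k+1) e_{k+1}, a coefficient of E',
  appear. E commutes with E', so powers of E differentiate as usual. The element f_1 is chosen
  because its brackets with the e_i are h_{i+1}, which kill a lowest weight vector.\<close>

lemma f1_fps_power:
  defines "E \<equiv> Abs_fps e" and "H \<equiv> Abs_fps (\<lambda>i. h (Suc i))"
  shows "fps_const (f 1) * E ^ Suc s
    = E ^ Suc s * fps_const (f 1) - of_nat (Suc s) * (E ^ s * H + fps_deriv (E ^ s))"
proof -
  let ?D = "fps_deriv E"
  have FE: "fps_const (f 1) * E = E * fps_const (f 1) - H"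
  proof (rule fps_ext)
    fix k
    show "fps_nth (fps_const (f 1) * E) k = fps_nth (E * fps_const (f 1) - H) k"
      using fe[of 1 k] by (simp add: E_def H_def)
  qed
  have HE: "H * E = E * H + 2 * ?D"
  proof (rule fps_ext)
    fix k
    have "fps_nth (H * E) k = (\<Sum>i=0..k. e (k - i) * h (Suc i) + 2 * e (Suc k))"
      by (simp add: fps_mult_nth H_def E_def he)
    also have "\<dots> = (\<Sum>i=0..k. e (k - i) * h (Suc i)) + of_nat (Suc k) * (2 * e (Suc k))"
      by (simp add: sum.distrib del: of_nat_Suc)
    also have "(\<Sum>i=0..k. e (k - i) * h (Suc i)) = (\<Sum>i=0..k. e i * h (Suc (k - i)))"
      by (rule sum.reindex_bij_witness[of _ "\<lambda>i. k - i" "\<lambda>i. k - i"]) auto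
    also have "of_nat (Suc k) * (2 * e (Suc k)) = 2 * (of_nat (Suc k) * e (Suc k))"
      by (metis (no_types) mult.assoc mult_of_nat_commute of_nat_numeral)
    finally show "fps_nth (H * E) k = fps_nth (E * H + 2 * ?D) k"
      by (simp add: fps_mult_nth H_def E_def mult_2 distrib_left)
  qed
  have ED: "?D * E = E * ?D"
  proof (rule fps_ext)
    fix k
    have "fps_nth (?D * E) k = (\<Sum>i=0..k. of_nat (Suc i) * (e (k - i) * e (Suc i)))"
      by (simp add: fps_mult_nth E_def mult.assoc ee[of "Suc _"] del: of_nat_Suc)
    also have "\<dots> = (\<Sum>i=0..k. e (k - i) * (of_nat (Suc i) * e (Suc i)))"
      by (intro sum.cong refl) (metis mult.assoc mult_of_nat_commute)
    also have "\<dots> = (\<Sum>i=0..k. e i * (of_nat (Suc (k - i)) * e (Suc (k - i))))"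
      by (rule sum.reindex_bij_witness[of _ "\<lambda>i. k - i" "\<lambda>i. k - i"]) auto
    finally show "fps_nth (?D * E) k = fps_nth (E * ?D) k"
      by (simp add: fps_mult_nth E_def del: of_nat_Suc)
  qed
  have HEs: "H * E ^ s = E ^ s * H + 2 * fps_deriv (E ^ s)" for s
  proof (induction s)
    case (Suc s)
    have "H * E ^ Suc s = E * (H * E ^ s) + 2 * (?D * E ^ s)"
      by (simp add: HE distrib_right flip: mult.assoc)
    also have "\<dots> = E ^ Suc s * H + (E * (2 * fps_deriv (E ^ s)) + 2 * (?D * E ^ s))"
      by (simp add: Suc.IH distrib_left mult.assoc)
    also have "E * (2 * fps_deriv (E ^ s)) + 2 * (?D * E ^ s) = 2 * fps_deriv (E ^ Suc s)"
      by (simp add: mult_2 mult_2_right distrib_left)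
    finally show ?case .
  qed simp
  have DEs: "E * fps_deriv (E ^ s) + ?D * E ^ s = fps_deriv (E ^ Suc s)" for s
    by simp
  have DEs': "E * fps_deriv (E ^ s) = of_nat s * (?D * E ^ s)" for s
  proof (induction s)
    case (Suc s)
    have "E * fps_deriv (E ^ Suc s) = E * (E * fps_deriv (E ^ s)) + E * ?D * E ^ s"
      by (simp add: distrib_left mult.assoc)
    also have "\<dots> = of_nat s * (E * ?D * E ^ s) + E * ?D * E ^ s"
      unfolding Suc.IH by (simp add: mult.assoc) (metis mult.assoc mult_of_nat_commute)
    finally show ?case by (simp add: ED distrib_right flip: mult.assoc)
  qed simp
  show ?thesis
  proof (induction s)
    case 0
    then show ?case using FE by simp
  next
    case (Suc s)
    have "fps_const (f 1) * E ^ Suc (Suc s) = (E * fps_const (f 1) - H) * E ^ Suc s"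
      by (subst power_Suc) (simp only: FE flip: mult.assoc)
    also have "\<dots> = E * (fps_const (f 1) * E ^ Suc s) - H * E ^ Suc s"
      by (simp add: algebra_simps)
    also have "\<dots> = E ^ Suc (Suc s) * fps_const (f 1)
        - E * (of_nat (Suc s) * (E ^ s * H + fps_deriv (E ^ s)))
        - (E ^ Suc s * H + 2 * fps_deriv (E ^ Suc s))"
      unfolding Suc.IH HEs by (simp add: right_diff_distrib mult.assoc)
    also have "E * (of_nat (Suc s) * (E ^ s * H + fps_deriv (E ^ s)))
        = of_nat (Suc s) * (E ^ Suc s * H + E * fps_deriv (E ^ s))"
      by (metis (no_types, opaque_lifting) distrib_left mult.assoc mult_of_nat_commute power_Suc)
    also have "of_nat (Suc s) * (E ^ Suc s * H + E * fps_deriv (E ^ s))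
        = of_nat (Suc s) * (E ^ Suc s * H) + of_nat s * fps_deriv (E ^ Suc s)"
    proof -
      have "of_nat (Suc s) * (E * fps_deriv (E ^ s)) = of_nat s * fps_deriv (E ^ Suc s)"
        unfolding DEs[symmetric] DEs'
        by (simp add: distrib_left distrib_right mult.assoc)
      then show ?thesis by (simp add: distrib_left del: of_nat_Suc power_Suc)
    qed
    finally show ?case
      by (simp add: distrib_left distrib_right mult_2 del: power_Suc fps_deriv_mult)
  qed
qed

text \<open>Garland's relations: up to \<open>N\<close>, \<open>f\<^sub>1\<close> maps the coefficient of \<open>x\<^sup>r\<close> in \<open>E(x)\<^bsup>s+1\<^esup> v\<close> to a nonzero multiple
  of the coefficient of \<open>x\<^bsup>r+1\<^esup>\<close> in \<open>E(x)\<^sup>s v\<close>.\<close>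

lemma fps_power_nth_mem:
  assumes N: "subspace N" "\<And>i x. x \<in> N \<Longrightarrow> e i * x \<in> N" "\<And>x. x \<in> N \<Longrightarrow> f 1 * x \<in> N"
    and v: "f 1 * v \<in> N" "\<And>i. h (Suc i) * v \<in> N" "e 0 ^ Suc m * v \<in> N"
    and "m < s + r" "0 < s"
  shows "fps_nth (Abs_fps e ^ s) r * v \<in> N"
  using assms(7,8)
proof (induction r arbitrary: s)
  case 0
  have "e 0 ^ (s - Suc m) * (e 0 ^ Suc m * v) \<in> N"
    using fps_power_nth_mult_mem[OF N(1), of "fps_const (e 0)" "e 0 ^ Suc m * v" "s - Suc m" 0] N v(3)
    by (auto simp: subspace_0 fps_nth_power_0 split: if_splits)
  moreover have "e 0 ^ (s - Suc m) * e 0 ^ Suc m = e 0 ^ s"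
    using 0 by (simp del: power_Suc flip: power_add)
  ultimately show ?case by (simp add: fps_nth_power_0 flip: mult.assoc)
next
  case (Suc r)
  let ?E = "Abs_fps e" let ?H = "Abs_fps (\<lambda>i. h (Suc i))"
  \<comment> \<open>The sum of exponent and degree is the same for (s + 1, r) and (s, r + 1), so the
    bound on it carries over.\<close>
  have IH: "fps_nth (?E ^ Suc s) r * v \<in> N" using Suc.prems by (intro Suc.IH) auto
  have coef: "fps_nth (?E ^ s) i * x \<in> N" if "x \<in> N" for s i x
    using fps_power_nth_mult_mem[OF N(1)] N(2) that by simp
  have "fps_nth (of_nat (Suc s) * (?E ^ s * ?H + fps_deriv (?E ^ s))) r * v
     = fps_nth (?E ^ Suc s) r * (f 1 * v) - f 1 * (fps_nth (?E ^ Suc s) r * v)"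
    using arg_cong[OF f1_fps_power[of s], of "\<lambda>x. fps_nth x r * v"]
    by (simp add: left_diff_distrib mult.assoc del: of_nat_Suc power_Suc)
  also have "\<dots> \<in> N" by (intro subspace_diff[OF N(1)] coef N(3) v IH)
  also have "fps_nth (of_nat (Suc s) * (?E ^ s * ?H + fps_deriv (?E ^ s))) r * v
     = of_nat (Suc s) * (fps_nth (?E ^ s * ?H) r * v + of_nat (Suc r) * (fps_nth (?E ^ s) (Suc r) * v))"
    by (simp add: fps_of_nat[symmetric] distrib_right mult.assoc del: of_nat_Suc)
  finally have "fps_nth (?E ^ s * ?H) r * v + of_nat (Suc r) * (fps_nth (?E ^ s) (Suc r) * v) \<in> N"
    using of_nat_mult_mem_iff[OF N(1)] by blast
  moreover have "fps_nth (?E ^ s * ?H) r * v \<in> N"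
    using v(2) coef by (auto simp: fps_mult_nth sum_distrib_right mult.assoc intro!: subspace_sum[OF N(1)])
  ultimately have "of_nat (Suc r) * (fps_nth (?E ^ s) (Suc r) * v) \<in> N"
    using subspace_diff[OF N(1)] by (metis add_diff_cancel_left')
  then show ?case using of_nat_mult_mem_iff[OF N(1)] by blast
qed

end

section \<open>The box of monomials\<close>

context unital_algebra
begin

text \<open>The hypothesis bounds the \<open>r\<close>-th coefficient of the \<open>s\<close>-th power of the current \<open>E(x) = \<Sum> e\<^sub>i x\<^sup>i\<close>.
  Put \<open>E = e\<^sub>0 + F\<close> and filter the monomials by the number \<open>q\<close> of factors \<open>e\<^sub>0\<close>. Up to terms with fewer
  such factors, the coefficients of \<open>e\<^sub>0\<^bsup>S-i-j\<^esup> E\<^sup>j F\<^sup>i v\<close> are multiples of a single one by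
  binomial coefficients; those with \<open>j > q\<close> vanish by hypothesis, and the one with \<open>i = j = 0\<close>
  vanishes trivially. This yields the hypothesis for \<open>(e\<^sub>1, e\<^sub>2, \<dots>)\<close> and \<open>e\<^sub>0\<^sup>q v\<close>.\<close>

lemma prod_list_mem_box_span:
  assumes "\<And>i j. e i * e j = e j * e i"
    and "subspace N" "\<And>i x. x \<in> N \<Longrightarrow> e i * x \<in> N"
    and "\<And>s r. 0 < s \<Longrightarrow> M \<le> r + s \<Longrightarrow> fps_nth (Abs_fps e ^ s) r * v \<in> N"
  shows "prod_list (map e as) * v
    \<in> span (N \<union> {prod_list (map e bs) * v |bs. \<forall>b\<in>set bs. b + length bs < M})"
  using assms
proof (induction M arbitrary: e N v as rule: less_induct)
  case (less M)
  note comm = less.prems(1) and N = less.prems(2,3) and rel = less.prems(4)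
  define T where "T = span (N \<union> {prod_list (map e bs) * v |bs. \<forall>b\<in>set bs. b + length bs < M})"
  have T: "subspace T" by (simp add: T_def)
  have NT: "N \<subseteq> T" by (auto simp: T_def span_base)
  have box: "prod_list (map e bs) * v \<in> T" if "\<forall>b\<in>set bs. b + length bs < M" for bs
    using that by (auto simp: T_def intro!: span_base)
  define e' where "e' = (\<lambda>i. e (Suc i))"
  define y where "y = fps_const (e 0)"
  define F where "F = fps_X * Abs_fps e'"
  have E: "Abs_fps e = y + F"
    by (rule fps_ext) (auto simp: y_def F_def e'_def)
  have "prod_list (map e as) * v \<in> T"
  proof (induction "count_list as 0" arbitrary: as rule: less_induct)
    case less': less
    define q where "q = count_list as 0"
    define as' where "as' = map (\<lambda>i. i - 1) (filter (\<lambda>i. i \<noteq> 0) as)"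
    define v' where "v' = e 0 ^ q * v"
    have "mset as = mset (map Suc as' @ replicate q 0)"
      unfolding as'_def q_def by (induction as) auto
    then have "prod_list (map e as) = prod_list (map e (map Suc as' @ replicate q 0))"
      using comm by (intro prod_list_map_mset_cong)
    then have as: "prod_list (map e as) * v = prod_list (map e' as') * v'"
      by (simp add: e'_def v'_def comp_def map_replicate_const prod_list_replicate mult.assoc)
    have v'T: "v' \<in> T"
    proof (cases "q < M \<or> q = 0")
      case True
      then have "\<forall>b\<in>set (replicate q 0). b + length (replicate q 0) < M" by auto
      from box[OF this] show ?thesis by (simp add: v'_def map_replicate_const prod_list_replicate)
    next
      case False
      then have "fps_nth (Abs_fps e ^ q) 0 * v \<in> N" by (intro rel) auto
      then show ?thesis using NT by (auto simp: v'_def fps_nth_power_0)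
    qed
    show ?case
    proof (cases "M = 0")
      \<comment> \<open>For M = 0 the new bound M - 1 - q would not be smaller than M. Here the
        hypothesis with s = 1 puts every e_b v into \<open>N\<close>.\<close>
      case True
      show ?thesis
      proof (cases as rule: rev_cases)
        case (snoc bs b)
        have "fps_nth (Abs_fps e ^ 1) b * v \<in> N" using True by (intro rel) auto
        then have "e b * v \<in> N" by simp
        then have "prod_list (map e bs) * (e b * v) \<in> N"
          using prod_list_mult_mem[of N e "e b * v" bs] N(2) by blast
        then show ?thesis using NT by (auto simp: snoc mult.assoc)
      qed (use box[of "[]"] in simp)
    next
      case False
      \<comment> \<open>Monomials with fewer factors e_0 lie in \<open>T\<close> by the inner
        induction. They are adjoined to \<open>N\<close>, so that they count as zero when
        \<open>e\<close>, \<open>v\<close> are replaced by \<open>e'\<close>,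
        \<open>v'\<close>.\<close>
      define N' where "N' = span (N \<union> {prod_list (map e bs) * v |bs. count_list bs 0 < q})"
      have N': "subspace N'" "N \<subseteq> N'" by (auto simp: N'_def span_base)
      have N'T: "N' \<subseteq> T"
        unfolding N'_def using NT less' by (intro span_minimal T) (auto simp: q_def)
      have N'_closed: "e' i * x \<in> N'" if "x \<in> N'" for i x
        using that unfolding N'_def
      proof (rule mult_span_mem)
        fix z assume "z \<in> N \<union> {prod_list (map e bs) * v |bs. count_list bs 0 < q}"
        then show "e' i * z \<in> span (N \<union> {prod_list (map e bs) * v |bs. count_list bs 0 < q})"
        proof
          assume "z \<in> {prod_list (map e bs) * v |bs. count_list bs 0 < q}"
          then obtain bs where "z = prod_list (map e bs) * v" "count_list bs 0 < q" by blast
          then have "e' i * z = prod_list (map e (Suc i # bs)) * v" "count_list (Suc i # bs) 0 < q"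
            by (simp_all add: e'_def mult.assoc)
          then show ?thesis by (blast intro: span_base)
        qed (use N e'_def in \<open>auto intro: span_base\<close>)
      qed
      have "fps_nth (Abs_fps e' ^ s) r * v' \<in> N'" if "0 < s" "M - 1 - q \<le> r + s" for s r
      proof -
        \<comment> \<open>The three exponents always add up to q + s. As F is x times the shifted
          current, the target \<open>Z s 0\<close> is the coefficient of x^r in the s-th power of
          that current, applied to e_0^q v.\<close>
        define Z where "Z = (\<lambda>i j. fps_nth (y ^ (q + s - i - j) * (y + F) ^ j * F ^ i) (r + s) * v)"
        have yF: "y * F = F * y"
          unfolding y_def F_def e'_def
          by (rule fps_ext) (auto simp: comm mult.assoc simp del: fps_mult_fps_X_commute)
        have yE: "y ^ k * (y + F) ^ j = (y + F) ^ j * y ^ k" for k j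
        proof (intro power_commuting_commutes)
          show "y * (y + F) ^ j = (y + F) ^ j * y"
            by (rule sym, intro power_commuting_commutes) (simp add: yF distrib_left distrib_right)
        qed
        have Z_rec: "Z i (Suc j) = Z i j + Z (Suc i) j" if "i + j < q + s" for i j
        proof -
          define k where "k = q + s - i - Suc j"
          have k: "q + s - i - j = Suc k" "q + s - Suc i - j = k"
            using that by (auto simp: k_def)
          have c1: "y ^ k * (y + F) ^ Suc j * F ^ i = (y ^ k * (y + F) ^ j) * y * F ^ i + (y ^ k * (y + F) ^ j) * F * F ^ i"
            by (simp only: power_Suc2 distrib_left distrib_right mult.assoc)
          have c2: "y ^ k * (y + F) ^ j * y = y ^ Suc k * (y + F) ^ j"
            using yE[of 1 j] by (simp add: power_Suc2 mult.assoc del: power_Suc)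
          have "y ^ k * (y + F) ^ Suc j * F ^ i
            = y ^ Suc k * (y + F) ^ j * F ^ i + y ^ k * (y + F) ^ j * F ^ Suc i"
            unfolding c1 c2 by (simp only: power_Suc mult.assoc)
          then show ?thesis
            unfolding Z_def k k_def[symmetric] by (simp only: fps_add_nth distrib_right)
        qed
        \<comment> \<open>From j >= q + 1 and M - 1 - q <= r + s follows M <= (r + s) + j, the
          hypothesis for the j-th power. This is where the loss of 1 + q in the bound comes
          from.\<close>
        have Z0: "Z 0 j \<in> N" if "q < j" "j \<le> q + s" for j
        proof -
          have "fps_nth (Abs_fps e ^ j) (r + s) * v \<in> N"
            using that \<open>M - 1 - q \<le> r + s\<close> by (intro rel) auto
          then have "prod_list (map e (replicate (q + s - j) 0)) * (fps_nth (Abs_fps e ^ j) (r + s) * v) \<in> N"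
            using prod_list_mult_mem[of N e] N(2) by blast
          then show ?thesis
            by (simp add: Z_def E y_def fps_const_power map_replicate_const prod_list_replicate mult.assoc)
        qed
        have Z_high: "Z i j \<in> N" if "q < j" "i + j \<le> q + s" for i j
          using that
        proof (induction i arbitrary: j)
          case (Suc i)
          then have "Z i (Suc j) - Z i j \<in> N" by (intro subspace_diff[OF N(1)] Suc.IH) auto
          then show ?case using Suc.prems Z_rec[of i j] by simp
        qed (use Z0 in auto)
        \<comment> \<open>For i > s only q + s - i < q factors e_0 are left.\<close>
        have Z_few: "Z i 0 \<in> N'" if "s < i" "i \<le> q + s" for i
        proof -
          have pow: "fps_nth (F ^ i) k * (prod_list (map e bs) * v) \<in> N'" if "count_list bs 0 < q" for k bs
          proof (rule fps_power_nth_mult_mem[OF N'(1)])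
            show "fps_nth F j * x \<in> N'" if "x \<in> N'" for j x
              using N'_closed[OF that] N'(1) by (auto simp: F_def subspace_0)
            show "prod_list (map e bs) * v \<in> N'"
              using that by (auto simp: N'_def intro!: span_base)
          qed
          have "y ^ (q + s - i) * F ^ i = F ^ i * y ^ (q + s - i)"
            using yF by (metis power_commuting_commutes)
          then have "Z i 0 = fps_nth (F ^ i * fps_const (e 0 ^ (q + s - i))) (r + s) * v"
            by (simp add: Z_def y_def fps_const_power)
          moreover have "count_list (replicate k 0) (0 :: nat) = k" for k
            by (induction k) auto
          ultimately show ?thesis
            using pow[of "replicate (q + s - i) 0" "r + s"] that
            by (simp add: map_replicate_const prod_list_replicate mult.assoc)
        qed
        have Z_few': "Z i j \<in> N'" if "s < i" "i + j \<le> q + s" for i j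
          using that
        proof (induction j arbitrary: i)
          case (Suc j)
          then have "Z i j + Z (Suc i) j \<in> N'" by (intro subspace_add[OF N'(1)] Suc.IH) auto
          then show ?case using Suc.prems Z_rec[of i j] by simp
        qed (use Z_few in auto)
        have Z_s: "Z s j - Z s 0 \<in> N'" if "j \<le> q" for j
          using that
        proof (induction j)
          case (Suc j)
          then have "(Z s j - Z s 0) + Z (Suc s) j \<in> N'"
            by (intro subspace_add[OF N'(1)] Z_few') auto
          then show ?case using Suc.prems Z_rec[of s j] by (simp add: algebra_simps)
        qed (simp add: subspace_0[OF N'(1)])
        \<comment> \<open>The solution of Pascal's rule
          \<open>c (Suc t) (Suc j) = c t j + c (Suc t) j\<close> with \<open>c 0 j = 1\<close> and
          \<open>c t (q + 1) = 0\<close> for t > 0; the latter reflects that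
          \<open>Z (s - t) (q + 1)\<close> lies in \<open>N\<close>. For j \<le> q the upper
          argument is negative, hence the generalised binomial.\<close>
        define c :: "nat \<Rightarrow> nat \<Rightarrow> 'k" where "c = (\<lambda>t j. (of_nat j - of_nat q - 1) gchoose t)"
        have Z_c: "Z (s - t) j - scale (c t j) (Z s 0) \<in> N'" if "t \<le> s" "j \<le> q + min t 1" for t j
          using that
        proof (induction t arbitrary: j)
          case 0
          then show ?case using Z_s by (simp add: c_def)
        next
          case (Suc t)
          have "j \<le> Suc q" using Suc.prems by simp
          then show ?case
          proof (induction j rule: inc_induct)
            case base
            have "Z (s - Suc t) (Suc q) \<in> N" using Suc.prems by (intro Z_high) auto
            then show ?case using N'(2) by (auto simp: c_def)
          next
            case (step j)
            have 1: "Z (s - t) j - scale (c t j) (Z s 0) \<in> N'"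
              using Suc.prems step by (intro Suc.IH) auto
            have "Z (s - Suc t) (Suc j) = Z (s - Suc t) j + Z (Suc (s - Suc t)) j"
              using Suc.prems step by (intro Z_rec) auto
            moreover have "Suc (s - Suc t) = s - t" using Suc.prems by auto
            moreover have "c (Suc t) (Suc j) = c t j + c (Suc t) j"
              using gbinomial_Suc_Suc[of "of_nat j - of_nat q - 1 :: 'k" t]
              by (simp add: c_def algebra_simps)
            ultimately have "Z (s - Suc t) j - scale (c (Suc t) j) (Z s 0)
              = (Z (s - Suc t) (Suc j) - scale (c (Suc t) (Suc j)) (Z s 0))
                - (Z (s - t) j - scale (c t j) (Z s 0))"
              by (simp add: scale_left_distrib)
            then show ?case using step.IH 1 subspace_diff[OF N'(1)] by simp
          qed
        qed
        \<comment> \<open>The constant series y^(q+s) has no coefficient at r + s > 0, so the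
          multiple \<open>c s 0\<close> of \<open>Z s 0\<close> vanishes modulo \<open>N'\<close>.
          The factor is the binomial coefficient of -q - 1 over s, nonzero in characteristic
          0.\<close>
        have "fps_nth (y ^ (q + s)) (r + s) = 0"
          using \<open>0 < s\<close> by (simp add: y_def fps_const_power)
        then have "Z 0 0 = 0" by (simp add: Z_def)
        then have "scale (c s 0) (Z s 0) \<in> N'"
          using Z_c[of s 0] subspace_neg[OF N'(1)] by fastforce
        moreover have "c s 0 \<noteq> 0"
        proof -
          have "(0 :: 'k) - of_nat q - 1 - of_nat i \<noteq> 0" for i
          proof -
            have "(0 :: 'k) - of_nat q - 1 - of_nat i = - of_nat (Suc (q + i))" by simp
            then show ?thesis by (simp only: neg_equal_0_iff_equal of_nat_eq_0_iff)
          qed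
          then show ?thesis by (auto simp: c_def gbinomial_prod_rev)
        qed
        ultimately have "Z s 0 \<in> N'"
          using subspace_scale[OF N'(1), of "scale (c s 0) (Z s 0)" "1 / c s 0"] by simp
        moreover have "Z s 0 = fps_nth (F ^ s * y ^ q) (r + s) * v"
        proof -
          have "y ^ q * F ^ s = F ^ s * y ^ q"
            using yF by (metis power_commuting_commutes)
          then show ?thesis by (simp add: Z_def)
        qed
        moreover have "F ^ s = Abs_fps e' ^ s * fps_X ^ s"
        proof (induction s)
          case (Suc s)
          have "F = Abs_fps e' * fps_X"
            unfolding F_def by (rule fps_mult_fps_X_commute)
          then have "F ^ Suc s = Abs_fps e' * (fps_X * Abs_fps e' ^ s) * fps_X ^ s"
            unfolding power_Suc Suc by (simp only: mult.assoc)
          also have "fps_X * Abs_fps e' ^ s = Abs_fps e' ^ s * fps_X"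
            by (rule fps_mult_fps_X_commute)
          finally show ?case by (simp only: power_Suc mult.assoc)
        qed simp
        ultimately have "fps_nth (Abs_fps e' ^ s * fps_X ^ s * fps_const (e 0 ^ q)) (r + s) * v \<in> N'"
          by (simp add: y_def fps_const_power)
        moreover have "fps_nth (Abs_fps e' ^ s * fps_X ^ s * fps_const (e 0 ^ q)) (r + s)
            = fps_nth (Abs_fps e' ^ s) r * e 0 ^ q"
          by (simp only: fps_mult_right_const_nth) (simp add: fps_X_power_mult_right_nth)
        ultimately show ?thesis by (simp add: v'_def mult.assoc)
      qed
      then have "prod_list (map e' as') * v'
        \<in> span (N' \<union> {prod_list (map e' bs) * v' |bs. \<forall>b\<in>set bs. b + length bs < M - 1 - q})"
        using comm N' N'_closed False by (intro less.IH) (auto simp: e'_def)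
      also have "\<dots> \<subseteq> T"
      proof (intro span_minimal T Un_least N'T subsetI)
        fix x assume "x \<in> {prod_list (map e' bs) * v' |bs. \<forall>b\<in>set bs. b + length bs < M - 1 - q}"
        then obtain bs where x: "x = prod_list (map e' bs) * v'" and
          bs: "\<forall>b\<in>set bs. b + length bs < M - 1 - q" by blast
        \<comment> \<open>Raising each index by 1 and appending q zeros turns b + length < M - 1 - q
          into (b + 1) + (length + q) < M. An empty \<open>bs\<close> carries no such bound and
          leaves \<open>v'\<close> itself, which is covered by \<open>v'T\<close>.\<close>
        show "x \<in> T"
        proof (cases bs)
          case (Cons b bs')
          let ?cs = "map Suc bs @ replicate q 0"
          have "\<forall>b\<in>set ?cs. b + length ?cs < M" using bs by (fastforce simp: Cons)
          from box[OF this] show ?thesis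
            by (simp add: x e'_def v'_def comp_def map_replicate_const prod_list_replicate mult.assoc)
        qed (use x v'T in simp)
      qed
      finally show ?thesis by (simp add: as)
    qed
  qed
  then show ?case by (simp add: T_def)
qed

end

text \<open>Any exponent \<open>P\<close> is accepted: if it exceeds m, the weight argument lowers
  it to m + 1, otherwise multiplication by e_0 raises it. Garland's relations then provide the
  hypothesis on the currents with M = m + 1.\<close>

lemma (in sl2_current) prod_list_mem_weyl_box_span:
  assumes N: "subspace N" "\<And>i x. x \<in> N \<Longrightarrow> e i * x \<in> N" "\<And>i x. x \<in> N \<Longrightarrow> f i * x \<in> N"
    and v: "\<And>i. f i * v \<in> N" "\<And>i. h (Suc i) * v \<in> N" "h 0 * v + of_nat m * v \<in> N"
    and P: "e 0 ^ P * v \<in> N"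
  shows "prod_list (map e as) * v
    \<in> span (N \<union> {prod_list (map e bs) * v |bs. \<forall>b\<in>set bs. b + length bs \<le> m})"
proof -
  have pow: "e 0 ^ k * x \<in> N" if "x \<in> N" for k x
    using that N(2) by (induction k) (auto simp: mult.assoc)
  have "e 0 ^ Suc m * v \<in> N"
  proof (cases "m < P")
    case True
    then show ?thesis using e0_power_mem[of N v m P] N v P by blast
  next
    case False
    then have "e 0 ^ Suc m = e 0 ^ (Suc m - P) * e 0 ^ P" by (simp del: power_Suc flip: power_add)
    then show ?thesis using pow[OF P, of "Suc m - P"] by (simp add: mult.assoc del: power_Suc)
  qed
  then have "fps_nth (Abs_fps e ^ s) r * v \<in> N" if "0 < s" "Suc m \<le> r + s" for s r
    using that N v by (intro fps_power_nth_mem) auto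
  from prod_list_mem_box_span[of e N "Suc m", OF ee N(1,2) this]
  show ?thesis by (simp add: less_Suc_eq_le)
qed

section \<open>Linear extension\<close>

lemma poly_mapping_single_induct [case_names zero add]:
  fixes x :: "'a \<Rightarrow>\<^sub>0 'b::monoid_add"
  assumes "P 0" "\<And>a c x. P x \<Longrightarrow> P (Poly_Mapping.single a c + x)"
  shows "P x"
proof (induction x rule: update_induct)
  case (update f a b)
  have "Poly_Mapping.update a b f = Poly_Mapping.single a b + f"
    using update(1) by (intro poly_mapping_eqI)
      (auto simp: lookup_update lookup_add lookup_single in_keys_iff when_def)
  with update assms(2) show ?case by simp
qed (rule assms(1))

lemma lin_ext_superset:
  assumes "finite S" "Poly_Mapping.keys x \<subseteq> S"
  shows "lin_ext f x = (\<Sum>a\<in>S. cscale (Poly_Mapping.lookup x a) (f a))"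
  unfolding lin_ext_def using assms
  by (intro sum.mono_neutral_left) (auto simp: in_keys_iff)

lemma lin_ext_zero [simp]: "lin_ext f 0 = 0"
  by (simp add: lin_ext_def)

lemma lin_ext_single [simp]: "lin_ext f (Poly_Mapping.single a c) = cscale c (f a)"
  by (cases "c = 0") (simp_all add: lin_ext_def)

lemma lin_ext_add: "lin_ext f (x + y) = lin_ext f x + lin_ext f y"
proof -
  let ?S = "Poly_Mapping.keys x \<union> Poly_Mapping.keys y"
  have "Poly_Mapping.keys (x + y) \<subseteq> ?S" by (rule keys_add)
  then show ?thesis
    by (simp add: lin_ext_superset[of ?S] lookup_add cvec.scale_left_distrib sum.distrib)
qed

lemma lin_ext_cscale: "lin_ext f (cscale c x) = cscale c (lin_ext f x)"
proof -
  have "Poly_Mapping.keys (cscale c x) \<subseteq> Poly_Mapping.keys x" by (auto simp: in_keys_iff)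
  then show ?thesis
    by (simp add: lin_ext_superset[of "Poly_Mapping.keys x"] cvec.scale_sum_right)
qed

lemma lin_ext_uminus: "lin_ext f (- x) = - lin_ext f x"
  using lin_ext_cscale[of f "-1" x] by simp

lemma lin_ext_diff: "lin_ext f (x - y) = lin_ext f x - lin_ext f y"
  using lin_ext_add[of f x "- y"] by (simp add: lin_ext_uminus)

lemma lin_ext_sum: "lin_ext f (sum g S) = (\<Sum>i\<in>S. lin_ext f (g i))"
  by (induction S rule: infinite_finite_induct) (auto simp: lin_ext_add)

lemma lin_ext_lin_ext: "lin_ext f (lin_ext g x) = lin_ext (\<lambda>a. lin_ext f (g a)) x"
  by (induction x rule: poly_mapping_single_induct) (simp_all add: lin_ext_add lin_ext_cscale)

lemma lin_ext_cong:
  assumes "\<And>a. a \<in> Poly_Mapping.keys x \<Longrightarrow> f a = g a"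
  shows "lin_ext f x = lin_ext g x"
  using assms by (simp add: lin_ext_def)

lemma lin_ext_const_zero [simp]: "lin_ext (\<lambda>a. 0) x = 0"
  by (simp add: lin_ext_def)

lemma lin_ext_fun_add: "lin_ext (\<lambda>a. f a + g a) x = lin_ext f x + lin_ext g x"
  by (simp add: lin_ext_def cvec.scale_right_distrib sum.distrib)

lemma lin_ext_fun_cscale: "lin_ext (\<lambda>a. cscale c (f a)) x = cscale c (lin_ext f x)"
  by (simp add: lin_ext_def cvec.scale_sum_right mult.commute)

lemma lin_ext_id: "lin_ext (\<lambda>a. Poly_Mapping.single a 1) x = x"
  by (induction x rule: poly_mapping_single_induct) (simp_all add: lin_ext_add)

lemma lin_ext_mem_subspace:
  assumes "cvec.subspace S" "\<And>a. a \<in> Poly_Mapping.keys x \<Longrightarrow> f a \<in> S"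
  shows "lin_ext f x \<in> S"
  unfolding lin_ext_def using assms by (intro cvec.subspace_sum cvec.subspace_scale)

lemma lin_ext_span_mem:
  assumes "x \<in> cvec.span S" "\<And>y. y \<in> S \<Longrightarrow> lin_ext f y \<in> T" "cvec.subspace T"
  shows "lin_ext f x \<in> T"
  using assms(1)
  by (induction rule: cvec.span_induct_alt)
    (use assms(2,3) in \<open>auto simp: lin_ext_add lin_ext_cscale cvec.subspace_0 cvec.subspace_add cvec.subspace_scale\<close>)

section \<open>The action on tensor powers\<close>

definition tcons :: "vbas \<Rightarrow> (vbas list \<Rightarrow>\<^sub>0 complex) \<Rightarrow> (vbas list \<Rightarrow>\<^sub>0 complex)"
  where "tcons b = lin_ext (\<lambda>w. Poly_Mapping.single (b # w) 1)"

text \<open>The parities of \<open>y\<close> and \<open>d\<close> need not agree; this frees the bracket relation below from side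
  conditions and allows induction on the tensor factors.\<close>

fun word_act :: "(nat \<Rightarrow> complex) \<Rightarrow> osp \<Rightarrow> nat \<Rightarrow> vbas list \<Rightarrow> (vbas list \<Rightarrow>\<^sub>0 complex)" where
  "word_act \<zeta> y d [] = 0"
| "word_act \<zeta> y d (b # w) =
     cscale (\<zeta> 0 ^ d) (lin_ext (\<lambda>c. Poly_Mapping.single (c # w) 1) (vact y b))
     + cscale (ssign (osp_odd y) (vbas_odd b)) (tcons b (word_act (\<zeta> \<circ> Suc) y d w))"

lemma word_act_eq_sum:
  "word_act \<zeta> y d w =
    (\<Sum>i<length w.
      cscale (ssign (osp_odd y) (odd (length (filter vbas_odd (take i w)))) * \<zeta> i ^ d)
        (lin_ext (\<lambda>b. Poly_Mapping.single (w[i := b]) 1) (vact y (w ! i))))"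
proof (induction w arbitrary: \<zeta>)
  case (Cons b w)
  show ?case
    unfolding word_act.simps Cons.IH length_Cons sum.lessThan_Suc_shift
    by (auto simp: tcons_def lin_ext_sum lin_ext_cscale lin_ext_lin_ext cvec.scale_sum_right
        ssign_def intro!: sum.cong)
qed simp

text \<open>Terms in which both elements hit the same factor give the bracket; terms hitting
  different factors cancel against the swapped product by the sign rule. Splitting off the first
  factor leaves a finite check over \<open>x\<close>, \<open>y\<close> and \<open>b\<close>.\<close>

lemma word_act_bracket:
  "lin_ext (word_act \<zeta> x d) (word_act \<zeta> y k w) =
     cscale (ssign (osp_odd x) (osp_odd y)) (lin_ext (word_act \<zeta> y k) (word_act \<zeta> x d w))
     + lin_ext (\<lambda>z. word_act \<zeta> z (d + k) w) (osp_bracket x y)"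
proof (induction w arbitrary: \<zeta>)
  case (Cons b w)
  let ?\<zeta> = "\<zeta> \<circ> Suc"
  have IH: "tcons b (lin_ext (word_act ?\<zeta> x d) (word_act ?\<zeta> y k w)) =
     cscale (ssign (osp_odd x) (osp_odd y)) (tcons b (lin_ext (word_act ?\<zeta> y k) (word_act ?\<zeta> x d w)))
     + lin_ext (\<lambda>z. tcons b (word_act ?\<zeta> z (d + k) w)) (osp_bracket x y)"
    unfolding Cons.IH[of ?\<zeta>] by (simp add: tcons_def lin_ext_add lin_ext_cscale lin_ext_lin_ext)
  \<comment> \<open>The inner action has already produced a combination of words, so the recursion
    is extended from words to vectors u of the tail.\<close>
  have tcons: "lin_ext (word_act \<zeta> y d) (tcons b u) =
    cscale (\<zeta> 0 ^ d) (lin_ext (\<lambda>c. tcons c u) (vact y b))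
    + cscale (ssign (osp_odd y) (vbas_odd b)) (tcons b (lin_ext (word_act ?\<zeta> y d) u))" for y d b u
  proof (induction u rule: poly_mapping_single_induct)
    case (add w c u)
    have "lin_ext (\<lambda>a. Poly_Mapping.single (a # w) c) p
      = cscale c (lin_ext (\<lambda>a. Poly_Mapping.single (a # w) 1) p)" for p
      by (simp flip: lin_ext_fun_cscale)
    with add show ?case
      by (simp add: tcons_def lin_ext_add lin_ext_cscale lin_ext_fun_add lin_ext_fun_cscale
        lin_ext_lin_ext algebra_simps cvec.scale_right_distrib comp_def)
  qed (simp add: tcons_def)
  show ?case
    by (cases x; cases y; cases b; insert IH;
      simp add: lin_ext_add lin_ext_cscale lin_ext_diff tcons ssign_def;
      intro poly_mapping_eqI; simp add: lookup_add lookup_minus lookup_single when_def power_add algebra_simps)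
qed simp

definition tensor_act :: "complex list \<Rightarrow> tcur \<Rightarrow> (vbas list \<Rightarrow>\<^sub>0 complex) \<Rightarrow> (vbas list \<Rightarrow>\<^sub>0 complex)"
  where "tensor_act zs a = lin_ext (tensor_act_basis zs a)"

lemma act_tensor_module [simp]: "act (tensor_module zs) = tensor_act zs"
  by (rule ext) (simp add: tensor_module_def tensor_act_def)

lemma tensor_act_basis_eq: "tensor_act_basis zs a w = word_act ((!) zs) (tosp a) (tdeg a) w"
  by (simp add: tensor_act_basis_def word_act_eq_sum tparity_def)

lemma tcur_parity: "osp_odd (tosp a) \<longleftrightarrow> odd (tdeg a)"
  using Rep_tcur[of a] by (auto simp: tosp_def tdeg_def)

lemma tosp_tw: "osp_odd y \<longleftrightarrow> odd k \<Longrightarrow> tosp (tw y k) = y"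
  and tdeg_tw: "osp_odd y \<longleftrightarrow> odd k \<Longrightarrow> tdeg (tw y k) = k"
  by (simp_all add: tosp_def tdeg_def tw_def Abs_tcur_inverse)

lemma osp_bracket_parity:
  "z \<in> Poly_Mapping.keys (osp_bracket x y) \<Longrightarrow> osp_odd z \<longleftrightarrow> osp_odd x \<noteq> osp_odd y"
  by (cases x; cases y) (auto split: if_splits)

lemma lin_ext_tbracket:
  "lin_ext f (tbracket a b) = lin_ext (\<lambda>y. f (tw y (tdeg a + tdeg b))) (osp_bracket (tosp a) (tosp b))"
  by (simp add: tbracket_def lin_ext_lin_ext)

lemma tensor_act_add: "tensor_act zs a (x + y) = tensor_act zs a x + tensor_act zs a y"
  and tensor_act_diff: "tensor_act zs a (x - y) = tensor_act zs a x - tensor_act zs a y"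
  and tensor_act_cscale: "tensor_act zs a (cscale c x) = cscale c (tensor_act zs a x)"
  and tensor_act_zero [simp]: "tensor_act zs a 0 = 0"
  by (simp_all add: tensor_act_def lin_ext_add lin_ext_diff lin_ext_cscale)

lemma tensor_act_bracket:
  "tensor_act zs a (tensor_act zs b x) =
    cscale (ssign (tparity a) (tparity b)) (tensor_act zs b (tensor_act zs a x))
    + lin_ext (\<lambda>c. tensor_act zs c x) (tbracket a b)"
proof (induction x rule: poly_mapping_single_induct)
  case (add w c x)
  have "tensor_act zs a (tensor_act zs b (Poly_Mapping.single w 1)) =
    cscale (ssign (tparity a) (tparity b)) (tensor_act zs b (tensor_act zs a (Poly_Mapping.single w 1)))
    + lin_ext (\<lambda>z. word_act ((!) zs) z (tdeg a + tdeg b) w) (osp_bracket (tosp a) (tosp b))"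
    by (simp add: tensor_act_def tensor_act_basis_eq[abs_def] word_act_bracket[of _ "tosp a"] tparity_def)
  \<comment> \<open>\<open>tw z k\<close> represents an element only when k has the parity of z.
    Each term of the bracket has the parity of the sum of the two degrees, so all terms are
    meaningful.\<close>
  also have "lin_ext (\<lambda>z. word_act ((!) zs) z (tdeg a + tdeg b) w) (osp_bracket (tosp a) (tosp b))
    = lin_ext (\<lambda>c. tensor_act zs c (Poly_Mapping.single w 1)) (tbracket a b)"
    unfolding lin_ext_tbracket
    by (intro lin_ext_cong)
      (auto simp: tensor_act_def tensor_act_basis_eq tosp_tw tdeg_tw tcur_parity
        dest!: osp_bracket_parity)
  finally have *: "tensor_act zs a (tensor_act zs b (cscale c (Poly_Mapping.single w 1))) =
    cscale (ssign (tparity a) (tparity b)) (tensor_act zs b (tensor_act zs a (cscale c (Poly_Mapping.single w 1))))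
    + lin_ext (\<lambda>d. tensor_act zs d (cscale c (Poly_Mapping.single w 1))) (tbracket a b)"
    by (simp only: tensor_act_cscale lin_ext_fun_cscale cvec.scale_right_distrib cvec.scale_left_commute)
  show ?case
    using * add
    by (simp add: tensor_act_add lin_ext_fun_add cvec.scale_right_distrib)
qed simp

definition tensor_word :: "complex list \<Rightarrow> tcur list \<Rightarrow> (vbas list \<Rightarrow>\<^sub>0 complex) \<Rightarrow> (vbas list \<Rightarrow>\<^sub>0 complex)"
  where "tensor_word zs ws = foldr (tensor_act zs) ws"

lemma tensor_word_simps [simp]:
  "tensor_word zs [] x = x"
  "tensor_word zs (a # ws) x = tensor_act zs a (tensor_word zs ws x)"
  "tensor_word zs (us @ ws) x = tensor_word zs us (tensor_word zs ws x)"
  by (simp_all add: tensor_word_def)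

lemma tensor_word_zero [simp]: "tensor_word zs ws 0 = 0"
  by (induction ws) auto

lemma tensor_word_add: "tensor_word zs ws (x + y) = tensor_word zs ws x + tensor_word zs ws y"
  and tensor_word_cscale: "tensor_word zs ws (cscale c x) = cscale c (tensor_word zs ws x)"
  by (induction ws) (simp_all add: tensor_act_add tensor_act_cscale)

lemma word_deg_simps [simp]:
  "word_deg [] = 0" "word_deg (a # ws) = tdeg a + word_deg ws"
  "word_deg (us @ ws) = word_deg us + word_deg ws"
  by (simp_all add: word_deg_def)

section \<open>Graded components of the action of the enveloping algebra\<close>

text \<open>The vector u_s m, where u_s is the part of u of t-degree s. Selecting the monomials of
  degree s inside the action gives all components at once, without a separate grading on the
  enveloping algebra.\<close>

definition free_comp :: "complex list \<Rightarrow> nat \<Rightarrow> (vbas list \<Rightarrow>\<^sub>0 complex) \<Rightarrow> free_alg \<Rightarrow> (vbas list \<Rightarrow>\<^sub>0 complex)"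
  where "free_comp zs s m =
    lin_ext (\<lambda>u. if word_deg (letters u) = s then tensor_word zs (letters u) m else 0)"

lemma free_comp_add: "free_comp zs s m (x + y) = free_comp zs s m x + free_comp zs s m y"
  and free_comp_diff: "free_comp zs s m (x - y) = free_comp zs s m x - free_comp zs s m y"
  and free_comp_cscale: "free_comp zs s m (cscale c x) = cscale c (free_comp zs s m x)"
  by (simp_all add: free_comp_def lin_ext_add lin_ext_diff lin_ext_cscale)

lemma free_comp_zero [simp]: "free_comp zs s m 0 = 0"
  by (simp add: free_comp_def)

lemma free_comp_single:
  "free_comp zs s m (Poly_Mapping.single u c) =
    (if word_deg (letters u) = s then cscale c (tensor_word zs (letters u) m) else 0)"
  by (simp add: free_comp_def)

lemma free_comp_mult_left:
  "free_comp zs s m (Poly_Mapping.single u c * x) =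
    (if word_deg (letters u) \<le> s
     then cscale c (tensor_word zs (letters u) (free_comp zs (s - word_deg (letters u)) m x)) else 0)"
proof (induction x rule: poly_mapping_single_induct)
  case (add v d x)
  then show ?case
    by (auto simp: distrib_left free_comp_add tensor_word_add cvec.scale_right_distrib mult_single
        free_comp_single plus_mon_def tensor_word_cscale)
qed simp

lemma free_comp_mult_right:
  "free_comp zs s m (x * Poly_Mapping.single v d) =
    (if word_deg (letters v) \<le> s
     then cscale d (free_comp zs (s - word_deg (letters v)) (tensor_word zs (letters v) m) x) else 0)"
proof (induction x rule: poly_mapping_single_induct)
  case (add u c x)
  then show ?case
    by (auto simp: distrib_right free_comp_add cvec.scale_right_distrib mult_single
        free_comp_single plus_mon_def mult.commute)
qed simp

text \<open>All terms of the relator have degree \<open>tdeg a + tdeg b\<close>, so selecting a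
  degree keeps either the whole relator or nothing, and the whole relator acts by zero.\<close>

lemma free_comp_env_relator: "free_comp zs s m (env_relator a b) = 0"
proof -
  have "free_comp zs s m (lin_ext free_gen (tbracket a b))
    = lin_ext (\<lambda>c. if tdeg a + tdeg b = s then tensor_act zs c m else 0) (tbracket a b)"
    unfolding free_comp_def lin_ext_lin_ext lin_ext_tbracket
    by (intro lin_ext_cong)
      (auto simp: free_gen_def tdeg_tw tcur_parity dest!: osp_bracket_parity)
  then show ?thesis
    unfolding env_relator_def free_comp_diff free_comp_cscale
    by (auto simp: free_gen_def mult_single plus_mon_def free_comp_single add.commute
        tensor_act_bracket[of zs a b])
qed

text \<open>A right factor of the relator is absorbed into the vector it acts on; therefore
  \<open>m\<close> is arbitrary and not just the generator.\<close>

lemma free_comp_env_ideal: "x \<in> env_ideal \<Longrightarrow> free_comp zs s m x = 0"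
proof (induction rule: env_ideal.induct)
  case (gen x a b y)
  have left: "free_comp zs s m (x * env_relator a b) = 0" for s m
    by (induction x rule: poly_mapping_single_induct)
      (simp_all add: distrib_right mult.assoc free_comp_add free_comp_mult_left
        free_comp_env_relator)
  show ?case
    by (induction y rule: poly_mapping_single_induct)
      (simp_all add: distrib_left free_comp_add free_comp_mult_right left)
qed (simp_all add: free_comp_add)

lift_definition env_comp :: "complex list \<Rightarrow> nat \<Rightarrow> env \<Rightarrow> (vbas list \<Rightarrow>\<^sub>0 complex)"
  is "\<lambda>zs s x. free_comp zs s (tensor_gen zs) x"
proof -
  fix zs s x y assume "env_rel x y"
  then have "free_comp zs s (tensor_gen zs) (x - y) = 0"
    unfolding env_rel_def by (rule free_comp_env_ideal)
  then show "free_comp zs s (tensor_gen zs) x = free_comp zs s (tensor_gen zs) y"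
    by (simp add: free_comp_diff)
qed

lemma env_cases: obtains x where "u = abs_env x"
  using Quotient3_abs_rep[OF Quotient3_env] by metis

lemma env_comp_add: "env_comp zs s (u + v) = env_comp zs s u + env_comp zs s v"
  by transfer (rule free_comp_add)

lemma env_comp_diff: "env_comp zs s (u - v) = env_comp zs s u - env_comp zs s v"
  by transfer (rule free_comp_diff)

lemma env_comp_zero [simp]: "env_comp zs s 0 = 0"
  using env_comp_diff[of zs s 0 0] by simp

lemma env_comp_const_mult: "env_comp zs s (env_const c * u) = cscale c (env_comp zs s u)"
  by transfer (simp add: free_comp_mult_left zero_mon_def)

lemma env_comp_gen_mult:
  "env_comp zs s (env_gen a * u) =
    (if tdeg a \<le> s then tensor_act zs a (env_comp zs (s - tdeg a) u) else 0)"
proof -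
  obtain x where u: "u = abs_env x" by (rule env_cases)
  show ?thesis
    by (simp add: u env_gen.abs_eq times_env.abs_eq env_comp.abs_eq free_gen_def free_comp_mult_left)
qed

lemma env_comp_one: "env_comp zs s 1 = (if s = 0 then tensor_gen zs else 0)"
  by transfer (simp add: free_comp_single zero_mon_def flip: single_one)

lemma env_comp_word:
  "env_comp zs s (prod_list (map env_gen ws)) =
    (if word_deg ws = s then tensor_word zs ws (tensor_gen zs) else 0)"
  by (induction ws arbitrary: s) (auto simp: env_comp_one env_comp_gen_mult)

lemma finite_env_comp: "finite {s. env_comp zs s u \<noteq> 0}"
proof -
  obtain x where u: "u = abs_env x" by (rule env_cases)
  have "{s. free_comp zs s (tensor_gen zs) x \<noteq> 0} \<subseteq> (\<lambda>u. word_deg (letters u)) ` Poly_Mapping.keys x"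
  proof (rule subsetI, rule ccontr)
    fix s assume s: "s \<in> {s. free_comp zs s (tensor_gen zs) x \<noteq> 0}"
      and "s \<notin> (\<lambda>u. word_deg (letters u)) ` Poly_Mapping.keys x"
    then have "free_comp zs s (tensor_gen zs) x = lin_ext (\<lambda>u. 0) x"
      unfolding free_comp_def by (intro lin_ext_cong) auto
    with s show False by simp
  qed
  then show ?thesis
    unfolding u env_comp.abs_eq by (rule finite_subset) simp
qed

text \<open>That the quotient does not collapse is seen on a nonzero representation, here the empty
  tensor product, where 1 fixes the generator.\<close>

instance env :: ring_1
proof
  have "tensor_gen [] \<noteq> 0"
    by (simp add: tensor_gen_def poly_mapping_eq_iff fun_eq_iff lookup_single)
  then have "env_comp [] 0 0 \<noteq> env_comp [] 0 1" by (simp add: env_comp_one)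
  then show "(0 :: env) \<noteq> 1" by metis
qed

text \<open>The degree s part of a representative works for all parameter lists simultaneously. This
  uniformity allows a comparison of two graded tensor products degree by degree.\<close>

lemma env_homogeneous_component:
  "\<exists>v. \<forall>zs t. env_comp zs t v = (if t = s then env_comp zs s u else 0)"
proof -
  obtain x where u: "u = abs_env x" by (rule env_cases)
  define y where "y = lin_ext (\<lambda>w. if word_deg (letters w) = s then Poly_Mapping.single w 1 else 0) x"

  have "env_comp zs t (abs_env y) = (if t = s then env_comp zs s u else 0)" for zs t
  proof -
    have "free_comp zs t m y = (if t = s then free_comp zs s m x else 0)" for m

    proof (cases "t = s")
      case False
      then have "lin_ext (\<lambda>a. lin_ext (\<lambda>u. if word_deg (letters u) = t then tensor_word zs (letters u) m else 0)
          (if word_deg (letters a) = s then Poly_Mapping.single a 1 else 0)) x = lin_ext (\<lambda>a. 0) x"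
        by (intro lin_ext_cong) auto
      with False show ?thesis by (simp add: y_def free_comp_def lin_ext_lin_ext)
    qed (auto simp: y_def free_comp_def lin_ext_lin_ext intro!: lin_ext_cong)
    then show ?thesis by (simp add: u env_comp.abs_eq)
  qed
  then show ?thesis by blast
qed

section \<open>Relations in the enveloping algebra\<close>

definition env_scale :: "complex \<Rightarrow> env \<Rightarrow> env"
  where "env_scale c u = env_const c * u"

lemma env_const_abs: "env_const c = abs_env (Poly_Mapping.single 0 c)"
  by (rule env_const.abs_eq)

lemma env_scale_abs: "env_scale c (abs_env x) = abs_env (cscale c x)"
  by (simp add: env_scale_def env_const_abs times_env.abs_eq cscale_def mult_map_scale_conv_mult)

lemma abs_env_simps:
  "abs_env 0 = 0" "abs_env 1 = 1" "abs_env x + abs_env y = abs_env (x + y)"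
  "abs_env x - abs_env y = abs_env (x - y)" "abs_env x * abs_env y = abs_env (x * y)"
  by (simp_all add: zero_env.abs_eq one_env.abs_eq plus_env.abs_eq minus_env.abs_eq times_env.abs_eq)

lemma mult_cscale_right: "x * cscale c y = cscale c (x * y)" for x y :: free_alg
proof -
  have "x * Poly_Mapping.single 0 c = Poly_Mapping.single 0 c * x"
    by (induction x rule: poly_mapping_single_induct)
      (simp_all add: distrib_left distrib_right mult_single mult.commute)
  then have "x * (Poly_Mapping.single 0 c * y) = Poly_Mapping.single 0 c * (x * y)"
    by (metis mult.assoc)
  then show ?thesis by (simp add: cscale_def mult_map_scale_conv_mult)
qed

interpretation ev: unital_algebra env_scale
proof
  fix a b :: complex and x y :: env
  obtain x' y' where x: "x = abs_env x'" and y: "y = abs_env y'" by (metis env_cases)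
  show "env_scale a (x + y) = env_scale a x + env_scale a y"
    by (simp add: x y env_scale_abs abs_env_simps cvec.scale_right_distrib)
  show "env_scale (a + b) x = env_scale a x + env_scale b x"
    by (simp add: x env_scale_abs abs_env_simps cvec.scale_left_distrib)
  show "env_scale a (env_scale b x) = env_scale (a * b) x"
    by (simp add: x env_scale_abs)
  show "env_scale 1 x = x"
    by (simp add: x env_scale_abs)
  show "env_scale a x * y = env_scale a (x * y)"
    by (simp add: env_scale_def mult.assoc)
  show "x * env_scale a y = env_scale a (x * y)"
    by (simp add: x y env_scale_abs abs_env_simps mult_cscale_right)
qed

lemma env_scale_numeral: "env_scale (numeral k) u = numeral k * u"
  using ev.of_nat_mult_eq_scale[of "numeral k" u] by simp

lemma env_span_words: "ev.span {prod_list (map env_gen ws) |ws. True} = UNIV"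
proof -
  have word: "abs_env (Poly_Mapping.single (Mon ws) c) = env_scale c (prod_list (map env_gen ws))" for ws c
  proof -
    have "prod_list (map env_gen ws) = abs_env (Poly_Mapping.single (Mon ws) 1)"
    proof (induction ws)
      case Nil
      show ?case by (simp add: abs_env_simps flip: zero_mon_def)
    next
      case (Cons a ws)
      then show ?case
        by (simp add: env_gen.abs_eq abs_env_simps free_gen_def mult_single plus_mon_def)
    qed
    then show ?thesis by (simp add: env_scale_abs)
  qed
  have "abs_env x \<in> ev.span {prod_list (map env_gen ws) |ws. True}" for x
  proof (induction x rule: poly_mapping_single_induct)
    case zero
    then show ?case by (simp add: abs_env_simps ev.span_zero)
  next
    case (add u c x)
    then show ?case
      using word[of "letters u" c]
      by (auto simp flip: abs_env_simps(3) intro!: ev.span_add ev.span_scale intro: ev.span_base)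
  qed
  then show ?thesis by (metis UNIV_eq_I env_cases)
qed

lemma env_gen_mult:
  "env_gen a * env_gen b = env_scale (ssign (tparity a) (tparity b)) (env_gen b * env_gen a)
    + abs_env (lin_ext (\<lambda>y. free_gen (tw y (tdeg a + tdeg b))) (osp_bracket (tosp a) (tosp b)))"
proof -
  have "env_relator a b \<in> env_ideal"
    using env_ideal.gen[of 1 a b 1] by simp
  then have "abs_env (free_gen a * free_gen b) = abs_env
    (cscale (ssign (tparity a) (tparity b)) (free_gen b * free_gen a) + lin_ext free_gen (tbracket a b))"
    by (simp add: env.abs_eq_iff env_rel_def env_relator_def diff_diff_eq)
  then show ?thesis
    by (simp add: env_gen.abs_eq env_scale_abs abs_env_simps lin_ext_tbracket)
qed

text \<open>Halved degrees: \<open>ue i\<close> is e_{2i} and \<open>up i\<close> is g^+_{2i+1}. The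
  even part becomes the untwisted current algebra of sl(2) in the variable t^2, and two odd elements
  with indices i, j bracket into index i + j + 1.\<close>

definition ue :: "nat \<Rightarrow> env" where "ue i = env_gen (tw OE (2 * i))"
definition uh :: "nat \<Rightarrow> env" where "uh i = env_gen (tw OH (2 * i))"
definition uf :: "nat \<Rightarrow> env" where "uf i = env_gen (tw OF (2 * i))"
definition up :: "nat \<Rightarrow> env" where "up i = env_gen (tw OGp (2 * i + 1))"
definition um :: "nat \<Rightarrow> env" where "um i = env_gen (tw OGm (2 * i + 1))"

lemmas u_defs = ue_def uh_def uf_def up_def um_def

lemma abs_env_scaled_gen: "abs_env (cscale c (free_gen a)) = env_scale c (env_gen a)"
  and abs_env_uminus_gen: "abs_env (- free_gen a) = - env_gen a"
  and abs_env_gen: "abs_env (free_gen a) = env_gen a"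
  by (simp_all add: env_gen.abs_eq env_scale_abs uminus_env.abs_eq)

lemma ue_ue: "ue i * ue j = ue j * ue i"
  and uh_ue: "uh i * ue j = ue j * uh i + 2 * ue (i + j)"
  and uf_ue: "uf i * ue j = ue j * uf i - uh (i + j)"
  and uh_up: "uh i * up j = up j * uh i + up (i + j)"
  and up_up: "up i * up j = - (up j * up i) + 2 * ue (i + j + 1)"
  and uf_up: "uf i * up j = up j * uf i - um (i + j)"
  and ue_up: "ue i * up j = up j * ue i"
  and um_ue: "um i * ue j = ue j * um i + up (i + j)"
  and um_up: "um i * up j = - (up j * um i) + uh (i + j + 1)"
  unfolding u_defs by (subst env_gen_mult;
      simp add: tparity_def tosp_tw tdeg_tw ssign_def abs_env_scaled_gen abs_env_uminus_gen abs_env_gen abs_env_simps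
        env_scale_numeral algebra_simps)+

interpretation sl2: sl2_current env_scale ue uh uf
  by unfold_locales (fact ue_ue uh_ue uf_ue)+

lemma env_gen_cases:
  obtains i where "env_gen a = ue i" | i where "env_gen a = uh i" | i where "env_gen a = uf i"
    | i where "env_gen a = up i" | i where "env_gen a = um i"
proof -
  have a: "a = tw (tosp a) (tdeg a)"
    by (simp add: tw_def tosp_def tdeg_def Rep_tcur_inverse)
  have par: "osp_odd (tosp a) \<longleftrightarrow> odd (tdeg a)" by (rule tcur_parity)
  show ?thesis
  proof (cases "even (tdeg a)")
    case True
    then obtain i where "tdeg a = 2 * i" by (rule evenE)
    with a par that show ?thesis by (cases "tosp a") (auto simp: u_defs)
  next
    case False
    then obtain i where "tdeg a = 2 * i + 1" by (rule oddE)
    with a par that show ?thesis by (cases "tosp a") (auto simp: u_defs)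
  qed
qed

section \<open>The spanning set\<close>

definition weyl_left_ideal :: "nat \<Rightarrow> env set"
  where "weyl_left_ideal n = \<Inter> {J. left_ideal J \<and> weyl_relators n \<subseteq> J}"

lemma left_ideal_weyl: "left_ideal (weyl_left_ideal n)"
  by (auto simp: weyl_left_ideal_def left_ideal_def)

lemma left_ideal_mult: "left_ideal J \<Longrightarrow> x \<in> J \<Longrightarrow> u * x \<in> J"
  by (simp add: left_ideal_def)

lemma left_ideal_subspace: "left_ideal J \<Longrightarrow> ev.subspace J"
  by (auto simp: left_ideal_def ev.subspace_def env_scale_def)

lemma weyl_left_ideal_mult: "x \<in> weyl_left_ideal n \<Longrightarrow> u * x \<in> weyl_left_ideal n"
  using left_ideal_weyl left_ideal_mult by blast

lemma env_const_of_nat: "env_const (of_nat n) = of_nat n"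
  using ev.of_nat_mult_eq_scale[of n 1] by (simp add: env_scale_def)

lemma weyl_relators_mem:
  "uf i \<in> weyl_left_ideal n" "um i \<in> weyl_left_ideal n" "uh (Suc i) \<in> weyl_left_ideal n"
  "uh 0 + of_nat n \<in> weyl_left_ideal n" "ue 0 ^ Suc n \<in> weyl_left_ideal n"
proof -
  have "weyl_relators n \<subseteq> weyl_left_ideal n"
    by (auto simp: weyl_left_ideal_def)
  then show "uf i \<in> weyl_left_ideal n" "um i \<in> weyl_left_ideal n" "uh (Suc i) \<in> weyl_left_ideal n"
    "uh 0 + of_nat n \<in> weyl_left_ideal n" "ue 0 ^ Suc n \<in> weyl_left_ideal n"
    by (auto simp: weyl_relators_def u_defs env_const_of_nat)
qed

abbreviation uel :: "nat list \<Rightarrow> env" where "uel as \<equiv> prod_list (map ue as)"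
abbreviation upl :: "nat list \<Rightarrow> env" where "upl bs \<equiv> prod_list (map up bs)"

text \<open>The preimage in U of a subspace of U / J. The condition restricts only the odd factors;
  products of the e_a are free, so each such space is stable under all e_a.\<close>

definition filt :: "nat \<Rightarrow> (nat list \<Rightarrow> bool) \<Rightarrow> env set"
  where "filt n P = ev.span (weyl_left_ideal n \<union> {uel as * upl bs |as bs. P bs})"

lemma subspace_filt: "ev.subspace (filt n P)"
  by (simp add: filt_def)

lemma filt_ideal: "x \<in> weyl_left_ideal n \<Longrightarrow> x \<in> filt n P"
  by (auto simp: filt_def intro: ev.span_base)

lemma filt_base: "P bs \<Longrightarrow> uel as * upl bs \<in> filt n P"
  by (auto simp: filt_def intro: ev.span_base)

lemma filt_upl: "P bs \<Longrightarrow> upl bs \<in> filt n P"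
  using filt_base[of P bs "[]"] by simp

lemma filt_mono:
  assumes "x \<in> filt n P" "\<And>bs. P bs \<Longrightarrow> Q bs"
  shows "x \<in> filt n Q"
  using assms(1) unfolding filt_def by (rule rev_subsetD) (intro ev.span_mono, use assms(2) in auto)

lemma filt_mult:
  assumes "x \<in> filt n P" "\<And>as bs. P bs \<Longrightarrow> u * (uel as * upl bs) \<in> filt n Q"
  shows "u * x \<in> filt n Q"
  using assms(1)
  unfolding filt_def[of n P] filt_def[of n Q]
proof (rule ev.mult_span_mem)
  fix y assume "y \<in> weyl_left_ideal n \<union> {uel as * upl bs |as bs. P bs}"
  then have "u * y \<in> filt n Q"
    using assms(2) by (auto intro: filt_ideal weyl_left_ideal_mult)
  then show "u * y \<in> ev.span (weyl_left_ideal n \<union> {uel as * upl bs |as bs. Q bs})"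
    by (simp add: filt_def)
qed

lemma filt_ue: "x \<in> filt n P \<Longrightarrow> ue i * x \<in> filt n P"
proof (erule filt_mult)
  fix as bs assume "P bs"
  then show "ue i * (uel as * upl bs) \<in> filt n P"
    using filt_base[of P bs "i # as"] by (simp add: mult.assoc)
qed

lemma up_uel: "up j * uel as = uel as * up j"
  by (rule prod_list_map_commute) (simp add: ue_up)

lemma filt_up:
  assumes "x \<in> filt n P" "\<And>bs. P bs \<Longrightarrow> Q (j # bs)"
  shows "up j * x \<in> filt n Q"
  using assms(1)
proof (rule filt_mult)
  fix as bs assume "P bs"
  have "up j * (uel as * upl bs) = uel as * upl (j # bs)"
    by (simp add: up_uel flip: mult.assoc)
  then show "up j * (uel as * upl bs) \<in> filt n Q"
    using filt_base assms(2)[OF \<open>P bs\<close>] by metis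
qed

section \<open>Action of h, g^- and f on products of the g^+\<close>

lemma uh_upl:
  "uh i * upl bs - upl bs * uh i
    \<in> ev.span {upl bs' |bs'. length bs' = length bs \<and> sum_list bs' = sum_list bs + i}"
proof (induction bs)
  case (Cons j bs)
  have "uh i * upl (j # bs) = (up j * uh i + up (i + j)) * upl bs"
    by (simp add: uh_up flip: mult.assoc)
  then have "uh i * upl (j # bs) - upl (j # bs) * uh i
    = up j * (uh i * upl bs - upl bs * uh i) + upl ((i + j) # bs)"
    by (simp add: algebra_simps)
  also have "\<dots> \<in> ev.span {upl bs' |bs'. length bs' = length (j # bs) \<and> sum_list bs' = sum_list (j # bs) + i}"
  proof (intro ev.span_add ev.mult_span_mem[OF Cons.IH])
    fix y assume "y \<in> {upl bs' |bs'. length bs' = length bs \<and> sum_list bs' = sum_list bs + i}"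
    then obtain bs' where "y = upl bs'" "length bs' = length bs" "sum_list bs' = sum_list bs + i"
      by blast
    then show "up j * y \<in> ev.span {upl bs' |bs'. length bs' = length (j # bs) \<and> sum_list bs' = sum_list (j # bs) + i}"
      by (intro ev.span_base) (auto intro!: exI[of _ "j # bs'"])
  next
    show "upl ((i + j) # bs) \<in> ev.span {upl bs' |bs'. length bs' = length (j # bs) \<and> sum_list bs' = sum_list (j # bs) + i}"
      by (intro ev.span_base CollectI exI[of _ "(i + j) # bs"]) simp
  qed
  finally show ?case .
qed (simp add: ev.span_zero)

text \<open>Since h_{2i+2} kills the generator, only commutators survive, each with one index raised
  by i + 1. The length is unchanged, and it is the strictly larger sum that makes these terms
  negligible.\<close>

lemma uh_Suc_upl_mem:
  "uh (Suc i) * upl bs \<in> filt n (\<lambda>bs'. length bs' = length bs \<and> sum_list bs' = sum_list bs + Suc i)"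
    (is "_ \<in> ?F")
proof -
  have "{upl bs' |bs'. length bs' = length bs \<and> sum_list bs' = sum_list bs + Suc i} \<subseteq> ?F"
    by (auto intro: filt_upl)
  then have "uh (Suc i) * upl bs - upl bs * uh (Suc i) \<in> ?F"
    using ev.span_minimal[OF _ subspace_filt] uh_upl by blast
  moreover have "upl bs * uh (Suc i) \<in> ?F"
    by (intro filt_ideal weyl_left_ideal_mult weyl_relators_mem)
  ultimately have "(uh (Suc i) * upl bs - upl bs * uh (Suc i)) + upl bs * uh (Suc i) \<in> ?F"
    by (rule ev.subspace_add[OF subspace_filt])
  then show ?thesis by simp
qed

lemma uh0_upl: "uh 0 * upl bs = upl bs * uh 0 + of_nat (length bs) * upl bs"
proof (induction bs)
  case (Cons j bs)
  have "uh 0 * upl (j # bs) = (up j * uh 0 + up j) * upl bs"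
    by (simp add: uh_up flip: mult.assoc)
  also have "\<dots> = up j * (uh 0 * upl bs) + up j * upl bs"
    by (simp add: algebra_simps)
  also have "\<dots> = upl (j # bs) * uh 0 + up j * (of_nat (length bs) * upl bs) + up j * upl bs"
    unfolding Cons.IH by (simp add: algebra_simps)
  also have "up j * (of_nat (length bs) * upl bs) = of_nat (length bs) * upl (j # bs)"
    by (metis (no_types, lifting) list.simps(9) mult.assoc mult_of_nat_commute prod_list.Cons)
  finally show ?case by (simp add: algebra_simps)
qed simp

lemma uh0_upl_mem:
  assumes "length bs \<le> n"
  shows "uh 0 * upl bs + of_nat (n - length bs) * upl bs \<in> weyl_left_ideal n"
proof -
  have "upl bs * (uh 0 + of_nat n) \<in> weyl_left_ideal n"
    by (intro weyl_left_ideal_mult weyl_relators_mem)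
  also have "upl bs * (uh 0 + of_nat n) = upl bs * uh 0 + of_nat n * upl bs"
    by (simp only: distrib_left mult_of_nat_commute)
  also have "\<dots> = uh 0 * upl bs + of_nat (n - length bs) * upl bs"
    using assms by (simp add: uh0_upl of_nat_diff algebra_simps)
  finally show ?thesis .
qed

lemma uh_upl_mem:
  "uh i * upl bs \<in> filt n (\<lambda>bs'. length bs' = length bs \<and> sum_list bs \<le> sum_list bs')" (is "_ \<in> ?F")
proof (cases i)
  case (Suc k)
  show ?thesis unfolding Suc using uh_Suc_upl_mem by (rule filt_mono) auto
next
  case 0
  have base: "upl bs \<in> ?F" by (rule filt_upl) simp
  have "upl bs * (uh 0 + of_nat n) \<in> ?F"
    by (intro filt_ideal weyl_left_ideal_mult weyl_relators_mem)
  then have "upl bs * (uh 0 + of_nat n) - of_nat n * upl bs + of_nat (length bs) * upl bs \<in> ?F"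
    using base by (simp only: ev.of_nat_mult_eq_scale)
      (intro ev.subspace_add[OF subspace_filt] ev.subspace_diff[OF subspace_filt] ev.subspace_scale[OF subspace_filt])
  also have "upl bs * (uh 0 + of_nat n) - of_nat n * upl bs = upl bs * uh 0"
    by (simp only: distrib_left mult_of_nat_commute) simp
  finally show ?thesis unfolding 0 uh0_upl .
qed

text \<open>A bracket of g^- with g^+ is some h of positive index, never h_0, and such an h
  preserves the length. So exactly the one g^+ used in the bracket is lost.\<close>

lemma um_upl_mem: "um i * upl bs \<in> filt n (\<lambda>bs'. Suc (length bs') = length bs)"
proof (induction bs arbitrary: i)
  case Nil
  then show ?case by (simp add: filt_ideal weyl_relators_mem)
next
  case (Cons j bs)
  have "um i * upl (j # bs) = (- (up j * um i) + uh (i + j + 1)) * upl bs"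
    by (simp add: um_up flip: mult.assoc)
  also have "\<dots> = uh (Suc (i + j)) * upl bs - up j * (um i * upl bs)"
    by (simp add: algebra_simps)
  also have "\<dots> \<in> filt n (\<lambda>bs'. Suc (length bs') = length (j # bs))"
  proof (rule ev.subspace_diff[OF subspace_filt])
    show "uh (Suc (i + j)) * upl bs \<in> filt n (\<lambda>bs'. Suc (length bs') = length (j # bs))"
      using uh_Suc_upl_mem by (rule filt_mono) auto
    show "up j * (um i * upl bs) \<in> filt n (\<lambda>bs'. Suc (length bs') = length (j # bs))"
      using Cons.IH by (rule filt_up) auto
  qed
  finally show ?case .
qed

text \<open>f turns one g^+ into a g^-, which in turn consumes another g^+.\<close>

lemma uf_upl_mem: "uf i * upl bs \<in> filt n (\<lambda>bs'. length bs' + 2 = length bs)"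
proof (induction bs arbitrary: i)
  case Nil
  then show ?case by (simp add: filt_ideal weyl_relators_mem)
next
  case (Cons j bs)
  have "uf i * upl (j # bs) = (up j * uf i - um (i + j)) * upl bs"
    by (simp add: uf_up flip: mult.assoc)
  also have "\<dots> = up j * (uf i * upl bs) - um (i + j) * upl bs"
    by (simp add: algebra_simps)
  also have "\<dots> \<in> filt n (\<lambda>bs'. length bs' + 2 = length (j # bs))"
  proof (rule ev.subspace_diff[OF subspace_filt])
    show "up j * (uf i * upl bs) \<in> filt n (\<lambda>bs'. length bs' + 2 = length (j # bs))"
      using Cons.IH by (rule filt_up) auto
    show "um (i + j) * upl bs \<in> filt n (\<lambda>bs'. length bs' + 2 = length (j # bs))"
      using um_upl_mem by (rule filt_mono) auto
  qed
  finally show ?case .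
qed

text \<open>The modules \<open>filt n P\<close> for such \<open>P\<close> form the filtration whose subquotients are Weyl modules of
  the current algebra of \<open>sl\<^sub>2\<close>.\<close>

definition up_closed :: "(nat list \<Rightarrow> bool) \<Rightarrow> bool"
  where "up_closed P \<longleftrightarrow> (\<forall>bs bs'. P bs \<longrightarrow>
    length bs' < length bs \<or> length bs' = length bs \<and> sum_list bs \<le> sum_list bs' \<longrightarrow> P bs')"

lemma up_closedD:
  assumes "up_closed P" "P bs"
    and "length bs' < length bs \<or> length bs' = length bs \<and> sum_list bs \<le> sum_list bs'"
  shows "P bs'"
  using assms unfolding up_closed_def by metis

lemma filt_uh:
  assumes "up_closed P" "x \<in> filt n P"
  shows "uh i * x \<in> filt n P"
  using assms(2)
proof (rule filt_mult)
  fix as bs assume "P bs"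
  show "uh i * (uel as * upl bs) \<in> filt n P"
  proof (induction as arbitrary: i)
    case Nil
    have "uh i * upl bs \<in> filt n P"
      by (rule filt_mono[OF uh_upl_mem]) (rule up_closedD[OF assms(1) \<open>P bs\<close>], simp)
    then show ?case by simp
  next
    case (Cons j as)
    have "uh i * (uel (j # as) * upl bs) = (ue j * uh i + 2 * ue (i + j)) * (uel as * upl bs)"
      by (simp add: uh_ue flip: mult.assoc)
    also have "\<dots> = ue j * (uh i * (uel as * upl bs)) + env_scale 2 (uel ((i + j) # as) * upl bs)"
      by (simp add: env_scale_numeral algebra_simps)
    also have "\<dots> \<in> filt n P"
      by (intro ev.subspace_add[OF subspace_filt] ev.subspace_scale[OF subspace_filt] filt_ue Cons.IH
          filt_base \<open>P bs\<close>)
    finally show ?case .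
  qed
qed

lemma filt_uf:
  assumes "up_closed P" "x \<in> filt n P"
  shows "uf i * x \<in> filt n P"
  using assms(2)
proof (rule filt_mult)
  fix as bs assume "P bs"
  show "uf i * (uel as * upl bs) \<in> filt n P"
  proof (induction as arbitrary: i)
    case Nil
    have "uf i * upl bs \<in> filt n P"
      by (rule filt_mono[OF uf_upl_mem]) (rule up_closedD[OF assms(1) \<open>P bs\<close>], simp)
    then show ?case by simp
  next
    case (Cons j as)
    have "uf i * (uel (j # as) * upl bs) = (ue j * uf i - uh (i + j)) * (uel as * upl bs)"
      by (simp add: uf_ue flip: mult.assoc)
    also have "\<dots> = ue j * (uf i * (uel as * upl bs)) - uh (i + j) * (uel as * upl bs)"
      by (simp add: algebra_simps)
    also have "\<dots> \<in> filt n P"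
      by (intro ev.subspace_diff[OF subspace_filt] filt_ue Cons.IH filt_uh[OF assms(1)]
          filt_base \<open>P bs\<close>)
    finally show ?case .
  qed
qed

lemma filt_um:
  assumes "x \<in> filt n (\<lambda>_. True)"
  shows "um i * x \<in> filt n (\<lambda>_. True)"
  using assms
proof (rule filt_mult)
  fix as bs
  show "um i * (uel as * upl bs) \<in> filt n (\<lambda>_. True)"
  proof (induction as arbitrary: i)
    case Nil
    have "um i * upl bs \<in> filt n (\<lambda>_. True)"
      using um_upl_mem by (rule filt_mono) simp
    then show ?case by simp
  next
    case (Cons j as)
    have "um i * (uel (j # as) * upl bs) = (ue j * um i + up (i + j)) * (uel as * upl bs)"
      by (simp add: um_ue flip: mult.assoc)
    also have "\<dots> = ue j * (um i * (uel as * upl bs)) + up (i + j) * (uel as * upl bs)"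
      by (simp add: algebra_simps)
    also have "\<dots> \<in> filt n (\<lambda>_. True)"
      by (intro ev.subspace_add[OF subspace_filt] filt_ue Cons.IH
          filt_up[where P = "\<lambda>_. True"] filt_base) simp_all
    finally show ?case .
  qed
qed

text \<open>The ordered monomials and J span a subspace that contains 1 and is stable under left
  multiplication by all generators, hence all of U.\<close>

lemma filt_True: "filt n (\<lambda>_. True) = UNIV"
proof -
  have "prod_list (map env_gen ws) \<in> filt n (\<lambda>_. True)" for ws
  proof (induction ws)
    case Nil
    then show ?case using filt_base[of "\<lambda>_. True" "[]" "[]"] by simp
  next
    case (Cons a ws)
    have "up_closed (\<lambda>_. True)" by (simp add: up_closed_def)
    with Cons show ?case
      by (cases a rule: env_gen_cases) (auto intro: filt_ue filt_uh filt_uf filt_um filt_up)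
  qed
  then have "ev.span {prod_list (map env_gen ws) |ws. True} \<subseteq> filt n (\<lambda>_. True)"
    by (intro ev.span_minimal subspace_filt) auto
  then show ?thesis unfolding env_span_words by blast
qed

section \<open>Commuting and reordering the odd factors\<close>

lemma uel_e_power: "ue 0 ^ k * upl bs = upl bs * ue 0 ^ k"
  using up_uel[of _ "replicate k 0"] prod_list_map_commute[of "ue 0 ^ k" up bs]
  by (simp add: map_replicate_const prod_list_replicate)

text \<open>Modulo products with fewer g^+ these elements anticommute, so reordering costs a sign.
  The scalar is left unspecified since only membership in subspaces is at stake.\<close>

definition upl_equiv :: "nat \<Rightarrow> nat list \<Rightarrow> nat list \<Rightarrow> bool"
  where "upl_equiv n bs cs \<longleftrightarrow> length bs = length cs \<and>
    (\<exists>\<epsilon>. upl bs - env_scale \<epsilon> (upl cs) \<in> filt n (\<lambda>ds. length ds < length bs))"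

lemma upl_equiv_refl: "upl_equiv n bs bs"
  unfolding upl_equiv_def
  by (rule conjI[OF refl], rule exI[of _ 1]) (simp add: ev.subspace_0[OF subspace_filt])

lemma upl_equiv_trans:
  assumes "upl_equiv n bs cs" "upl_equiv n cs ds"
  shows "upl_equiv n bs ds"
proof -
  from assms obtain \<epsilon> \<delta> where l: "length bs = length cs" "length cs = length ds"
    and 1: "upl bs - env_scale \<epsilon> (upl cs) \<in> filt n (\<lambda>ds. length ds < length bs)"
    and 2: "upl cs - env_scale \<delta> (upl ds) \<in> filt n (\<lambda>ds. length ds < length bs)"
    unfolding upl_equiv_def by auto
  have "(upl bs - env_scale \<epsilon> (upl cs)) + env_scale \<epsilon> (upl cs - env_scale \<delta> (upl ds))
    \<in> filt n (\<lambda>ds. length ds < length bs)"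
    by (intro ev.subspace_add[OF subspace_filt] ev.subspace_scale[OF subspace_filt] 1 2)
  then have "upl bs - env_scale (\<epsilon> * \<delta>) (upl ds) \<in> filt n (\<lambda>ds. length ds < length bs)"
    by (simp add: ev.scale_right_diff_distrib)
  with l show ?thesis unfolding upl_equiv_def by auto
qed

lemma upl_equiv_Cons:
  assumes "upl_equiv n bs cs"
  shows "upl_equiv n (j # bs) (j # cs)"
proof -
  from assms obtain \<epsilon> where l: "length bs = length cs"
    and 1: "upl bs - env_scale \<epsilon> (upl cs) \<in> filt n (\<lambda>ds. length ds < length bs)"
    unfolding upl_equiv_def by auto
  have "up j * (upl bs - env_scale \<epsilon> (upl cs)) \<in> filt n (\<lambda>ds. length ds < length (j # bs))"
    using 1 by (rule filt_up) simp
  also have "up j * (upl bs - env_scale \<epsilon> (upl cs)) = upl (j # bs) - env_scale \<epsilon> (upl (j # cs))"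
    by (simp add: right_diff_distrib ev.mult_scale_right)
  finally show ?thesis using l unfolding upl_equiv_def by auto
qed

lemma upl_equiv_swap: "upl_equiv n (i # j # bs) (j # i # bs)"
proof -
  have "upl (i # j # bs) = (- (up j * up i) + 2 * ue (i + j + 1)) * upl bs"
    using up_up[of i j] by (simp flip: mult.assoc)
  then have "upl (i # j # bs) - env_scale (- 1) (upl (j # i # bs)) = env_scale 2 (uel [i + j + 1] * upl bs)"
    by (simp add: env_scale_numeral algebra_simps)
  also have "\<dots> \<in> filt n (\<lambda>ds. length ds < length (i # j # bs))"
    by (intro ev.subspace_scale[OF subspace_filt] filt_base) simp
  finally have "upl (i # j # bs) - env_scale (- 1) (upl (j # i # bs))
    \<in> filt n (\<lambda>ds. length ds < length (i # j # bs))" .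
  then show ?thesis unfolding upl_equiv_def by (intro conjI exI[of _ "- 1"]) simp_all
qed

lemma upl_equiv_insort: "upl_equiv n (i # bs) (insort i bs)"
proof (induction bs)
  case (Cons j bs)
  show ?case
  proof (cases "i \<le> j")
    case False
    then show ?thesis
      using upl_equiv_trans[OF upl_equiv_swap upl_equiv_Cons[OF Cons.IH]] by simp
  qed (simp add: upl_equiv_refl)
qed (simp add: upl_equiv_refl)

lemma upl_equiv_sort: "upl_equiv n bs (sort bs)"
proof (induction bs)
  case (Cons j bs)
  then show ?case
    using upl_equiv_trans[OF upl_equiv_Cons upl_equiv_insort] by simp
qed (simp add: upl_equiv_refl)

lemma sorted_not_distinct_adjacent:
  assumes "sorted cs" "\<not> distinct cs"
  shows "\<exists>xs i ys. cs = xs @ i # i # ys"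
  using assms
proof (induction cs)
  case (Cons a cs)
  show ?case
  proof (cases "distinct cs")
    case True
    with Cons.prems have "a \<in> set cs" by simp
    with Cons.prems obtain ys where "cs = a # ys" by (cases cs) (auto intro: order.antisym)
    then show ?thesis by (intro exI[of _ "[]"]) simp
  next
    case False
    with Cons obtain xs i ys where "cs = xs @ i # i # ys" by auto
    then show ?thesis by (metis append_Cons)
  qed
qed simp

text \<open>From [g^+, g^+] = 2e the square of g^+_{2i+1} is e_{4i+2}, so a repetition removes two
  odd factors.\<close>

lemma upl_repeat_mem: "upl (bs @ i # i # cs) \<in> filt n (\<lambda>ds. length ds < length (bs @ i # i # cs))"
proof (induction bs)
  case Nil
  have "up i * up i + up i * up i = 2 * ue (i + i + 1)"
    using up_up[of i i] by (simp add: eq_diff_eq)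
  then have "2 * (up i * up i) = 2 * ue (i + i + 1)" by (simp add: mult_2)
  then have "env_scale (1 / 2) (env_scale 2 (up i * up i)) = env_scale (1 / 2) (env_scale 2 (ue (i + i + 1)))"
    by (simp only: env_scale_numeral)
  then have "up i * up i = ue (i + i + 1)" by simp
  then have "upl ([] @ i # i # cs) = uel [i + i + 1] * upl cs"
    by (simp flip: mult.assoc)
  then show ?case using filt_base[of "\<lambda>ds. length ds < length ([] @ i # i # cs)" cs "[i + i + 1]"] by simp
next
  case (Cons j bs)
  have "up j * upl (bs @ i # i # cs) \<in> filt n (\<lambda>ds. length ds < length ((j # bs) @ i # i # cs))"
    using Cons.IH by (rule filt_up) simp
  then show ?case by simp
qed

text \<open>Garland's relation with s = 1 kills e_{2i} on the generator for i >= n, and the bracket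
  with g^-_1, which also kills the generator, turns this into g^+_{2i+1}.\<close>

lemma up_mem:
  assumes "n \<le> i"
  shows "up i \<in> weyl_left_ideal n"
proof -
  have "fps_nth (Abs_fps ue ^ 1) i * 1 \<in> weyl_left_ideal n"
  proof (rule sl2.fps_power_nth_mem[where m = n])
    show "uf 1 * 1 \<in> weyl_left_ideal n" "ue 0 ^ Suc n * 1 \<in> weyl_left_ideal n"
      "uh (Suc j) * 1 \<in> weyl_left_ideal n" for j
      using weyl_relators_mem[where n = n] by simp_all
  qed (use assms in \<open>auto intro: weyl_left_ideal_mult left_ideal_subspace left_ideal_weyl\<close>)
  then have "ue i \<in> weyl_left_ideal n" by simp
  then have "um 0 * ue i - ue i * um 0 \<in> weyl_left_ideal n"
    by (intro ev.subspace_diff[OF left_ideal_subspace[OF left_ideal_weyl]] weyl_left_ideal_mult weyl_relators_mem)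
  then show ?thesis by (simp add: um_ue)
qed

text \<open>\<open>weyl_index\<close> in halved degrees. The bound a <= n - k - s is written as a
  sum because subtraction of naturals would truncate.\<close>

definition weyl_box :: "nat \<Rightarrow> (nat list \<times> nat list) set"
  where "weyl_box n = {(as, bs). sorted_wrt (<) bs \<and> (\<forall>b\<in>set bs. b < n)
    \<and> sorted as \<and> (\<forall>a\<in>set as. a + length as + length bs \<le> n)}"

lemma weyl_box_span:
  "ev.span (weyl_left_ideal n \<union> {uel as * upl bs |as bs. (as, bs) \<in> weyl_box n}) = UNIV"
proof -
  define T where "T = ev.span (weyl_left_ideal n \<union> {uel as * upl bs |as bs. (as, bs) \<in> weyl_box n})"
  have T: "ev.subspace T" by (simp add: T_def)
  have ideal_T: "x \<in> T" if "x \<in> weyl_left_ideal n" for x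
    using that by (auto simp: T_def intro: ev.span_base)
  have filt_T: "x \<in> T" if "x \<in> filt n P" "\<And>as bs. P bs \<Longrightarrow> uel as * upl bs \<in> T" for x P
  proof -
    have "filt n P \<subseteq> T"
      unfolding filt_def using ideal_T that(2) by (intro ev.span_minimal T) auto
    with that(1) show ?thesis by blast
  qed
  have uel_filt: "uel as * x \<in> filt n P" if "x \<in> filt n P" for as x P
    using that ev.prod_list_mult_mem[of "filt n P" ue x as] filt_ue by blast
  have "uel as * upl bs \<in> T" if "length bs = k" for k as bs
    using that
  proof (induction k arbitrary: as bs rule: less_induct)
    case (less k)
    have short: "x \<in> T" if "x \<in> filt n (\<lambda>ds. length ds < k)" for x
      using that less.IH by (rule filt_T) auto
    \<comment> \<open>For fixed k the induction raises the sum of the odd indices. It is bounded: an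
      index of at least n puts the product into J, and otherwise the sum is at most k * n.\<close>
    show ?case using less.prems
    proof (induction "k * n - sum_list bs" arbitrary: as bs rule: less_induct)
      case less': less
      define cs where "cs = sort bs"
      have len: "length cs = k" and sum: "sum_list cs = sum_list bs"
        using less'.prems sum_mset_sum_list[of cs] sum_mset_sum_list[of bs]
        by (simp_all add: cs_def del: sum_mset_sum_list)
      obtain \<epsilon> where \<epsilon>: "upl bs - env_scale \<epsilon> (upl cs) \<in> filt n (\<lambda>ds. length ds < k)"
        using upl_equiv_sort[of n bs] less'.prems by (auto simp: upl_equiv_def cs_def)
      have "uel as * upl cs \<in> T"
      proof (cases "\<exists>b\<in>set cs. n \<le> b")
        case True
        then have "cs \<noteq> []" by auto
        have "\<forall>b\<in>set cs. b \<le> last cs"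
          using sorted_sort[of bs] \<open>cs \<noteq> []\<close> unfolding cs_def[symmetric]
          by (metis append_butlast_last_id in_set_conv_decomp_first sorted_append
              list.set_intros(1) Un_iff set_append order_refl set_ConsD empty_iff list.set(1))
        \<comment> \<open>In the sorted list the largest index comes last, next to the generator,
          where it is killed.\<close>
        with True have "up (last cs) \<in> weyl_left_ideal n" by (auto intro!: up_mem)
        then have "uel as * (upl (butlast cs) * up (last cs)) \<in> weyl_left_ideal n"
          by (intro weyl_left_ideal_mult)
        also have "upl (butlast cs) * up (last cs) = upl (butlast cs @ [last cs])" by simp
        also have "butlast cs @ [last cs] = cs" using \<open>cs \<noteq> []\<close> by simp
        finally show ?thesis by (rule ideal_T)
      next
        case small: False
        show ?thesis
        proof (cases "sorted_wrt (<) cs")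
          case False
          moreover have "sorted cs" by (simp add: cs_def)
          ultimately have "\<not> distinct cs" by (simp add: strict_sorted_iff)
          then obtain xs i ys where cs: "cs = xs @ i # i # ys"
            using \<open>sorted cs\<close> sorted_not_distinct_adjacent by blast
          have "upl cs \<in> filt n (\<lambda>ds. length ds < k)"
            using upl_repeat_mem[of xs i ys n] len unfolding cs by simp
          then show ?thesis by (intro short uel_filt)
        next
          case strict: True
          have "set cs \<subseteq> {..<n}" using small by auto
          moreover have "distinct cs" using strict by (simp add: strict_sorted_iff)
          ultimately have "k \<le> n" using card_mono[of "{..<n}" "set cs"] len by (simp add: distinct_card)
          \<comment> \<open>The pieces strictly below \<open>cs\<close> in the filtration. Modulo
            them \<open>upl cs\<close> is a lowest weight vector of weight k - n for the even
            part.\<close>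
          define P where "P = (\<lambda>ds :: nat list. length ds < k \<or> length ds = k \<and> sum_list cs < sum_list ds)"
          have P: "up_closed P" by (auto simp: up_closed_def P_def)
          have "x \<in> T" if "x \<in> filt n P" for x
            using that
          proof (rule filt_T)
            fix as ds assume "P ds"
            then consider "length ds < k" | "length ds = k" "sum_list cs < sum_list ds"
              by (auto simp: P_def)
            then show "uel as * upl ds \<in> T"
            proof cases
              case 2
              then have "0 < k" by (cases ds) auto
              \<comment> \<open>Strictness guarantees that the truncated difference k * n - sum
                really drops when the sum grows.\<close>
              have "sum_list cs < k * n"
              proof -
                have "sum_list ds' \<le> length ds' * (n - 1)" if "\<forall>b\<in>set ds'. b < n" for ds'
                  using that by (induction ds') auto
                from this[of cs] have "sum_list cs \<le> k * (n - 1)" using small len by (auto simp: not_le)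
                also have "\<dots> < k * n" using \<open>0 < k\<close> \<open>k \<le> n\<close> by simp
                finally show ?thesis .
              qed
              with 2 have "k * n - sum_list ds < k * n - sum_list bs" using sum by simp
              then show ?thesis using 2(1) by (rule less'.hyps)
            qed (rule less.IH, auto)
          qed
          then have filt_P: "filt n P \<subseteq> T" by blast
          have "uel as * upl cs \<in> ev.span (filt n P \<union>
            {uel as' * upl cs |as'. \<forall>a\<in>set as'. a + length as' \<le> n - k})"
          proof (rule sl2.prod_list_mem_weyl_box_span)
            show "uf i * upl cs \<in> filt n P" for i
              using uf_upl_mem by (rule filt_mono) (auto simp: P_def len)
            show "uh (Suc i) * upl cs \<in> filt n P" for i
              using uh_Suc_upl_mem by (rule filt_mono) (auto simp: P_def len)
            show "uh 0 * upl cs + of_nat (n - k) * upl cs \<in> filt n P"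
              using uh0_upl_mem[of cs n] \<open>k \<le> n\<close> by (intro filt_ideal) (simp add: len)
            \<comment> \<open>The relator e_0^(n+1) commutes past the odd factors to the generator.
              Its exponent is too large for weight k - n; the box lemma sharpens it.\<close>
            show "ue 0 ^ Suc n * upl cs \<in> filt n P"
              unfolding uel_e_power by (intro filt_ideal weyl_left_ideal_mult weyl_relators_mem)
          qed (auto intro: subspace_filt filt_ue filt_uf[OF P])
          also have "\<dots> \<subseteq> T"
          proof (intro ev.span_minimal T Un_least filt_P subsetI)
            fix x assume "x \<in> {uel as' * upl cs |as'. \<forall>a\<in>set as'. a + length as' \<le> n - k}"
            then obtain as' where x: "x = uel as' * upl cs"
              and as': "\<forall>a\<in>set as'. a + length as' \<le> n - k" by blast
            have "uel as' = uel (sort as')"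
              using ue_ue by (intro prod_list_map_mset_cong) simp_all
            moreover have "(sort as', cs) \<in> weyl_box n"
              using as' strict small \<open>k \<le> n\<close> len by (fastforce simp: weyl_box_def)
            ultimately show "x \<in> T"
              unfolding x T_def by (auto intro: ev.span_base)
          qed
          finally show ?thesis .
        qed
      qed
      moreover have "uel as * (upl bs - env_scale \<epsilon> (upl cs)) \<in> T"
        using \<epsilon> by (intro short uel_filt)
      ultimately have "uel as * (upl bs - env_scale \<epsilon> (upl cs)) + env_scale \<epsilon> (uel as * upl cs) \<in> T"
        by (intro ev.subspace_add[OF T] ev.subspace_scale[OF T])
      then show ?case by (simp add: right_diff_distrib ev.mult_scale_right)
    qed
  qed
  then have "filt n (\<lambda>_. True) \<subseteq> T" using filt_T by blast
  then show ?thesis by (auto simp: filt_True T_def)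
qed

section \<open>Counting\<close>

definition staircase :: "nat \<Rightarrow> nat list set"
  where "staircase m = {as. sorted as \<and> (\<forall>a\<in>set as. a + length as \<le> m)}"

text \<open>A list either starts with 0, which is dropped, or has positive entries, which are all
  lowered by 1. In both cases m drops by one, so the count at most doubles.\<close>

lemma staircase_card: "finite (staircase m) \<and> card (staircase m) \<le> 2 ^ m"
proof (induction m)
  case 0
  have "staircase 0 \<subseteq> {[]}"
  proof
    fix as assume "as \<in> staircase 0"
    then show "as \<in> {[]}" by (cases as) (auto simp: staircase_def)
  qed
  then show ?case
    by (metis card.insert_remove card_mono empty_iff finite.simps finite_subset is_singletonI
        is_singleton_altdef power_0)
next
  case (Suc m)
  have "staircase (Suc m) \<subseteq> (#) 0 ` staircase m \<union> map Suc ` staircase m"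
  proof
    fix as assume as: "as \<in> staircase (Suc m)"
    show "as \<in> (#) 0 ` staircase m \<union> map Suc ` staircase m"
    proof (cases "\<exists>as'. as = 0 # as'")
      case True
      with as show ?thesis by (auto simp: staircase_def)
    next
      case False
      with as have pos: "\<forall>a\<in>set as. a \<noteq> 0" by (cases as) (auto simp: staircase_def)
      define as' where "as' = map (\<lambda>a. a - 1) as"
      have "as = map Suc as'"
        unfolding as'_def map_map using pos by (intro map_idI[symmetric]) auto
      moreover from this as have "as' \<in> staircase m"
        by (auto simp: staircase_def sorted_map sorted_wrt_map)
      ultimately show ?thesis by blast
    qed
  qed
  moreover have "card ((#) 0 ` staircase m \<union> map Suc ` staircase m) \<le> 2 ^ Suc m"
    using card_Un_le[of "(#) 0 ` staircase m" "map Suc ` staircase m"] Suc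
      card_image_le[of "staircase m" "(#) 0"] card_image_le[of "staircase m" "map Suc"] by simp
  ultimately show ?case
    using Suc by (meson card_mono finite_Un finite_imageI finite_subset le_trans)
qed

text \<open>The odd indices form a subset B of n elements and leave a staircase of size n - |B|. The
  sum of 2^(n - |B|) is the expansion of (1 + 2)^n, with 1 for elements of B and 2 for the
  others.\<close>

lemma weyl_box_card: "finite (weyl_box n) \<and> card (weyl_box n) \<le> 3 ^ n"
proof -
  let ?\<Sigma> = "SIGMA B:Pow {..<n}. staircase (n - card B)"
  have inj: "inj_on (\<lambda>(as, bs). (set bs, as)) (weyl_box n)"
    by (auto simp: inj_on_def weyl_box_def intro: strict_sorted_equal)
  have sub: "(\<lambda>(as, bs). (set bs, as)) ` weyl_box n \<subseteq> ?\<Sigma>"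
    by (auto simp: weyl_box_def staircase_def strict_sorted_iff distinct_card)
  have fin: "finite ?\<Sigma>"
    using staircase_card by auto
  have "card ?\<Sigma> = (\<Sum>B\<in>Pow {..<n}. card (staircase (n - card B)))"
    using staircase_card by simp
  also have "\<dots> \<le> (\<Sum>B\<in>Pow {..<n}. 2 ^ (n - card B))"
    using staircase_card by (intro sum_mono) auto
  also have "\<dots> = (\<Sum>B\<in>Pow {..<n}. (\<Prod>i\<in>B. 1) * (\<Prod>i\<in>{..<n} - B. 2))"
    by (intro sum.cong) (auto simp: card_Diff_subset finite_subset)
  also have "\<dots> = (\<Prod>i<n. 1 + 2)"
    by (rule prod_add[symmetric]) simp
  also have "\<dots> = 3 ^ n" by (simp add: numeral_3_eq_3)
  finally have "card ?\<Sigma> \<le> 3 ^ n" .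
  then show ?thesis
    using card_image[OF inj] card_mono[OF fin sub] finite_imageD[OF finite_subset[OF sub fin] inj] by simp
qed

text \<open>A nontrivial relation would make one member redundant, and fewer than |B| vectors would
  span the independent set \<open>B\<close>. Working with a family covers coincident members as
  well.\<close>

lemma (in vector_space) spanning_family_independent:
  assumes "finite I" "independent B" "card I \<le> card B" "B \<subseteq> span (f ` I)"
    and "S \<subseteq> I" "(\<Sum>i\<in>S. scale (c i) (f i)) = 0" "j \<in> S"
  shows "c j = 0"
proof (rule ccontr)
  assume c: "c j \<noteq> 0"
  let ?T = "f ` (I - {j})"
  have "finite S" using assms(1,5) finite_subset by blast
  then have "(\<Sum>i\<in>S. scale (c i) (f i)) = scale (c j) (f j) + (\<Sum>i\<in>S - {j}. scale (c i) (f i))"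
    using assms(7) by (rule sum.remove)
  then have "scale (c j) (f j) = - (\<Sum>i\<in>S - {j}. scale (c i) (f i))"
    using assms(6) by (simp add: eq_neg_iff_add_eq_0)
  also have "\<dots> \<in> span ?T"
    using assms(5) by (intro span_neg span_sum span_scale span_base) auto
  finally have "scale (1 / c j) (scale (c j) (f j)) \<in> span ?T" by (rule span_scale)
  then have "f j \<in> span ?T" using c by simp
  then have "f ` I \<subseteq> span ?T" by (auto intro: span_base)
  then have "B \<subseteq> span ?T" using assms(4) span_minimal[OF _ subspace_span] by blast
  then have "card B \<le> card ?T" using independent_span_bound[of ?T B] assms(1,2) by auto
  also have "\<dots> \<le> card (I - {j})" using assms(1) by (intro card_image_le) auto
  also have "\<dots> < card I" using assms(1,5,7) by (intro psubset_card_mono) auto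
  finally show False using assms(3) by simp
qed

section \<open>Weights in the tensor power\<close>

text \<open>The h-weight shifted by 1. Weights of words of length n then fill 0 to 2n, and the
  parity of a word is that of its weight.\<close>

fun vbas_weight :: "vbas \<Rightarrow> int" where
  "vbas_weight VM = 0"
| "vbas_weight V0 = 1"
| "vbas_weight VP = 2"

fun osp_weight :: "osp \<Rightarrow> int" where
  "osp_weight OE = 2"
| "osp_weight OGp = 1"
| "osp_weight OH = 0"
| "osp_weight OGm = -1"
| "osp_weight OF = -2"

definition word_weight :: "vbas list \<Rightarrow> int"
  where "word_weight w = sum_list (map vbas_weight w)"

lemma word_weight_simps [simp]:
  "word_weight [] = 0" "word_weight (b # w) = vbas_weight b + word_weight w"
  by (simp_all add: word_weight_def)

lemma word_weight_bounds: "0 \<le> word_weight w \<and> word_weight w \<le> 2 * int (length w)"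
proof (induction w)
  case (Cons b w)
  then show ?case by (cases b) auto
qed simp

lemma odd_word_weight: "odd (word_weight w) \<longleftrightarrow> odd (length (filter vbas_odd w))"
proof (induction w)
  case (Cons b w)
  then show ?case by (cases b) auto
qed simp

lemma odd_osp_weight: "odd (osp_weight y) \<longleftrightarrow> osp_odd y"
  by (cases y) auto

definition supp_on :: "'a set \<Rightarrow> ('a \<Rightarrow>\<^sub>0 complex) set"
  where "supp_on A = {x. Poly_Mapping.keys x \<subseteq> A}"

lemma subspace_supp_on: "cvec.subspace (supp_on A)"
proof -
  have "supp_on A = {x. \<forall>a. a \<notin> A \<longrightarrow> Poly_Mapping.lookup x a = 0}"
    by (auto simp: supp_on_def in_keys_iff)
  then show ?thesis by (simp add: cvec.subspace_def lookup_add)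
qed

lemma single_supp_on: "a \<in> A \<Longrightarrow> Poly_Mapping.single a c \<in> supp_on A"
  by (simp add: supp_on_def)

lemma supp_on_mono: "x \<in> supp_on A \<Longrightarrow> A \<subseteq> B \<Longrightarrow> x \<in> supp_on B"
  by (auto simp: supp_on_def)

lemma lin_ext_supp_on:
  assumes "x \<in> supp_on A" "\<And>a. a \<in> A \<Longrightarrow> f a \<in> supp_on B"
  shows "lin_ext f x \<in> supp_on B"
  using assms by (intro lin_ext_mem_subspace subspace_supp_on) (auto simp: supp_on_def)

lemma word_act_supp_on:
  "word_act \<zeta> y d w \<in> supp_on {u. length u = length w \<and> word_weight u = word_weight w + osp_weight y}"
proof (induction w arbitrary: \<zeta>)
  case Nil
  then show ?case by (simp add: cvec.subspace_0 subspace_supp_on)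
next
  case (Cons b w)
  let ?A = "{u. length u = length (b # w) \<and> word_weight u = word_weight (b # w) + osp_weight y}"
  have "vact y b \<in> supp_on {c. vbas_weight c = vbas_weight b + osp_weight y}"
    by (cases y; cases b) (simp_all add: supp_on_def)
  then have "lin_ext (\<lambda>c. Poly_Mapping.single (c # w) 1) (vact y b) \<in> supp_on ?A"
    by (rule lin_ext_supp_on) (simp add: single_supp_on)
  moreover have "tcons b (word_act (\<zeta> \<circ> Suc) y d w) \<in> supp_on ?A"
    unfolding tcons_def using Cons by (rule lin_ext_supp_on) (simp add: single_supp_on)
  ultimately show ?case
    by (simp add: cvec.subspace_add cvec.subspace_scale subspace_supp_on)
qed

lemma tensor_act_supp_on:
  assumes "x \<in> supp_on A"
    and "\<And>w u. w \<in> A \<Longrightarrow> length u = length w \<Longrightarrow> word_weight u = word_weight w + osp_weight (tosp a) \<Longrightarrow> u \<in> B"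
  shows "tensor_act zs a x \<in> supp_on B"
  unfolding tensor_act_def using assms(1)
proof (rule lin_ext_supp_on)
  fix w assume "w \<in> A"
  then show "tensor_act_basis zs a w \<in> supp_on B"
    unfolding tensor_act_basis_eq
    by (intro supp_on_mono[OF word_act_supp_on]) (use assms(2) in blast)
qed

abbreviation words :: "nat \<Rightarrow> vbas list set"
  where "words n \<equiv> {w. length w = n}"

lemma tensor_gen_supp_on: "tensor_gen zs \<in> supp_on {w. length w = length zs \<and> even (word_weight w)}"
proof -
  have "word_weight (replicate k VM) = 0" for k by (induction k) auto
  then show ?thesis by (simp add: tensor_gen_def single_supp_on)
qed

lemma tensor_word_parity:
  "tensor_word zs ws (tensor_gen zs)
    \<in> supp_on {w. length w = length zs \<and> (odd (word_weight w) \<longleftrightarrow> odd (word_deg ws))}"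
proof (induction ws)
  case Nil
  then show ?case using tensor_gen_supp_on by simp
next
  case (Cons a ws)
  show ?case
    unfolding tensor_word_simps
    using Cons by (rule tensor_act_supp_on) (auto simp: odd_osp_weight tcur_parity)
qed

text \<open>Each e_0 raises the weight by 2, and n + 1 of them leave the range from 0 to 2n.\<close>

lemma tensor_act_raise_nilpotent:
  assumes "x \<in> supp_on (words n)"
  shows "(tensor_act zs (tw OE 0) ^^ Suc n) x = 0"
proof -
  have "(tensor_act zs (tw OE 0) ^^ k) x \<in> supp_on {w. length w = n \<and> 2 * int k \<le> word_weight w}" for k
  proof (induction k)
    case 0
    then show ?case using assms word_weight_bounds by (auto simp: supp_on_def)
  next
    case (Suc k)
    show ?case unfolding funpow.simps comp_def
      using Suc by (rule tensor_act_supp_on) (auto simp: tosp_tw)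
  qed
  from this[of "Suc n"] have "(tensor_act zs (tw OE 0) ^^ Suc n) x \<in> supp_on {}"
  proof (rule supp_on_mono, intro subsetI)
    fix w assume "w \<in> {w. length w = n \<and> 2 * int (Suc n) \<le> word_weight w}"
    then show "w \<in> {}" using word_weight_bounds[of w] by auto
  qed
  then show ?thesis by (simp add: supp_on_def)
qed

lemma tensor_act_lower_nilpotent:
  assumes "x \<in> supp_on (words n)"
  shows "(tensor_act zs (tw OF 0) ^^ Suc n) x = 0"
proof -
  have "(tensor_act zs (tw OF 0) ^^ k) x \<in> supp_on {w. length w = n \<and> word_weight w \<le> 2 * int n - 2 * int k}" for k
  proof (induction k)
    case 0
    then show ?case using assms word_weight_bounds by (auto simp: supp_on_def)
  next
    case (Suc k)
    show ?case unfolding funpow.simps comp_def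
      using Suc by (rule tensor_act_supp_on) (auto simp: tosp_tw)
  qed
  from this[of "Suc n"] have "(tensor_act zs (tw OF 0) ^^ Suc n) x \<in> supp_on {}"
  proof (rule supp_on_mono, intro subsetI)
    fix w assume "w \<in> {w. length w = n \<and> word_weight w \<le> 2 * int n - 2 * int (Suc n)}"
    then show "w \<in> {}" using word_weight_bounds[of w] by auto
  qed
  then show ?thesis by (simp add: supp_on_def)
qed

section \<open>Cyclicity of the tensor product\<close>

text \<open>Lagrange interpolation in the squares: p vanishes at (z_j)^2 for j \<noteq> i. Since
  only odd powers are allowed, p is multiplied by one further factor z, and the normalisation
  divides by z_i.\<close>

lemma interpolation:
  fixes z :: "nat \<Rightarrow> complex"
  assumes "\<And>j. j < n \<Longrightarrow> z j \<noteq> 0" "\<And>j k. j < n \<Longrightarrow> k < n \<Longrightarrow> j \<noteq> k \<Longrightarrow> (z j)\<^sup>2 \<noteq> (z k)\<^sup>2" "i < n"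
  obtains c :: "nat \<Rightarrow> complex" and m where
    "\<And>j. j < n \<Longrightarrow> (\<Sum>k\<le>m. c k * z j ^ (2 * k + 1)) = (if j = i then 1 else 0)"
proof -
  define p where "p = (\<Prod>k\<in>{..<n} - {i}. [:- ((z k)\<^sup>2), 1:])"
  have p: "poly p x = (\<Prod>k\<in>{..<n} - {i}. x - (z k)\<^sup>2)" for x
    by (simp add: p_def poly_prod)
  have nz: "poly p ((z i)\<^sup>2) \<noteq> 0"
    using assms(2,3) by (auto simp: p)
  have zero: "poly p ((z j)\<^sup>2) = 0" if "j < n" "j \<noteq> i" for j
    using that by (auto simp: p)
  define c where "c = (\<lambda>k. coeff p k / (z i * poly p ((z i)\<^sup>2)))"
  have "(\<Sum>k\<le>degree p. c k * z j ^ (2 * k + 1)) = (if j = i then 1 else 0)" if "j < n" for j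
  proof -
    have "(\<Sum>k\<le>degree p. c k * z j ^ (2 * k + 1))
      = z j * (\<Sum>k\<le>degree p. coeff p k * ((z j)\<^sup>2) ^ k) / (z i * poly p ((z i)\<^sup>2))"
      unfolding c_def by (simp add: sum_distrib_left sum_divide_distrib mult_ac flip: power_mult)
    also have "\<dots> = z j * poly p ((z j)\<^sup>2) / (z i * poly p ((z i)\<^sup>2))"
      by (simp add: poly_altdef)
    also have "\<dots> = (if j = i then 1 else 0)"
      using nz zero that assms(1,3) by auto
    finally show ?thesis .
  qed
  then show ?thesis by (rule that)
qed

definition admissible :: "complex list \<Rightarrow> bool"
  where "admissible zs \<longleftrightarrow> (\<forall>i<length zs. zs ! i \<noteq> 0) \<and>
    (\<forall>i<length zs. \<forall>j<length zs. i \<noteq> j \<longrightarrow> (zs ! i)\<^sup>2 \<noteq> (zs ! j)\<^sup>2)"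

text \<open>By interpolation the elements \<open>g\<^sup>+\<^sub>k\<close> generate the action of \<open>g\<^sup>+\<close> on each single factor, and
  these already carry the lowest vector to every word.\<close>

lemma tensor_gen_cyclic:
  assumes "admissible zs" "length w = length zs"
  shows "Poly_Mapping.single w 1 \<in> cvec.span {tensor_word zs ws (tensor_gen zs) |ws. True}"
  using assms(2)
proof (induction "nat (word_weight w)" arbitrary: w rule: less_induct)
  case less
  let ?Z = "cvec.span {tensor_word zs ws (tensor_gen zs) |ws. True}"
  have closed: "tensor_act zs a x \<in> ?Z" if "x \<in> ?Z" for a x
    unfolding tensor_act_def using that
  proof (rule lin_ext_span_mem)
    fix y assume "y \<in> {tensor_word zs ws (tensor_gen zs) |ws. True}"
    then obtain ws where "y = tensor_word zs ws (tensor_gen zs)" by blast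
    then have "lin_ext (tensor_act_basis zs a) y = tensor_word zs (a # ws) (tensor_gen zs)"
      by (simp add: tensor_act_def)
    then show "lin_ext (tensor_act_basis zs a) y \<in> ?Z" by (blast intro: cvec.span_base)
  qed simp
  show ?case
  proof (cases "\<exists>i<length w. w ! i \<noteq> VM")
    case False
    then have "w = replicate (length zs) VM"
      using less.prems by (intro nth_equalityI) auto
    then have "Poly_Mapping.single w 1 = tensor_word zs [] (tensor_gen zs)"
      by (simp add: tensor_gen_def)
    then show ?thesis by (blast intro: cvec.span_base)
  next
    case True
    then obtain i where i: "i < length w" "w ! i \<noteq> VM" by blast
    \<comment> \<open>g^+ sends \<open>b\<close> to \<open>w ! i\<close>, so \<open>u\<close> has
      weight one less than \<open>w\<close> and falls under the induction.\<close>
    define b where "b = (if w ! i = VP then V0 else VM)"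
    define u where "u = w[i := b]"
    have b: "vact OGp b = Poly_Mapping.single (w ! i) 1" "vbas_weight (w ! i) = vbas_weight b + 1"
      using i(2) by (cases "w ! i"; simp add: b_def)+
    have "word_weight w = word_weight u + 1"
    proof -
      have "word_weight (xs[i := b]) = word_weight xs - vbas_weight (xs ! i) + vbas_weight b"
        if "i < length xs" for xs
        using that by (induction xs arbitrary: i) (auto simp: nth_Cons split: nat.split)
      then show ?thesis using i(1) b(2) by (simp add: u_def)
    qed
    then have "nat (word_weight u) < nat (word_weight w)"
      using word_weight_bounds[of u] by simp
    moreover have len: "length u = length zs" using less.prems by (simp add: u_def)
    ultimately have u_mem: "Poly_Mapping.single u 1 \<in> ?Z" by (rule less.hyps)
    have "i < length zs" using i(1) less.prems by simp
    then obtain c m where c: "\<And>j. j < length zs \<Longrightarrow>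
        (\<Sum>k\<le>m. c k * zs ! j ^ (2 * k + 1)) = (if j = i then 1 else 0)"
      using interpolation[of "length zs" "\<lambda>j. zs ! j" i] assms(1) unfolding admissible_def by blast
    \<comment> \<open>The sign of moving g^+ past the first j factors of \<open>u\<close>. It does
      not depend on k, so interpolation in the powers of z_j isolates the term j = i; the remaining
      sign squares to 1.\<close>
    define \<sigma> where "\<sigma> = (\<lambda>j. ssign True (odd (length (filter vbas_odd (take j u)))))"
    define g where "g = (\<lambda>j. lin_ext (\<lambda>b. Poly_Mapping.single (u[j := b]) 1) (vact OGp (u ! j)))"
    have "(\<Sum>k\<le>m. cscale (c k) (tensor_act zs (tw OGp (2 * k + 1)) (Poly_Mapping.single u 1)))
      = (\<Sum>k\<le>m. \<Sum>j<length zs. cscale (\<sigma> j * (c k * zs ! j ^ (2 * k + 1))) (g j))"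
      using len by (simp add: tensor_act_def tensor_act_basis_eq word_act_eq_sum tosp_tw tdeg_tw
          cvec.scale_sum_right \<sigma>_def g_def mult_ac)
    also have "\<dots> = (\<Sum>j<length zs. \<Sum>k\<le>m. cscale (\<sigma> j * (c k * zs ! j ^ (2 * k + 1))) (g j))"
      by (rule sum.swap)
    also have "\<dots> = (\<Sum>j<length zs. cscale (\<sigma> j * (\<Sum>k\<le>m. c k * zs ! j ^ (2 * k + 1))) (g j))"
      by (simp add: cvec.scale_sum_left sum_distrib_left)
    also have "\<dots> = (\<Sum>j<length zs. if j = i then cscale (\<sigma> i) (g i) else 0)"
    proof (rule sum.cong[OF refl])
      fix j assume "j \<in> {..<length zs}"
      then have "(\<Sum>k\<le>m. c k * zs ! j ^ (2 * k + 1)) = (if j = i then 1 else 0)" by (intro c) simp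
      then show "cscale (\<sigma> j * (\<Sum>k\<le>m. c k * zs ! j ^ (2 * k + 1))) (g j)
          = (if j = i then cscale (\<sigma> i) (g i) else 0)"
        by (simp only:) simp
    qed
    also have "\<dots> = cscale (\<sigma> i) (g i)" using \<open>i < length zs\<close> by simp
    also have "g i = Poly_Mapping.single w 1"
      using i(1) b(1) by (simp add: g_def u_def)
    finally have "cscale (\<sigma> i) (Poly_Mapping.single w 1) \<in> ?Z"
      by (rule subst) (intro cvec.span_sum cvec.span_scale closed u_mem)
    then have "cscale (\<sigma> i) (cscale (\<sigma> i) (Poly_Mapping.single w 1)) \<in> ?Z"
      by (rule cvec.span_scale)
    moreover have "\<sigma> i * \<sigma> i = 1" by (simp add: \<sigma>_def ssign_def)
    ultimately show ?thesis by simp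
  qed
qed

section \<open>The defining ideal of the graded tensor product\<close>

lemma tensor_filt_eq:
  "tensor_filt zs s = cvec.span {tensor_word zs ws (tensor_gen zs) |ws. word_deg ws \<le> s}"
  by (simp add: tensor_filt_def tensor_word_def)

text \<open>This is F_{s-1}. The strict inequality makes it the zero space at s = 0, so no case
  distinction is needed.\<close>

definition lower :: "complex list \<Rightarrow> nat \<Rightarrow> (vbas list \<Rightarrow>\<^sub>0 complex) set"
  where "lower zs s = cvec.span {tensor_word zs ws (tensor_gen zs) |ws. word_deg ws < s}"

lemma filt_prev_tensor: "filt_prev (tensor_module zs) (tensor_filt zs) = lower zs"
proof
  fix s
  show "filt_prev (tensor_module zs) (tensor_filt zs) s = lower zs s"
    by (cases s) (simp_all add: filt_prev_def lower_def tensor_filt_eq less_Suc_eq_le,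
      simp add: tensor_module_def)
qed

lemma subspace_lower: "cvec.subspace (lower zs s)"
  by (simp add: lower_def)

lemma tensor_word_lower: "word_deg ws < s \<Longrightarrow> tensor_word zs ws (tensor_gen zs) \<in> lower zs s"
  by (auto simp: lower_def intro!: cvec.span_base)

lemma lower_subset_tensor_filt: "lower zs s \<subseteq> tensor_filt zs s"
  unfolding lower_def tensor_filt_eq by (intro cvec.span_mono) auto

lemma tensor_act_lower:
  assumes "x \<in> lower zs s"
  shows "tensor_act zs a x \<in> lower zs (s + tdeg a)"
  using assms unfolding lower_def tensor_act_def
proof (rule lin_ext_span_mem)
  fix y assume "y \<in> {tensor_word zs ws (tensor_gen zs) |ws. word_deg ws < s}"
  then obtain ws where ws: "y = tensor_word zs ws (tensor_gen zs)" "word_deg ws < s" by blast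
  then have "lin_ext (tensor_act_basis zs a) y = tensor_word zs (a # ws) (tensor_gen zs)"
    "word_deg (a # ws) < s + tdeg a"
    by (simp_all add: tensor_act_def)
  then show "lin_ext (tensor_act_basis zs a) y
    \<in> cvec.span {tensor_word zs ws (tensor_gen zs) |ws. word_deg ws < s + tdeg a}"
    by (blast intro: cvec.span_base)
qed simp

lemma env_comp_scale: "env_comp zs s (env_scale c u) = cscale c (env_comp zs s u)"
  by (simp add: env_scale_def env_comp_const_mult)

lemma env_comp_sum: "env_comp zs s (sum g S) = (\<Sum>i\<in>S. env_comp zs s (g i))"
  by (induction S rule: infinite_finite_induct) (auto simp: env_comp_add)

lemma env_induct [case_names zero add]:
  assumes "P 0" "\<And>c ws u. P u \<Longrightarrow> P (env_scale c (prod_list (map env_gen ws)) + u)"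
  shows "P u"
proof -
  have "u \<in> ev.span {prod_list (map env_gen ws) |ws. True}" unfolding env_span_words by simp
  then show ?thesis
    by (induction rule: ev.span_induct_alt) (use assms in auto)
qed

lemma env_comp_mem_tensor_filt: "env_comp zs s u \<in> tensor_filt zs s"
  unfolding tensor_filt_eq
proof (induction u rule: env_induct)
  case (add c ws u)
  have "env_comp zs s (prod_list (map env_gen ws))
    \<in> cvec.span {tensor_word zs ws (tensor_gen zs) |ws. word_deg ws \<le> s}"
    by (auto simp: env_comp_word cvec.span_zero intro!: cvec.span_base)
  with add show ?case
    by (simp add: env_comp_add env_comp_scale cvec.span_add cvec.span_scale)
qed (simp add: cvec.span_zero)

text \<open>The annihilator of the generator of the graded tensor product: each homogeneous part u_s
  must carry the generator into F_{s-1}.\<close>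

definition graded_ker :: "complex list \<Rightarrow> env set"
  where "graded_ker zs = {u. \<forall>s. env_comp zs s u \<in> lower zs s}"

lemma left_ideal_graded_ker: "left_ideal (graded_ker zs)"
proof -
  have add: "x + y \<in> graded_ker zs" if "x \<in> graded_ker zs" "y \<in> graded_ker zs" for x y
    using that by (simp add: graded_ker_def env_comp_add cvec.subspace_add subspace_lower)
  have scale: "env_scale c x \<in> graded_ker zs" if "x \<in> graded_ker zs" for c x
    using that by (simp add: graded_ker_def env_comp_scale cvec.subspace_scale subspace_lower)
  have zero: "0 \<in> graded_ker zs"
    by (simp add: graded_ker_def cvec.subspace_0 subspace_lower)
  have gen: "env_gen a * x \<in> graded_ker zs" if "x \<in> graded_ker zs" for a x
  proof -
    have "env_comp zs s (env_gen a * x) \<in> lower zs s" for s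
    proof (cases "tdeg a \<le> s")
      case True
      have "env_comp zs (s - tdeg a) x \<in> lower zs (s - tdeg a)"
        using that by (simp add: graded_ker_def)
      from tensor_act_lower[OF this, of a] True show ?thesis by (simp add: env_comp_gen_mult)
    qed (simp add: env_comp_gen_mult cvec.subspace_0 subspace_lower)
    then show ?thesis by (simp add: graded_ker_def)
  qed
  have word: "prod_list (map env_gen ws) * x \<in> graded_ker zs" if "x \<in> graded_ker zs" for ws x
    using that by (induction ws) (auto simp: mult.assoc gen)
  have "u * x \<in> graded_ker zs" if "x \<in> graded_ker zs" for u x
    by (induction u rule: env_induct)
      (auto simp: zero distrib_right ev.scale_mult_left intro!: add scale word that)
  with zero add show ?thesis by (simp add: left_ideal_def)
qed

lemma env_comp_gen:
  "env_comp zs s (env_gen a) = (if s = tdeg a then tensor_act zs a (tensor_gen zs) else 0)"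
  using env_comp_gen_mult[of zs s a 1] by (auto simp: env_comp_one)

lemma env_comp_power_mult:
  assumes "tdeg a = 0"
  shows "env_comp zs s (env_gen a ^ k * u) = (tensor_act zs a ^^ k) (env_comp zs s u)"
  by (induction k) (simp_all add: env_comp_gen_mult assms mult.assoc)

lemma env_comp_supp_on: "env_comp zs s u \<in> supp_on (words (length zs))"
proof (induction u rule: env_induct)
  case (add c ws u)
  have "tensor_word zs ws (tensor_gen zs) \<in> supp_on (words (length zs))"
    using tensor_word_parity by (rule supp_on_mono) auto
  with add show ?case
    by (auto simp: env_comp_add env_comp_scale env_comp_word
        intro!: cvec.subspace_add cvec.subspace_scale subspace_supp_on)
qed (simp add: cvec.subspace_0 subspace_supp_on)

text \<open>f and g^- kill each lowest weight vector, and n factors of weight -1 give h_0. The power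
  sum by which h_{2i+2} acts returns a multiple of the generator, which lies in F_0 and so in
  F_{2i+1}.\<close>

lemma weyl_relators_graded_ker:
  assumes "length zs = n"
  shows "weyl_relators n \<subseteq> graded_ker zs"
proof -
  have zero: "word_act \<zeta> y d (replicate k VM) = 0" if "vact y VM = 0" for \<zeta> y d k
    using that by (induction k arbitrary: \<zeta>) (simp_all add: tcons_def)
  have weight: "word_act \<zeta> OH d (replicate k VM)
    = cscale (- (\<Sum>i<k. \<zeta> i ^ d)) (Poly_Mapping.single (replicate k VM) 1)" for \<zeta> d k
  proof (induction k arbitrary: \<zeta>)
    case (Suc k)
    show ?case
      by (simp add: Suc tcons_def sum.lessThan_Suc_shift ssign_def del: sum.lessThan_Suc
          flip: single_add)
  qed simp
  have act: "tensor_act zs a (tensor_gen zs) = word_act ((!) zs) (tosp a) (tdeg a) (replicate n VM)" for a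
    using assms by (simp add: tensor_act_def tensor_gen_def tensor_act_basis_eq)
  have gen_mem: "tensor_gen zs \<in> lower zs s" if "0 < s" for s
    using that tensor_word_lower[of "[]" s zs] by simp
  have lower0: "0 \<in> lower zs s" for s by (simp add: cvec.subspace_0 subspace_lower)
  have gen: "tensor_gen zs = Poly_Mapping.single (replicate n VM) 1"
    using assms by (simp add: tensor_gen_def)
  have "env_gen (tw OF (2 * i)) \<in> graded_ker zs" "env_gen (tw OGm (2 * i + 1)) \<in> graded_ker zs" for i
    by (auto simp: graded_ker_def env_comp_gen act tosp_tw tdeg_tw zero lower0)
  moreover have "env_gen (tw OH (2 * i + 2)) \<in> graded_ker zs" for i
    using gen_mem[of "2 * i + 2"]
    by (auto simp: graded_ker_def env_comp_gen act tosp_tw tdeg_tw weight lower0 simp flip: gen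
        intro!: cvec.subspace_neg[OF subspace_lower] cvec.subspace_scale[OF subspace_lower])
  moreover have "env_gen (tw OH 0) + env_const (of_nat n) \<in> graded_ker zs"
    using env_comp_const_mult[of zs _ "of_nat n" 1]
    by (auto simp: graded_ker_def env_comp_add env_comp_gen act tosp_tw tdeg_tw weight lower0
        env_comp_one simp flip: gen)
  moreover have "env_gen (tw OE 0) ^ (n + 1) \<in> graded_ker zs"
  proof -
    have "env_comp zs s (env_gen (tw OE 0) ^ Suc n * 1) = 0" for s
      unfolding env_comp_power_mult[OF tdeg_tw[of OE 0, simplified]]
      using env_comp_supp_on[of zs s 1] assms tensor_act_raise_nilpotent by metis
    then show ?thesis by (simp add: graded_ker_def lower0)
  qed
  ultimately show ?thesis by (auto simp: weyl_relators_def)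
qed

section \<open>Linear algebra for the comparison of dimensions\<close>

context vector_space
begin

lemma span_Un_image:
  assumes "subspace J" "finite I" "u \<in> span (J \<union> f ` I)"
  shows "\<exists>x\<in>J. \<exists>d. u = x + (\<Sum>i\<in>I. scale (d i) (f i))"
  using assms(3)
proof (induction rule: span_induct_alt)
  case base
  show ?case using assms(1) by (intro bexI[of _ 0] exI[of _ "\<lambda>_. 0"]) (auto simp: subspace_0)
next
  case (step c y z)
  then obtain x d where x: "x \<in> J" "z = x + (\<Sum>i\<in>I. scale (d i) (f i))" by blast
  from step(1) show ?case
  proof
    assume "y \<in> J"
    with x assms(1) show ?thesis
      by (intro bexI[of _ "scale c y + x"] exI[of _ d])
        (auto simp: add.assoc subspace_add subspace_scale)
  next
    assume "y \<in> f ` I"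
    then obtain j where j: "j \<in> I" "y = f j" by blast
    have "(\<Sum>i\<in>I. scale (if i = j then c + d i else d i) (f i))
      = (\<Sum>i\<in>I. scale (d i) (f i) + (if i = j then scale c (f j) else 0))"
      by (intro sum.cong refl) (simp add: scale_left_distrib add.commute)
    also have "\<dots> = scale c y + (\<Sum>i\<in>I. scale (d i) (f i))"
      using j assms(2) by (simp add: sum.distrib add.commute)
    finally show ?thesis using x
      by (intro bexI[of _ x] exI[of _ "\<lambda>i. if i = j then c + d i else d i"]) (simp_all add: algebra_simps)
  qed
qed

end

lemma inj_on_single: "inj_on (\<lambda>w. Poly_Mapping.single w (1 :: complex)) A"
proof (rule inj_onI)
  fix v w :: 'a
  assume "Poly_Mapping.single v (1 :: complex) = Poly_Mapping.single w 1"
  then have "Poly_Mapping.keys (Poly_Mapping.single v (1 :: complex)) = Poly_Mapping.keys (Poly_Mapping.single w (1 :: complex))"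
    by (rule arg_cong)
  then show "v = w" by simp
qed

lemma independent_singles: "cvec.independent ((\<lambda>w. Poly_Mapping.single w 1) ` A)" if "finite A"
proof (rule cvec.independent_if_scalars_zero)
  fix f and x :: "'a \<Rightarrow>\<^sub>0 complex"
  assume sum: "(\<Sum>x\<in>(\<lambda>w. Poly_Mapping.single w 1) ` A. cscale (f x) x) = 0"
    and "x \<in> (\<lambda>w. Poly_Mapping.single w 1) ` A"
  then obtain w where w: "w \<in> A" "x = Poly_Mapping.single w 1" by blast
  have "(\<Sum>x\<in>(\<lambda>w. Poly_Mapping.single w 1) ` A. cscale (f x) x)
    = (\<Sum>v\<in>A. Poly_Mapping.single v (f (Poly_Mapping.single v 1)))"
    by (simp add: sum.reindex[OF inj_on_single])
  with sum have "Poly_Mapping.lookup (\<Sum>v\<in>A. Poly_Mapping.single v (f (Poly_Mapping.single v 1))) w = 0"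
    by simp
  then show "f x = 0"
    using w that by (simp add: lookup_sum lookup_single when_def)
qed (use that in simp)

lemma words_card: "finite (words n)" "card (words n) = 3 ^ n"
proof -
  have U: "(UNIV :: vbas set) = {VM, V0, VP}" using vbas.exhaust by auto
  have fin: "finite (UNIV :: vbas set)" and card: "card (UNIV :: vbas set) = 3" by (simp_all add: U)
  show "finite (words n)" using finite_lists_length_eq[OF fin, of n] by simp
  show "card (words n) = 3 ^ n" using card_lists_length_eq[OF fin, of n] card by simp
qed

section \<open>Box monomials acting on the tensor generator\<close>

definition box_word :: "nat list \<times> nat list \<Rightarrow> tcur list"
  where "box_word = (\<lambda>(as, bs). map (\<lambda>a. tw OE (2 * a)) as @ map (\<lambda>b. tw OGp (2 * b + 1)) bs)"

definition box_mon :: "nat list \<times> nat list \<Rightarrow> env"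
  where "box_mon p = prod_list (map env_gen (box_word p))"

lemma box_mon_eq: "box_mon (as, bs) = uel as * upl bs"
  by (simp add: box_mon_def box_word_def comp_def ue_def[abs_def] up_def[abs_def])

lemma box_mon_span: "ev.span (weyl_left_ideal n \<union> box_mon ` weyl_box n) = UNIV"
proof -
  have "box_mon ` weyl_box n = {uel as * upl bs |as bs. (as, bs) \<in> weyl_box n}"
    by (force simp: box_mon_eq)
  then show ?thesis using weyl_box_span by simp
qed

lemma env_comp_box_mon:
  "env_comp zs s (box_mon p) =
    (if word_deg (box_word p) = s then tensor_word zs (box_word p) (tensor_gen zs) else 0)"
  by (simp add: box_mon_def env_comp_word)

lemma weyl_left_ideal_subset_graded_ker:
  assumes "length zs = n"
  shows "weyl_left_ideal n \<subseteq> graded_ker zs"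
  using weyl_relators_graded_ker[OF assms] left_ideal_graded_ker
  by (auto simp: weyl_left_ideal_def)

text \<open>Write a monomial of degree s as an element of J plus box monomials and take components
  of degree s. The part from J falls into F_{s-1}, covered by induction on the degree, and only box
  monomials of degree s remain.\<close>

lemma tensor_word_box_span:
  assumes "length zs = n"
  shows "tensor_word zs ws (tensor_gen zs) \<in> cvec.span
    ((\<lambda>p. tensor_word zs (box_word p) (tensor_gen zs)) ` {p \<in> weyl_box n. word_deg (box_word p) \<le> word_deg ws})"
proof (induction "word_deg ws" arbitrary: ws rule: less_induct)
  case less
  define s where "s = word_deg ws"
  let ?g = "\<lambda>p. tensor_word zs (box_word p) (tensor_gen zs)"
  let ?Z = "cvec.span (?g ` {p \<in> weyl_box n. word_deg (box_word p) \<le> s})"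
  have low: "lower zs s \<subseteq> ?Z"
    unfolding lower_def
  proof (intro cvec.span_minimal subsetI)
    fix x assume "x \<in> {tensor_word zs ws (tensor_gen zs) |ws. word_deg ws < s}"
    then obtain vs where vs: "x = tensor_word zs vs (tensor_gen zs)" "word_deg vs < s" by blast
    then have "x \<in> cvec.span (?g ` {p \<in> weyl_box n. word_deg (box_word p) \<le> word_deg vs})"
      using less[of vs] by (simp add: s_def)
    also have "\<dots> \<subseteq> ?Z" using vs(2) by (intro cvec.span_mono) auto
    finally show "x \<in> ?Z" .
  qed simp
  have "env_comp zs s u \<in> ?Z" for u
  proof -
    have "u \<in> ev.span (weyl_left_ideal n \<union> box_mon ` weyl_box n)" by (simp add: box_mon_span)
    then show ?thesis
    proof (induction rule: ev.span_induct_alt)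
      case (step c y z)
      from step(1) have "env_comp zs s y \<in> ?Z"
      proof
        assume "y \<in> weyl_left_ideal n"
        then show ?thesis
          using weyl_left_ideal_subset_graded_ker[OF assms] low by (auto simp: graded_ker_def)
      next
        assume "y \<in> box_mon ` weyl_box n"
        then obtain p where p: "p \<in> weyl_box n" "y = box_mon p" by blast
        show ?thesis
        proof (cases "word_deg (box_word p) = s")
          case True
          then have "?g p \<in> ?Z" using p(1) by (intro cvec.span_base imageI) simp
          with True show ?thesis by (simp add: p(2) env_comp_box_mon)
        qed (simp add: p(2) env_comp_box_mon cvec.span_zero)
      qed
      with step(2) show ?case
        by (simp add: env_comp_add env_comp_scale cvec.span_add cvec.span_scale)
    qed (simp add: cvec.span_zero)
  qed
  from this[of "prod_list (map env_gen ws)"] show ?case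
    by (simp add: env_comp_word s_def)
qed

text \<open>The box monomials produce at most 3^n vectors, whose span contains all 3^n basis words;
  hence this family is independent. A relation modulo the graded kernel is first completed by terms
  of lower degree to a true relation in the tensor power.\<close>

lemma box_mon_independent:
  assumes "admissible zs" "length zs = n"
    and "(\<Sum>p\<in>weyl_box n. env_scale (c p) (box_mon p)) \<in> graded_ker zs" "q \<in> weyl_box n"
  shows "c q = 0"
proof -
  let ?g = "\<lambda>p. tensor_word zs (box_word p) (tensor_gen zs)"
  let ?B = "(\<lambda>w. Poly_Mapping.single w (1 :: complex)) ` words n"
  define s where "s = word_deg (box_word q)"
  have fin: "finite (weyl_box n)" using weyl_box_card by blast

  have B: "cvec.independent ?B" by (intro independent_singles words_card)
  have card: "card (weyl_box n) \<le> card ?B"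
    using weyl_box_card words_card card_image[OF inj_on_single] by metis
  have all: "tensor_word zs ws (tensor_gen zs) \<in> cvec.span (?g ` weyl_box n)" for ws
    using tensor_word_box_span[OF assms(2), of ws] by (rule rev_subsetD) (intro cvec.span_mono, auto)
  have span: "?B \<subseteq> cvec.span (?g ` weyl_box n)"
  proof
    fix x assume "x \<in> ?B"
    then have "x \<in> cvec.span {tensor_word zs ws (tensor_gen zs) |ws. True}"
      using tensor_gen_cyclic[OF assms(1)] assms(2) by auto
    also have "\<dots> \<subseteq> cvec.span (?g ` weyl_box n)"
      using all by (intro cvec.span_minimal) auto
    finally show "x \<in> cvec.span (?g ` weyl_box n)" .
  qed
  have "lower zs s \<subseteq> cvec.span ({0} \<union> ?g ` {p \<in> weyl_box n. word_deg (box_word p) < s})"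
    unfolding lower_def
  proof (intro cvec.span_minimal subsetI)
    fix x assume "x \<in> {tensor_word zs ws (tensor_gen zs) |ws. word_deg ws < s}"
    then obtain vs where vs: "x = tensor_word zs vs (tensor_gen zs)" "word_deg vs < s" by blast
    then have "x \<in> cvec.span (?g ` {p \<in> weyl_box n. word_deg (box_word p) \<le> word_deg vs})"
      using tensor_word_box_span[OF assms(2)] by simp
    also have "\<dots> \<subseteq> cvec.span ({0} \<union> ?g ` {p \<in> weyl_box n. word_deg (box_word p) < s})"
      using vs(2) by (intro cvec.span_mono) auto
    finally show "x \<in> cvec.span ({0} \<union> ?g ` {p \<in> weyl_box n. word_deg (box_word p) < s})" .
  qed simp
  moreover have "env_comp zs s (\<Sum>p\<in>weyl_box n. env_scale (c p) (box_mon p)) \<in> lower zs s"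
    using assms(3) by (simp add: graded_ker_def)
  ultimately have "env_comp zs s (\<Sum>p\<in>weyl_box n. env_scale (c p) (box_mon p))
    \<in> cvec.span ({0} \<union> ?g ` {p \<in> weyl_box n. word_deg (box_word p) < s})" by blast
  from cvec.span_Un_image[OF cvec.subspace_single_0 _ this] obtain d where
    d: "env_comp zs s (\<Sum>p\<in>weyl_box n. env_scale (c p) (box_mon p))
      = (\<Sum>p | p \<in> weyl_box n \<and> word_deg (box_word p) < s. cscale (d p) (?g p))"
    using fin by auto
  \<comment> \<open>The coefficients of the true relation: \<open>c\<close> in degree s, and below s
    the expansion \<open>d\<close> of the error in F_{s-1} with opposite sign.\<close>
  define k where "k = (\<lambda>p. if word_deg (box_word p) = s then c p
    else if word_deg (box_word p) < s then - d p else 0)"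
  have "(\<Sum>p\<in>weyl_box n. cscale (k p) (?g p))
    = (\<Sum>p\<in>weyl_box n. cscale (c p) (env_comp zs s (box_mon p))
        - (if word_deg (box_word p) < s then cscale (d p) (?g p) else 0))"
    by (intro sum.cong) (auto simp: k_def env_comp_box_mon)
  also have "\<dots> = env_comp zs s (\<Sum>p\<in>weyl_box n. env_scale (c p) (box_mon p))
      - (\<Sum>p | p \<in> weyl_box n \<and> word_deg (box_word p) < s. cscale (d p) (?g p))"
    using fin by (simp add: sum_subtractf env_comp_sum env_comp_scale sum.inter_filter)
  also have "\<dots> = 0" using d by simp
  finally have "k q = 0"
    by (rule cvec.spanning_family_independent[OF fin B card span order_refl _ assms(4)])
  then show ?thesis by (simp add: k_def s_def)
qed

text \<open>The box monomials span U modulo J and remain independent modulo the a priori larger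
  kernel, so nothing fits strictly between the two.\<close>

lemma graded_ker_eq:
  assumes "admissible zs" "length zs = n"
  shows "graded_ker zs = weyl_left_ideal n"
proof
  show "weyl_left_ideal n \<subseteq> graded_ker zs"
    using assms(2) by (rule weyl_left_ideal_subset_graded_ker)
  show "graded_ker zs \<subseteq> weyl_left_ideal n"
  proof
    fix u assume u: "u \<in> graded_ker zs"
    have "u \<in> ev.span (weyl_left_ideal n \<union> box_mon ` weyl_box n)" by (simp add: box_mon_span)
    from ev.span_Un_image[OF left_ideal_subspace[OF left_ideal_weyl] _ this]
    obtain x d where x: "x \<in> weyl_left_ideal n"
      and ux: "u = x + (\<Sum>p\<in>weyl_box n. env_scale (d p) (box_mon p))"
      using weyl_box_card by blast
    have "u - x \<in> graded_ker zs"
      using u x weyl_left_ideal_subset_graded_ker[OF assms(2)]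
      by (intro ev.subspace_diff[OF left_ideal_subspace[OF left_ideal_graded_ker]]) auto
    then have "(\<Sum>p\<in>weyl_box n. env_scale (d p) (box_mon p)) \<in> graded_ker zs"
      by (simp add: ux)
    then have "d p = 0" if "p \<in> weyl_box n" for p
      using box_mon_independent[OF assms] that by blast
    then have "u = x" by (simp add: ux)
    with x show "u \<in> weyl_left_ideal n" by simp
  qed
qed

lemma admissible_exists: "\<exists>zs. admissible zs \<and> length zs = n"
proof -
  let ?zs = "map (\<lambda>i. of_nat (Suc i)) [0..<n] :: complex list"
  have "(of_nat (Suc i) :: complex)\<^sup>2 \<noteq> (of_nat (Suc j))\<^sup>2" if "i \<noteq> j" for i j
  proof
    assume "(of_nat (Suc i) :: complex)\<^sup>2 = (of_nat (Suc j))\<^sup>2"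
    then have "(Suc i)\<^sup>2 = (Suc j)\<^sup>2" by (simp only: of_nat_eq_iff flip: of_nat_power)
    with that show False by simp
  qed
  moreover have "(of_nat (Suc i) :: complex) \<noteq> 0" for i by (simp only: of_nat_eq_0_iff)
  ultimately have "admissible ?zs" by (simp add: admissible_def del: of_nat_Suc)
  then show ?thesis by (intro exI[of _ ?zs]) simp
qed

section \<open>Cosets\<close>

definition coset :: "'a::ab_group_add set \<Rightarrow> 'a \<Rightarrow> 'a set"
  where "coset J x = (\<lambda>h. h + x) ` J"

definition add_subgroup :: "'a::ab_group_add set \<Rightarrow> bool"
  where "add_subgroup J \<longleftrightarrow> 0 \<in> J \<and> (\<forall>x\<in>J. \<forall>y\<in>J. x - y \<in> J)"

lemma add_subgroup_0: "add_subgroup J \<Longrightarrow> 0 \<in> J"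
  and add_subgroup_diff: "add_subgroup J \<Longrightarrow> x \<in> J \<Longrightarrow> y \<in> J \<Longrightarrow> x - y \<in> J"
  by (auto simp: add_subgroup_def)

lemma add_subgroup_uminus: "add_subgroup J \<Longrightarrow> x \<in> J \<Longrightarrow> - x \<in> J"
  using add_subgroup_diff[of J 0 x] by (simp add: add_subgroup_0)

lemma add_subgroup_add: "add_subgroup J \<Longrightarrow> x \<in> J \<Longrightarrow> y \<in> J \<Longrightarrow> x + y \<in> J"
  using add_subgroup_diff[of J x "- y"] by (simp add: add_subgroup_uminus)

lemma mem_coset: "y \<in> coset J x \<longleftrightarrow> y - x \<in> J"
  unfolding coset_def by (metis (no_types, lifting) diff_add_cancel add_diff_cancel image_iff)

lemma coset_0 [simp]: "coset J 0 = J"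
  by (simp add: coset_def)

lemma coset_eq_iff:
  assumes "add_subgroup J"
  shows "coset J x = coset J y \<longleftrightarrow> x - y \<in> J"
proof
  assume "coset J x = coset J y"
  moreover have "x \<in> coset J x" using assms by (simp add: mem_coset add_subgroup_0)
  ultimately show "x - y \<in> J" by (simp add: mem_coset)
next
  assume xy: "x - y \<in> J"
  have "z - x \<in> J \<longleftrightarrow> z - y \<in> J" for z
  proof
    assume "z - x \<in> J"
    from add_subgroup_add[OF assms this xy] show "z - y \<in> J" by simp
  next
    assume "z - y \<in> J"
    from add_subgroup_diff[OF assms this xy] show "z - x \<in> J" by simp
  qed
  then show "coset J x = coset J y" unfolding set_eq_iff mem_coset by blast
qed

lemma coset_eq_self_iff: "add_subgroup J \<Longrightarrow> coset J x = J \<longleftrightarrow> x \<in> J"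
  using coset_eq_iff[of J x 0] by simp

text \<open>The operations on quotients are unions over all representatives. Well-definedness makes
  all members of the union equal. Two subgroups occur because the graded action changes the degree
  and with it the subspace divided out.\<close>

lemma coset_UN:
  assumes "add_subgroup J" "add_subgroup K" "\<And>y. y - x \<in> J \<Longrightarrow> g y - g x \<in> K"
  shows "(\<Union>y\<in>coset J x. coset K (g y)) = coset K (g x)"
proof -
  have "coset K (g y) = coset K (g x)" if "y \<in> coset J x" for y
    using that assms(3) by (simp add: coset_eq_iff[OF assms(2)] mem_coset)
  then have "(\<Union>y\<in>coset J x. coset K (g y)) = (\<Union>y\<in>coset J x. coset K (g x))"
    by (rule SUP_cong[OF refl])
  moreover have "x \<in> coset J x" using assms(1) by (simp add: mem_coset add_subgroup_0)
  ultimately show ?thesis unfolding UN_constant by (metis empty_iff)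
qed

lemma coset_add:
  assumes "add_subgroup J"
  shows "(\<Union>h\<in>coset J x. \<Union>k\<in>coset J y. {h + k}) = coset J (x + y)"
proof (intro equalityI subsetI)
  fix z assume "z \<in> (\<Union>h\<in>coset J x. \<Union>k\<in>coset J y. {h + k})"
  then obtain h k where "h - x \<in> J" "k - y \<in> J" "z = h + k" by (auto simp: mem_coset)
  with add_subgroup_add[OF assms, of "h - x" "k - y"] show "z \<in> coset J (x + y)"
    by (simp add: mem_coset algebra_simps)
next
  fix z assume "z \<in> coset J (x + y)"
  then have "z - y \<in> coset J x" by (simp add: mem_coset algebra_simps)
  moreover have "y \<in> coset J y" using assms by (simp add: mem_coset add_subgroup_0)
  moreover have "z = (z - y) + y" by simp
  ultimately show "z \<in> (\<Union>h\<in>coset J x. \<Union>k\<in>coset J y. {h + k})" by blast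
qed

lemma a_r_coset_eq_coset: "add M = (+) \<Longrightarrow> J +>\<^bsub>M\<^esub> x = coset J x"
  by (auto simp: a_r_coset_def' coset_def)

lemma set_add_cosets:
  "add M = (+) \<Longrightarrow> add_subgroup J \<Longrightarrow> coset J x <+>\<^bsub>M\<^esub> coset J y = coset J (x + y)"
  by (simp add: set_add_def' coset_add)

section \<open>Cyclic modules\<close>

lemma add_subgroup_left_ideal: "left_ideal J \<Longrightarrow> add_subgroup J"
  using ev.subspace_diff[OF left_ideal_subspace] by (auto simp: add_subgroup_def left_ideal_def)

lemma regular_tmod_add: "add regular_tmod = (+)"
  and regular_tmod_carrier: "carrier regular_tmod = UNIV"
  by (simp_all add: regular_tmod_def)

context
  fixes J assumes J: "left_ideal J"
begin

lemma quot_carrier: "carrier (tmod_quot regular_tmod J) = range (coset J)"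
  by (auto simp: tmod_quot_def A_RCOSETS_def' a_r_coset_eq_coset[OF regular_tmod_add] regular_tmod_carrier)

lemma quot_zero: "\<zero>\<^bsub>tmod_quot regular_tmod J\<^esub> = coset J 0"
  by (simp add: tmod_quot_def)

lemma quot_add: "coset J x \<oplus>\<^bsub>tmod_quot regular_tmod J\<^esub> coset J y = coset J (x + y)"
  by (simp add: tmod_quot_def set_add_cosets[OF regular_tmod_add add_subgroup_left_ideal[OF J]])

lemma quot_smult: "c \<odot>\<^bsub>tmod_quot regular_tmod J\<^esub> coset J x = coset J (env_scale c x)"
proof -
  have "c \<odot>\<^bsub>tmod_quot regular_tmod J\<^esub> coset J x = (\<Union>y\<in>coset J x. coset J (env_const c * y))"
    by (simp add: tmod_quot_def a_r_coset_eq_coset[OF regular_tmod_add]) (simp add: regular_tmod_def)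
  also have "\<dots> = coset J (env_const c * x)"
    using J by (intro coset_UN add_subgroup_left_ideal) (auto simp flip: right_diff_distrib intro: left_ideal_mult)
  finally show ?thesis by (simp add: env_scale_def)
qed

lemma quot_act: "act (tmod_quot regular_tmod J) a (coset J x) = coset J (env_gen a * x)"
proof -
  have "act (tmod_quot regular_tmod J) a (coset J x) = (\<Union>y\<in>coset J x. coset J (env_gen a * y))"
    by (simp add: tmod_quot_def a_r_coset_eq_coset[OF regular_tmod_add]) (simp add: regular_tmod_def)
  also have "\<dots> = coset J (env_gen a * x)"
    using J by (intro coset_UN add_subgroup_left_ideal) (auto simp flip: right_diff_distrib intro: left_ideal_mult)
  finally show ?thesis .
qed

lemma quot_act_power: "(act (tmod_quot regular_tmod J) a ^^ k) (coset J x) = coset J (env_gen a ^ k * x)"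
  by (induction k) (simp_all add: quot_act mult.assoc)

lemma quot_act_word:
  "foldr (\<lambda>i. act (tmod_quot regular_tmod J) (g i)) is (coset J x)
    = coset J (prod_list (map (\<lambda>i. env_gen (g i)) is) * x)"
  by (induction "is") (simp_all add: quot_act mult.assoc)

lemma quot_abelian_monoid: "abelian_monoid (tmod_quot regular_tmod J)"
  by (rule abelian_monoidI) (auto simp: quot_carrier quot_zero quot_add algebra_simps simp del: coset_0)

lemma quot_finsum:
  assumes "finite S"
  shows "(\<Oplus>\<^bsub>tmod_quot regular_tmod J\<^esub>i\<in>S. c i \<odot>\<^bsub>tmod_quot regular_tmod J\<^esub> coset J (f i))
    = coset J (\<Sum>i\<in>S. env_scale (c i) (f i))"
proof -
  interpret abelian_monoid "tmod_quot regular_tmod J" by (rule quot_abelian_monoid)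
  show ?thesis
    using assms
  proof (induction S rule: finite_induct)
    case empty
    show ?case by (simp add: quot_zero)
  next
    case (insert i S)
    then show ?case
      by (subst finsum_insert) (auto simp: quot_carrier quot_smult quot_add)
  qed
qed

end

section \<open>The twisted Weyl module\<close>

lemma graded_quot_integrable: "sl2_integrable (tmod_quot regular_tmod (graded_ker zs))"
  unfolding sl2_integrable_def
proof
  fix x assume "x \<in> carrier (tmod_quot regular_tmod (graded_ker zs))"
  then obtain u where x: "x = coset (graded_ker zs) u"
    by (auto simp: quot_carrier[OF left_ideal_graded_ker])
  let ?n = "Suc (length zs)"
  have mem: "env_gen (tw y 0) ^ ?n * u \<in> graded_ker zs" if "y = OE \<or> y = OF" for y
  proof -
    have "tdeg (tw y 0) = 0" using that by (auto simp: tdeg_tw)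
    then have "env_comp zs s (env_gen (tw y 0) ^ ?n * u) = 0" for s
      using that tensor_act_raise_nilpotent[OF env_comp_supp_on] tensor_act_lower_nilpotent[OF env_comp_supp_on]
      by (auto simp only: env_comp_power_mult)
    then show ?thesis by (simp add: graded_ker_def cvec.subspace_0 subspace_lower del: power_Suc)
  qed
  show "\<exists>N. (act (tmod_quot regular_tmod (graded_ker zs)) (tw OE 0) ^^ N) x = \<zero>\<^bsub>tmod_quot regular_tmod (graded_ker zs)\<^esub>
    \<and> (act (tmod_quot regular_tmod (graded_ker zs)) (tw OF 0) ^^ N) x = \<zero>\<^bsub>tmod_quot regular_tmod (graded_ker zs)\<^esub>"
    unfolding x quot_act_power[OF left_ideal_graded_ker] quot_zero[OF left_ideal_graded_ker]
      coset_eq_iff[OF add_subgroup_left_ideal[OF left_ideal_graded_ker]]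
    by (intro exI[of _ ?n]) (simp only: mem diff_0_right simp_thms)
qed

lemma weyl_ideal_eq: "weyl_ideal n = weyl_left_ideal n"
proof
  obtain zs where zs: "admissible zs" "length zs = n" using admissible_exists by blast
  have "sl2_integrable (tmod_quot regular_tmod (weyl_left_ideal n))"
    using graded_quot_integrable[of zs] graded_ker_eq[OF zs] by simp
  moreover have "weyl_relators n \<subseteq> weyl_left_ideal n" by (auto simp: weyl_left_ideal_def)
  ultimately show "weyl_ideal n \<subseteq> weyl_left_ideal n"
    using left_ideal_weyl unfolding weyl_ideal_def by blast
  show "weyl_left_ideal n \<subseteq> weyl_ideal n"
    unfolding weyl_ideal_def weyl_left_ideal_def by blast
qed

definition index_box :: "nat list \<times> nat list \<Rightarrow> nat list \<times> nat list"
  where "index_box = (\<lambda>(as, bs). (map (\<lambda>a. a div 2) as, map (\<lambda>b. b div 2) bs))"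

lemma bij_betw_index_box: "bij_betw index_box (weyl_index n) (weyl_box n)"
proof (rule bij_betw_byWitness[where f' = "\<lambda>(as, bs). (map (\<lambda>a. 2 * a) as, map (\<lambda>b. 2 * b + 1) bs)"])
  show "\<forall>p\<in>weyl_index n. (\<lambda>(as, bs). (map (\<lambda>a. 2 * a) as, map (\<lambda>b. 2 * b + 1) bs)) (index_box p) = p"
    by (auto simp: weyl_index_def index_box_def intro!: map_idI)
  show "\<forall>p\<in>weyl_box n. index_box ((\<lambda>(as, bs). (map (\<lambda>a. 2 * a) as, map (\<lambda>b. 2 * b + 1) bs)) p) = p"
    by (auto simp: index_box_def comp_def)
  show "index_box ` weyl_index n \<subseteq> weyl_box n"
  proof (rule image_subsetI)
    fix q assume "q \<in> weyl_index n"
    moreover obtain as bs where q: "q = (as, bs)" by fastforce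
    ultimately have p: "(as, bs) \<in> weyl_index n" by simp
    have "sorted_wrt (<) (map (\<lambda>b. b div 2) bs)"
      unfolding sorted_wrt_map
      by (rule sorted_wrt_mono_rel[of bs "(<)"]) (use p in \<open>auto simp: weyl_index_def elim!: oddE\<close>)
    moreover have "sorted (map (\<lambda>a. a div 2) as)"
      unfolding sorted_map
      by (rule sorted_wrt_mono_rel[of as "(\<le>)"]) (use p in \<open>auto simp: weyl_index_def intro: div_le_mono\<close>)
    moreover have "b div 2 < n" if "b \<in> set bs" for b
      using p that by (fastforce simp: weyl_index_def elim!: oddE)
    moreover have "a div 2 + length as + length bs \<le> n" if "a \<in> set as" for a
      using p that by (fastforce simp: weyl_index_def elim!: evenE)
    ultimately show "index_box q \<in> weyl_box n"
      by (auto simp: q index_box_def weyl_box_def)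
  qed
  show "(\<lambda>(as, bs). (map (\<lambda>a. 2 * a) as, map (\<lambda>b. 2 * b + 1) bs)) ` weyl_box n \<subseteq> weyl_index n"
    by (fastforce simp: weyl_box_def weyl_index_def sorted_wrt_map sorted_map)
qed

lemma weyl_vec_eq:
  assumes "p \<in> weyl_index n"
  shows "weyl_vec n p = coset (weyl_left_ideal n) (box_mon (index_box p))"
proof -
  obtain as bs where p: "p = (as, bs)" by fastforce
  have as: "map (\<lambda>a. env_gen (tw OE a)) as = map (\<lambda>a. ue (a div 2)) as"
    and bs: "map (\<lambda>b. env_gen (tw OGp b)) bs = map (\<lambda>b. up (b div 2)) bs"
    using assms by (auto simp: p weyl_index_def ue_def up_def)
  have "weyl_gen n = coset (weyl_left_ideal n) 1"
    by (simp add: weyl_gen_def weyl_ideal_eq a_r_coset_eq_coset[OF regular_tmod_add])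
  then have "weyl_vec n p = coset (weyl_left_ideal n)
      (prod_list (map (\<lambda>a. env_gen (tw OE a)) as) * prod_list (map (\<lambda>b. env_gen (tw OGp b)) bs))"
    by (simp add: p weyl_vec_def weyl_module_def weyl_ideal_eq quot_act_word[OF left_ideal_weyl])
  then show ?thesis
    unfolding as bs by (simp add: p index_box_def box_mon_eq comp_def)
qed

lemma weyl_basis: "is_basis_family (weyl_module n) (weyl_vec n) (weyl_index n)"
proof -
  let ?J = "weyl_left_ideal n" and ?M = "tmod_quot regular_tmod (weyl_left_ideal n)"
  obtain zs where zs: "admissible zs" "length zs = n" using admissible_exists by blast
  note bij = bij_betw_index_box[of n]
  have fin: "finite (weyl_index n)"
    using bij_betw_finite[OF bij] weyl_box_card by blast
  have sum: "(\<Oplus>\<^bsub>?M\<^esub>i\<in>S. c i \<odot>\<^bsub>?M\<^esub> weyl_vec n i)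
    = coset ?J (\<Sum>i\<in>S. env_scale (c i) (box_mon (index_box i)))" if "S \<subseteq> weyl_index n" for S c
  proof -
    interpret abelian_monoid ?M by (rule quot_abelian_monoid[OF left_ideal_weyl])
    have "(\<Oplus>\<^bsub>?M\<^esub>i\<in>S. c i \<odot>\<^bsub>?M\<^esub> weyl_vec n i)
      = (\<Oplus>\<^bsub>?M\<^esub>i\<in>S. c i \<odot>\<^bsub>?M\<^esub> coset ?J (box_mon (index_box i)))"
      using that by (intro finsum_cong')
        (auto simp: weyl_vec_eq subset_iff quot_smult[OF left_ideal_weyl] quot_carrier[OF left_ideal_weyl])
    then show ?thesis
      using quot_finsum[OF left_ideal_weyl] finite_subset[OF that fin] by simp
  qed
  have carrier: "weyl_vec n ` weyl_index n \<subseteq> carrier ?M"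
    by (auto simp: quot_carrier[OF left_ideal_weyl] weyl_vec_eq)
  have spanning: "\<exists>S c. finite S \<and> S \<subseteq> weyl_index n \<and> x = (\<Oplus>\<^bsub>?M\<^esub>i\<in>S. c i \<odot>\<^bsub>?M\<^esub> weyl_vec n i)"
    if "x \<in> carrier ?M" for x
  proof -
    from that obtain u where x: "x = coset ?J u" by (auto simp: quot_carrier[OF left_ideal_weyl])
    have "u \<in> ev.span (?J \<union> box_mon ` weyl_box n)" by (simp add: box_mon_span)
    from ev.span_Un_image[OF left_ideal_subspace[OF left_ideal_weyl] _ this]
    obtain y d where y: "y \<in> ?J" and u: "u = y + (\<Sum>p\<in>weyl_box n. env_scale (d p) (box_mon p))"
      using weyl_box_card by blast
    have "(\<Sum>p\<in>weyl_box n. env_scale (d p) (box_mon p))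
      = (\<Sum>i\<in>weyl_index n. env_scale (d (index_box i)) (box_mon (index_box i)))"
      by (rule sum.reindex_bij_betw[OF bij, symmetric])
    moreover have "x = coset ?J (\<Sum>p\<in>weyl_box n. env_scale (d p) (box_mon p))"
      using y by (simp add: x u coset_eq_iff[OF add_subgroup_left_ideal[OF left_ideal_weyl]])
    ultimately have "x = (\<Oplus>\<^bsub>?M\<^esub>i\<in>weyl_index n. d (index_box i) \<odot>\<^bsub>?M\<^esub> weyl_vec n i)"
      by (simp add: sum)
    with fin show ?thesis
      by (intro exI[of _ "weyl_index n"] exI[of _ "\<lambda>i. d (index_box i)"]) auto
  qed
  have independent: "c j = 0"
    if S: "finite S" "S \<subseteq> weyl_index n" and zero: "(\<Oplus>\<^bsub>?M\<^esub>i\<in>S. c i \<odot>\<^bsub>?M\<^esub> weyl_vec n i) = \<zero>\<^bsub>?M\<^esub>"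
      and j: "j \<in> S" for S c j
  proof -
    \<comment> \<open>The coefficients are transported along the bijection of index sets and
      extended by 0 outside \<open>S\<close>.\<close>
    define d where "d = (\<lambda>p. let i = inv_into (weyl_index n) index_box p in if i \<in> S then c i else 0)"
    have d: "d (index_box i) = (if i \<in> S then c i else 0)" if "i \<in> weyl_index n" for i
      using that bij by (simp add: d_def bij_betw_def)
    have "(\<Sum>p\<in>weyl_box n. env_scale (d p) (box_mon p))
      = (\<Sum>i\<in>weyl_index n. env_scale (d (index_box i)) (box_mon (index_box i)))"
      by (rule sum.reindex_bij_betw[OF bij, symmetric])
    also have "\<dots> = (\<Sum>i\<in>S. env_scale (c i) (box_mon (index_box i)))"
      using S fin by (intro sum.mono_neutral_cong_right) (auto simp: d)
    finally have "(\<Sum>p\<in>weyl_box n. env_scale (d p) (box_mon p)) \<in> ?J"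
      using zero S(2) by (simp add: sum quot_zero[OF left_ideal_weyl] coset_eq_self_iff[OF add_subgroup_left_ideal[OF left_ideal_weyl]])
    moreover have "index_box j \<in> weyl_box n"
      using j S(2) bij by (auto simp: bij_betw_def)
    ultimately have "d (index_box j) = 0"
      using box_mon_independent[OF zs] graded_ker_eq[OF zs] by metis
    with d[of j] j S(2) show ?thesis by auto
  qed
  show ?thesis
    unfolding is_basis_family_def weyl_module_def weyl_ideal_eq
    by (intro conjI ballI allI impI carrier) (rule spanning, assumption, rule independent)
qed

section \<open>The graded tensor product\<close>

lemma tensor_module_add: "add (tensor_module zs) = (+)"
  by (simp add: tensor_module_def)

lemma add_subgroup_subspace: "cvec.subspace J \<Longrightarrow> add_subgroup J"
  by (simp add: add_subgroup_def cvec.subspace_0 cvec.subspace_diff)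

lemmas add_subgroup_lower = add_subgroup_subspace[OF subspace_lower]

text \<open>The orbit map of the generator, from U to the graded tensor product. Its kernel is
  \<open>graded_ker zs\<close>, and its surjectivity is the cyclicity of the associated graded
  module.\<close>

definition graded_class :: "complex list \<Rightarrow> env \<Rightarrow> nat \<Rightarrow> (vbas list \<Rightarrow>\<^sub>0 complex) set"
  where "graded_class zs u s = coset (lower zs s) (env_comp zs s u)"

lemma graded_class_eq_iff: "graded_class zs u = graded_class zs v \<longleftrightarrow> u - v \<in> graded_ker zs"
  by (simp add: fun_eq_iff graded_class_def coset_eq_iff[OF add_subgroup_lower] graded_ker_def env_comp_diff)

text \<open>Monomials of degree below s disappear modulo F_{s-1}. The representative has no
  components in other degrees, so representatives for different s can be added without
  interference.\<close>

lemma tensor_filt_homogeneous: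
  assumes "m \<in> tensor_filt zs s"
  shows "\<exists>u. m - env_comp zs s u \<in> lower zs s \<and> (\<forall>t. t \<noteq> s \<longrightarrow> env_comp zs t u = 0)"
  using assms unfolding tensor_filt_eq
proof (induction rule: cvec.span_induct_alt)
  case base
  show ?case by (intro exI[of _ 0]) (simp add: cvec.subspace_0 subspace_lower)
next
  case (step c x y)
  then obtain u where u: "y - env_comp zs s u \<in> lower zs s" "\<forall>t. t \<noteq> s \<longrightarrow> env_comp zs t u = 0" by blast
  from step obtain ws where ws: "x = tensor_word zs ws (tensor_gen zs)" "word_deg ws \<le> s" by blast
  show ?case
  proof (cases "word_deg ws = s")
    case True
    with u ws show ?thesis
      by (intro exI[of _ "env_scale c (prod_list (map env_gen ws)) + u"])
        (simp add: env_comp_add env_comp_scale env_comp_word)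
  next
    case False
    then have "x \<in> lower zs s" using ws by (simp add: tensor_word_lower)
    then have "cscale c x + (y - env_comp zs s u) \<in> lower zs s"
      using u by (intro cvec.subspace_add cvec.subspace_scale subspace_lower)
    with u show ?thesis by (intro exI[of _ u]) (simp add: algebra_simps)
  qed
qed

lemma graded_carrier: "carrier (graded_tensor zs) = range (graded_class zs)"
proof (intro equalityI subsetI)
  fix X assume "X \<in> carrier (graded_tensor zs)"
  then have mem: "\<forall>s. \<exists>m\<in>tensor_filt zs s. X s = coset (lower zs s) m"
    and fin: "finite {s. X s \<noteq> lower zs s}"
    by (auto simp: graded_tensor_def assoc_graded_def Let_def filt_prev_tensor
        a_r_coset_eq_coset[OF tensor_module_add])
  have "\<exists>u. X s = coset (lower zs s) (env_comp zs s u) \<and> (\<forall>t. t \<noteq> s \<longrightarrow> env_comp zs t u = 0)" for s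
  proof -
    obtain m where m: "m \<in> tensor_filt zs s" "X s = coset (lower zs s) m" using mem by blast
    then show ?thesis
      using tensor_filt_homogeneous[OF m(1)] by (auto simp: coset_eq_iff[OF add_subgroup_lower])
  qed
  then obtain u where u: "\<And>s. X s = coset (lower zs s) (env_comp zs s (u s))"
    "\<And>s t. t \<noteq> s \<Longrightarrow> env_comp zs t (u s) = 0" by metis
  define v where "v = (\<Sum>s | X s \<noteq> lower zs s. u s)"
  have "X t = graded_class zs v t" for t
  proof -
    have "env_comp zs t v = (\<Sum>s | X s \<noteq> lower zs s. if s = t then env_comp zs t (u t) else 0)"
      unfolding v_def env_comp_sum by (intro sum.cong) (auto simp: u(2))
    also have "\<dots> = (if X t \<noteq> lower zs t then env_comp zs t (u t) else 0)"
      using fin by simp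
    finally show ?thesis using u(1)[of t] by (auto simp: graded_class_def)
  qed
  then show "X \<in> range (graded_class zs)" by blast
next
  fix X assume "X \<in> range (graded_class zs)"
  then obtain u where X: "X = graded_class zs u" by blast
  have "{s. X s \<noteq> lower zs s} \<subseteq> {s. env_comp zs s u \<noteq> 0}"
    by (auto simp: X graded_class_def)
  then have "finite {s. X s \<noteq> lower zs s}" using finite_env_comp finite_subset by blast
  then show "X \<in> carrier (graded_tensor zs)"
    using env_comp_mem_tensor_filt
    by (auto simp: X graded_tensor_def assoc_graded_def Let_def filt_prev_tensor
        a_r_coset_eq_coset[OF tensor_module_add] graded_class_def)
qed

lemma graded_add:
  "graded_class zs u \<oplus>\<^bsub>graded_tensor zs\<^esub> graded_class zs v = graded_class zs (u + v)"
  by (rule ext) (simp add: graded_tensor_def assoc_graded_def Let_def graded_class_def env_comp_add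
      set_add_cosets[OF tensor_module_add add_subgroup_lower])

lemma graded_smult:
  "c \<odot>\<^bsub>graded_tensor zs\<^esub> graded_class zs u = graded_class zs (env_scale c u)"
proof
  fix s
  have "(c \<odot>\<^bsub>graded_tensor zs\<^esub> graded_class zs u) s
    = (\<Union>m\<in>coset (lower zs s) (env_comp zs s u). coset (lower zs s) (cscale c m))"
    by (simp add: graded_tensor_def assoc_graded_def Let_def filt_prev_tensor graded_class_def
        a_r_coset_eq_coset[OF tensor_module_add]) (simp add: tensor_module_def)
  also have "\<dots> = coset (lower zs s) (cscale c (env_comp zs s u))"
    by (intro coset_UN add_subgroup_lower)
      (simp flip: cvec.scale_right_diff_distrib add: cvec.subspace_scale subspace_lower)
  finally show "(c \<odot>\<^bsub>graded_tensor zs\<^esub> graded_class zs u) s = graded_class zs (env_scale c u) s"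
    by (simp add: graded_class_def env_comp_scale)
qed

lemma graded_act:
  "act (graded_tensor zs) a (graded_class zs u) = graded_class zs (env_gen a * u)"
proof
  fix s
  show "act (graded_tensor zs) a (graded_class zs u) s = graded_class zs (env_gen a * u) s"
  proof (cases "s < tdeg a")
    case True
    then show ?thesis
      by (simp add: graded_tensor_def assoc_graded_def Let_def filt_prev_tensor graded_class_def
        env_comp_gen_mult)
  next
    case False
    have "act (graded_tensor zs) a (graded_class zs u) s
      = (\<Union>m\<in>coset (lower zs (s - tdeg a)) (env_comp zs (s - tdeg a) u).
          coset (lower zs s) (tensor_act zs a m))"
      using False
      by (simp add: graded_tensor_def assoc_graded_def Let_def filt_prev_tensor graded_class_def
        a_r_coset_eq_coset[OF tensor_module_add])
    also have "\<dots> = coset (lower zs s) (tensor_act zs a (env_comp zs (s - tdeg a) u))"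
    proof (intro coset_UN add_subgroup_lower)
      fix y assume "y - env_comp zs (s - tdeg a) u \<in> lower zs (s - tdeg a)"
      from tensor_act_lower[OF this, of a]
      show "tensor_act zs a y - tensor_act zs a (env_comp zs (s - tdeg a) u) \<in> lower zs s"
        using False by (simp add: tensor_act_diff)
    qed
    finally show ?thesis using False by (simp add: graded_class_def env_comp_gen_mult)
  qed
qed

text \<open>Since odd generators have odd degree, the parity of a homogeneous element is that of its degree.\<close>

definition parity_proj :: "bool \<Rightarrow> (vbas list \<Rightarrow>\<^sub>0 complex) \<Rightarrow> (vbas list \<Rightarrow>\<^sub>0 complex)"
  where "parity_proj p = lin_ext (\<lambda>w. if odd (word_weight w) = p then Poly_Mapping.single w 1 else 0)"

lemma parity_part_tensor:
  "parity_part (tensor_module zs) p = supp_on {w. length w = length zs \<and> odd (word_weight w) = p}"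
  by (auto simp: tensor_module_def supp_on_def odd_word_weight)

lemma parity_proj_supp_on:
  assumes "x \<in> supp_on {w. length w = k \<and> odd (word_weight w) = q}"
  shows "parity_proj p x = (if q = p then x else 0)"
proof -
  have "parity_proj p x = lin_ext (\<lambda>w. if q = p then Poly_Mapping.single w 1 else 0) x"
    unfolding parity_proj_def using assms by (intro lin_ext_cong) (auto simp: supp_on_def)
  then show ?thesis by (simp add: lin_ext_id)
qed

lemma parity_proj_tensor_word:
  "parity_proj p (tensor_word zs ws (tensor_gen zs)) = (if odd (word_deg ws) = p then tensor_word zs ws (tensor_gen zs) else 0)"
  by (rule parity_proj_supp_on[OF tensor_word_parity])

text \<open>Monomials of degree exactly s give vectors of the parity of s. The part of the wrong
  parity thus comes from monomials of smaller degree.\<close>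

lemma parity_proj_tensor_filt:
  assumes "m \<in> tensor_filt zs s"
  shows "(if odd s = p then m - parity_proj p m else parity_proj p m) \<in> lower zs s"
proof -
  define g where "g = (\<lambda>m. if odd s = p then m - parity_proj p m else parity_proj p m)"
  have add: "g (x + y) = g x + g y" and scale: "g (cscale c x) = cscale c (g x)" and zero: "g 0 = 0" for x y c
    by (simp_all add: g_def parity_proj_def lin_ext_add lin_ext_cscale cvec.scale_right_diff_distrib)
  have "g m \<in> lower zs s"
    using assms unfolding tensor_filt_eq
  proof (induction rule: cvec.span_induct_alt)
    case (step c x y)
    then obtain ws where ws: "x = tensor_word zs ws (tensor_gen zs)" "word_deg ws \<le> s" by blast
    have "g x \<in> lower zs s"
    proof (cases "word_deg ws = s")
      case True
      then show ?thesis
        by (auto simp: g_def ws(1) parity_proj_tensor_word cvec.subspace_0 subspace_lower)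
    next
      case False
      then have "x \<in> lower zs s" using ws by (simp add: tensor_word_lower)
      then show ?thesis
        by (auto simp: g_def ws(1) parity_proj_tensor_word cvec.subspace_0 subspace_lower)
    qed
    with step show ?case
      by (simp add: add scale cvec.subspace_add cvec.subspace_scale subspace_lower)
  qed (simp add: zero cvec.subspace_0 subspace_lower)
  then show ?thesis by (simp add: g_def)
qed

text \<open>Parity is rewritten as a vanishing condition on the components of u in the degrees of
  the wrong parity, a form that refers to the parameters only through the kernel in each
  degree.\<close>

lemma graded_parity_part:
  "parity_part (graded_tensor zs) p =
    graded_class zs ` {u. \<forall>s. odd s \<noteq> p \<longrightarrow> env_comp zs s u \<in> lower zs s}"
proof -
  have key: "graded_class zs u s \<inter> parity_part (tensor_module zs) p \<noteq> {}
      \<longleftrightarrow> (odd s \<noteq> p \<longrightarrow> env_comp zs s u \<in> lower zs s)" for u s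
  proof
    assume "graded_class zs u s \<inter> parity_part (tensor_module zs) p \<noteq> {}"
    then obtain x where x: "x - env_comp zs s u \<in> lower zs s" "x \<in> parity_part (tensor_module zs) p"
      by (auto simp: graded_class_def mem_coset)
    then have proj: "parity_proj p x = x"
      using parity_proj_supp_on[of x "length zs" p p] by (simp add: parity_part_tensor)
    have "(x - env_comp zs s u) + env_comp zs s u \<in> tensor_filt zs s"
      using x(1) lower_subset_tensor_filt env_comp_mem_tensor_filt
      unfolding tensor_filt_eq by (intro cvec.span_add) auto
    then have "x \<in> tensor_filt zs s" by simp
    from parity_proj_tensor_filt[OF this, of p] proj
    have "x \<in> lower zs s" if "odd s \<noteq> p" using that by simp
    then show "odd s \<noteq> p \<longrightarrow> env_comp zs s u \<in> lower zs s"
      using cvec.subspace_diff[OF subspace_lower _ x(1), of x] by auto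
  next
    assume *: "odd s \<noteq> p \<longrightarrow> env_comp zs s u \<in> lower zs s"
    show "graded_class zs u s \<inter> parity_part (tensor_module zs) p \<noteq> {}"
    proof (cases "odd s = p")
      case True
      have "parity_proj p (env_comp zs s u) \<in> parity_part (tensor_module zs) p"
        unfolding parity_part_tensor parity_proj_def using env_comp_supp_on
        by (rule lin_ext_supp_on) (auto simp: single_supp_on cvec.subspace_0 subspace_supp_on)
      moreover have "- (env_comp zs s u - parity_proj p (env_comp zs s u)) \<in> lower zs s"
        using parity_proj_tensor_filt[OF env_comp_mem_tensor_filt[of zs s u], of p] True
        by (intro cvec.subspace_neg subspace_lower) simp
      ultimately show ?thesis by (auto simp: graded_class_def mem_coset)
    next
      case False
      then have "0 \<in> graded_class zs u s"
        using * by (simp add: graded_class_def mem_coset cvec.subspace_neg subspace_lower)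
      moreover have "0 \<in> parity_part (tensor_module zs) p"
        by (simp add: parity_part_tensor cvec.subspace_0 subspace_supp_on)
      ultimately show ?thesis by blast
    qed
  qed
  have "parity_part (graded_tensor zs) p
    = {X \<in> carrier (graded_tensor zs). \<forall>s. X s \<inter> parity_part (tensor_module zs) p \<noteq> {}}"
    by (simp add: graded_tensor_def assoc_graded_def Let_def)
  also have "\<dots> = graded_class zs ` {u. \<forall>s. graded_class zs u s \<inter> parity_part (tensor_module zs) p \<noteq> {}}"
    unfolding graded_carrier by auto
  finally show ?thesis unfolding key .
qed

text \<open>Both modules are cyclic with the same annihilator J of the generator. The map sends u
  applied to one generator to u applied to the other.\<close>

lemma graded_tensor_iso:
  assumes "admissible zs" "admissible zs'" "length zs = length zs'"
  shows "tmod_iso (graded_tensor zs) (graded_tensor zs')"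
proof -
  have ker: "graded_ker zs = graded_ker zs'"
    using graded_ker_eq assms by metis
  define \<phi> where "\<phi> = (\<lambda>X. graded_class zs' (SOME u. graded_class zs u = X))"
  have \<phi>: "\<phi> (graded_class zs u) = graded_class zs' u" for u
  proof -
    have "graded_class zs (SOME v. graded_class zs v = graded_class zs u) = graded_class zs u"
      by (rule someI_ex) blast
    then show ?thesis by (simp add: \<phi>_def graded_class_eq_iff ker)
  qed
  \<comment> \<open>Parity needs the condition in a single degree, whereas the kernels are compared
    as a whole; passing to the homogeneous component of u bridges the gap.\<close>
  have lower_iff: "env_comp zs s u \<in> lower zs s \<longleftrightarrow> env_comp zs' s u \<in> lower zs' s" for s u
  proof -
    obtain v where v: "\<And>zs t. env_comp zs t v = (if t = s then env_comp zs s u else 0)"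
      using env_homogeneous_component by metis
    have "v \<in> graded_ker ys \<longleftrightarrow> env_comp ys s u \<in> lower ys s" for ys
      by (auto simp: graded_ker_def v cvec.subspace_0 subspace_lower)
    then show ?thesis using ker by metis
  qed
  have "bij_betw \<phi> (carrier (graded_tensor zs)) (carrier (graded_tensor zs'))"
    unfolding bij_betw_def graded_carrier
    by (auto simp: inj_on_def \<phi> graded_class_eq_iff ker image_image)
  moreover have "\<phi> ` parity_part (graded_tensor zs) p = parity_part (graded_tensor zs') p" for p
    unfolding graded_parity_part image_image \<phi> lower_iff ..
  ultimately show ?thesis
    unfolding tmod_iso_def
    by (intro exI[of _ \<phi>]) (auto simp: graded_carrier \<phi> graded_add graded_smult graded_act)
qed

theorem corollary1p10:
  fixes n :: nat
  shows
    "(\<forall>zs zs' :: complex list.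
        length zs = n \<longrightarrow> (\<forall>i<n. zs ! i \<noteq> 0) \<longrightarrow>
        (\<forall>i<n. \<forall>j<n. i \<noteq> j \<longrightarrow> (zs ! i)\<^sup>2 \<noteq> (zs ! j)\<^sup>2) \<longrightarrow>
        length zs' = n \<longrightarrow> (\<forall>i<n. zs' ! i \<noteq> 0) \<longrightarrow>
        (\<forall>i<n. \<forall>j<n. i \<noteq> j \<longrightarrow> (zs' ! i)\<^sup>2 \<noteq> (zs' ! j)\<^sup>2) \<longrightarrow>
        tmod_iso (graded_tensor zs) (graded_tensor zs'))
     \<and> is_basis_family (weyl_module n) (weyl_vec n) (weyl_index n)"
  using graded_tensor_iso weyl_basis by (simp add: admissible_def)

end
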